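(* Let $\mathcal{HM}$ be the Horrocks–Mumford bundle on $\mathbb P^4$ over $k$, defined as the cohomology $\ker q/\operatorname{im}p$ of the monad $$V(2)\xrightarrow{\;p\;}\Lambda^2\mathcal T\oplus\Lambda^2\mathcal T\xrightarrow{\;q\;}V^*(-2)\otimes\mathcal O(\partial\mathbb P^4)$$ described in the context, and let $K=K(\mathbb P^4)$. The canonical map $$K^2\to\mathcal{HM}_\eta,\qquad (f,g)\mapsto\big[(f\alpha^-,\,-g\alpha^+)\big]$$ is a (well-defined) isomorphism of $K$-vector spaces. Under this identification, the Weil decoration of $\mathcal{HM}$ is given as follows: put $$h_\nu=\frac{z_{\nu+1}z_{\nu-1}}{z_{\nu+2}z_{\nu-2}}\in\kappa(H_\nu)^*,\qquad \nu\in\mathbb Z/5\mathbb Z .$$ Then for all $(f,g)\in K^2\setminus\{(0,0)\}$ and all prime divisors $P$ of $\mathbb P^4$, $$\mathcal W_{\mathcal{HM}}(f,g)_P=\begin{cases}\min\{\mathrm{ord}_P(f),\mathrm{ord}_P(g)\}+1,&P=H_\nu\text{ for some }\nu\text{ and }\frac fg(H_\nu)=h_\nu,\\ \min\{\mathrm{ord}_P(f),\mathrm{ord}_P(g)\},&\text{else.}\end{cases}$$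
   Context: Conventions: $k$ is an algebraically closed field of characteristic $0$; $\mathcal O=\mathcal O_{\mathbb P^4}$, $\mathcal T$ is the tangent sheaf, $\Omega$ the cotangent sheaf of $\mathbb P^4$. $\eta$ is the generic point. $\mathrm{ord}_P$ is the valuation of the DVR $\mathcal O_{\mathbb P^4,P}$ of a prime divisor $P$ (with $\mathrm{ord}_P(0)=\infty$), $\kappa(P)$ its residue field; $f(P)\in\kappa(P)\cup\{\infty\}$ is the residue class of $f$ if $f\in\mathcal O_{\mathbb P^4,P}$ and $\infty$ otherwise ($f/0$ has value $\infty$ for $f\ne0$). $D_P$ is the coefficient of a divisor $D$ at $P$. Weil decoration of a reflexive sheaf $\mathcal E$ on a normal variety $X$ with function field $K$: regard $\mathcal E$ as subsheaf of the constant sheaf $\mathcal E_\eta$. For $0\ne e\in\mathcal E_\eta$ let $\mathcal E(e)(U)=(K\cdot e)\cap\mathcal E(U)$; there is a unique Weil divisor $D(e)$ with $\mathcal O_X(D(e))=\frac1e\mathcal E(e)\subseteq K$, where $\mathcal O_X(D)(U)=\{f\in K^*\mid(D+\mathrm{div} f)|_U\ge0\}\cup\{0\}$; set $\mathcal W_{\mathcal E}(e)=D(e)$. The monad. Let $V=k^5$ with standard basis indexed by $\mathbb Z/5\mathbb Z$ and written $\frac{\partial}{\partial z_0},\dots,\frac{\partial}{\partial z_4}$, dual basis $z_0,\dots,z_4$ of $V^*$ (homogeneous coordinates on $\mathbb P^4=\mathbb P(V)$), $H_\nu=\{z_\nu=0\}$, $\partial\mathbb P^4=\sum_{\nu}H_\nu$.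 For a $k$-vector space $W$ put $W(\ell)=W\otimes_k\mathcal O(\ell)$. The section $s=\sum_\nu\frac{\partial}{\partial z_\nu}\otimes z_\nu$ of $V(1)$ gives the dual Euler sequence $0\to\mathcal O\xrightarrow{s}V(1)\xrightarrow{\iota^*}\mathcal T\to0$. Let $p_0=\Lambda^2\iota^*\colon(\Lambda^2V)(2)\to\Lambda^2\mathcal T$, with dual $p_0^*\colon\Omega^2\to(\Lambda^2V^* )(-2)$. Let $\Phi\colon\Lambda^2\mathcal T\xrightarrow{\sim}\Omega^2\otimes\mathcal O(\partial\mathbb P^4)$ be the isomorphism induced by the perfect pairing $\Lambda^2\mathcal T\otimes\Lambda^2\mathcal T\to\Lambda^4\mathcal T\cong\mathcal O(\partial\mathbb P^4)$, and $q_0=p_0^*\circ\Phi\colon\Lambda^2\mathcal T\to(\Lambda^2V^* )(-2)\otimes\mathcal O(\partial\mathbb P^4)$ (with $p_0^*$ twisted by $\mathcal O(\partial\mathbb P^4)$). Define linear maps $f^\pm\colon V\to\Lambda^2V$ by $$f^+\big(\tfrac{\partial}{\partial z_\nu}\big)=\tfrac{\partial}{\partial z_{\nu+2}}\wedge\tfrac{\partial}{\partial z_{\nu-2}},\qquad f^-\big(\tfrac{\partial}{\partial z_\nu}\big)=\tfrac{\partial}{\partial z_{\nu+1}}\wedge\tfrac{\partial}{\partial z_{\nu-1}},$$ with dual maps $f_\pm=(f^\pm)^*\colon\Lambda^2V^*\to V^*$; the same symbols denote the induced (twisted) sheaf maps. Then $p=(p_0\circ f^+)\oplus(p_0\circ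 f^-)$ and $q=(f_-\circ q_0)\oplus(-f_+\circ q_0)$, i.e. $p(x)=(p_0f^+x,\,p_0f^-x)$ and $q(v^1,v^2)=f_-q_0v^1-f_+q_0v^2$. The sheaf $\mathcal{HM}=\ker q/\operatorname{im}p$ is a rank two vector bundle. The vectors $\alpha^\pm$. In the generic stalk $\mathcal T_\eta$ let $a_\nu$ be the image under $\iota^*_\eta$ of $z_\nu\frac{\partial}{\partial z_\nu}=\frac{\partial}{\partial z_\nu}\otimes z_\nu$, $\nu=0,\dots,4$, so $a_0+\dots+a_4=0$, and $a_1,\dots,a_4$ is a $K$-basis of $\mathcal T_\eta$; the identification $\Lambda^4\mathcal T\cong\mathcal O(\partial\mathbb P^4)$ is normalised by $a_1\wedge a_2\wedge a_3\wedge a_4\mapsto1$. Writing $[ij]=a_i\wedge a_j\in(\Lambda^2\mathcal T)_\eta$, set $\alpha^+=[13]+[23]+[24]$ and $\alpha^-=[12]+[14]+[34]$. The vectors $(f\alpha^-,-g\alpha^+)$ lie in $\ker q_\eta$, and $[\,\cdot\,]$ denotes the class in $\mathcal{HM}_\eta=\ker q_\eta/\operatorname{im}p_\eta$. *)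

theory Defs
  imports
    "HOL-Analysis.Finite_Cartesian_Product"
    "HOL-Library.Poly_Mapping"
    "HOL-Library.Numeral_Type"
    "HOL-Library.Product_Plus"
    "HOL-Library.Extended"
    "HOL-Computational_Algebra.Polynomial"
    "HOL-Computational_Algebra.Fraction_Field"
begin

section \<open>The homogeneous coordinate ring and \<open>\<P>\<^sup>4 = Proj k[z\<^sub>0,\<dots>,z\<^sub>4]\<close>\<close>

text \<open>
  The numeral type \<^typ>\<open>5\<close> with its ring structure serves as the index set \<open>\<int>/5\<int>\<close>.
  A monomial is a finitely supported exponent function. All rational functions and all
  sections of the sheaves \<open>\<O>(l)\<close> are realised inside the field of fractions of
  \<open>k[z\<^sub>0,\<dots>,z\<^sub>4]\<close>; the function field \<open>K\<close> is its part of degree 0.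
\<close>

type_synonym 'k hpoly = "(5 \<Rightarrow>\<^sub>0 nat) \<Rightarrow>\<^sub>0 'k"
type_synonym 'k hfrac = "'k hpoly fract"
type_synonym 'k point = "'k hpoly set"

definition Zvar :: "5 \<Rightarrow> 'k::field hpoly" where
  "Zvar \<nu> = Poly_Mapping.single (Poly_Mapping.single \<nu> 1) 1"

definition zf :: "5 \<Rightarrow> 'k::field hfrac" where
  "zf \<nu> = Fract (Zvar \<nu>) 1"

definition mdeg :: "(5 \<Rightarrow>\<^sub>0 nat) \<Rightarrow> nat" where
  "mdeg m = (\<Sum>\<nu>\<in>UNIV. Poly_Mapping.lookup m \<nu>)"

definition homog :: "nat \<Rightarrow> 'k::field hpoly \<Rightarrow> bool" where
  "homog d a \<longleftrightarrow> (\<forall>m\<in>Poly_Mapping.keys a. mdeg m = d)"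

definition hcomp :: "nat \<Rightarrow> 'k::field hpoly \<Rightarrow> 'k hpoly" where
  "hcomp d a = (\<Sum>m | m \<in> Poly_Mapping.keys a \<and> mdeg m = d.
      Poly_Mapping.single m (Poly_Mapping.lookup a m))"

definition homog_ideal :: "'k::field hpoly set \<Rightarrow> bool" where
  "homog_ideal I \<longleftrightarrow> 0 \<in> I \<and> (\<forall>a\<in>I. \<forall>b\<in>I. a + b \<in> I) \<and> (\<forall>a\<in>I. \<forall>r. r * a \<in> I)
     \<and> (\<forall>a\<in>I. \<forall>d. hcomp d a \<in> I)"

text \<open>Points are the homogeneous primes that do not contain the irrelevant ideal.\<close>

definition Proj4 :: "'k::field point set" where
  "Proj4 = {x. homog_ideal x \<and> 1 \<notin> x \<and> (\<forall>a b. a * b \<in> x \<longrightarrow> a \<in> x \<or> b \<in> x)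
     \<and> (\<exists>\<nu>. Zvar \<nu> \<notin> x)}"

definition zopen :: "'k::field point set \<Rightarrow> bool" where
  "zopen U \<longleftrightarrow> (\<exists>I. homog_ideal I \<and> U = {x \<in> Proj4. \<not> I \<subseteq> x})"

definition eta :: "'k::field point" where
  "eta = {0}"

text \<open>Prime divisors are identified with their generic points, the points of codimension one.\<close>

definition prime_divisors :: "'k::field point set" where
  "prime_divisors = {P \<in> Proj4. P \<noteq> eta \<and> \<not> (\<exists>y\<in>Proj4. eta \<subset> y \<and> y \<subset> P)}"

definition Hyp :: "5 \<Rightarrow> 'k::field point" where
  "Hyp \<nu> = {Zvar \<nu> * a | a. True}"

section \<open>Line bundles, local rings, valuations\<close>

definition twist_stalk :: "int \<Rightarrow> 'k::field point \<Rightarrow> 'k hfrac set" where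
  "twist_stalk l x = {Fract a b | a b d e.
      homog d a \<and> homog e b \<and> int d = int e + l \<and> b \<notin> x}"

text \<open>\<open>\<O>(l)\<close>, as a subsheaf of the constant sheaf of fractions of degree \<open>l\<close>
  (sections over non-empty open sets).\<close>

definition twist :: "int \<Rightarrow> 'k::field point set \<Rightarrow> 'k hfrac set" where
  "twist l U = {f. \<forall>x\<in>U. f \<in> twist_stalk l x}"

definition local_ring :: "'k::field point \<Rightarrow> 'k hfrac set" where
  "local_ring x = twist_stalk 0 x"

definition fun_field :: "'k::field hfrac set" where
  "fun_field = local_ring eta"

definition max_ideal :: "'k::field point \<Rightarrow> 'k hfrac set" where
  "max_ideal x = {Fract a b | a b d. homog d a \<and> homog d b \<and> a \<in> x \<and> b \<notin> x}"

definition ordP :: "'k::field point \<Rightarrow> 'k hfrac \<Rightarrow> int extended" where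
  "ordP P f = (if f = 0 then Pinf else
     Fin (THE n. \<exists>\<pi> u. max_ideal P = (\<lambda>r. \<pi> * r) ` local_ring P
                      \<and> u \<in> local_ring P \<and> inverse u \<in> local_ring P
                      \<and> f = u * power_int \<pi> n))"

text \<open>The residue field \<open>\<kappa>(P)\<close> consists of the cosets of \<^const>\<open>max_ideal\<close> in
  \<^const>\<open>local_ring\<close>; the value \<open>\<infinity>\<close> is represented by \<^const>\<open>None\<close>.\<close>

definition value_at :: "'k::field point \<Rightarrow> 'k hfrac \<Rightarrow> 'k hfrac set option" where
  "value_at P f = (if f \<in> local_ring P then Some {f + m | m. m \<in> max_ideal P} else None)"

text \<open>The value of \<open>f/g\<close> at \<open>P\<close>; division by zero has to be caught since \<open>f / 0 = 0\<close>
  in the library.\<close>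

definition quot_value_at :: "'k::field point \<Rightarrow> 'k hfrac \<Rightarrow> 'k hfrac \<Rightarrow> 'k hfrac set option" where
  "quot_value_at P f g = (if g = 0 then None else value_at P (f / g))"

section \<open>Weil divisors and Weil decorations\<close>

definition weil_divisor :: "('k::field point \<Rightarrow> int) \<Rightarrow> bool" where
  "weil_divisor D \<longleftrightarrow> finite {P. D P \<noteq> 0} \<and> {P. D P \<noteq> 0} \<subseteq> prime_divisors"

definition divisor_sheaf :: "('k::field point \<Rightarrow> int) \<Rightarrow> 'k point set \<Rightarrow> 'k hfrac set" where
  "divisor_sheaf D U =
     {f \<in> fun_field. f \<noteq> 0 \<and> (\<forall>P\<in>prime_divisors \<inter> U. 0 \<le> Fin (D P) + ordP P f)} \<union> {0}"

text \<open>
  A sheaf regarded as a subsheaf of the constant sheaf of its generic stalk is given by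
  its sets \<open>E U\<close> of sections over the non-empty open sets \<open>U\<close>; \<open>scl\<close> is the
  scalar multiplication of the generic stalk. The set on the right-hand side below is
  \<open>(1/e) ((K \<cdot> e) \<inter> E U)\<close>.
\<close>

definition weil_decoration ::
  "('k::field hfrac \<Rightarrow> 'e \<Rightarrow> 'e) \<Rightarrow> ('k point set \<Rightarrow> 'e set) \<Rightarrow> 'e \<Rightarrow> 'k point \<Rightarrow> int" where
  "weil_decoration scl E e = (THE D. weil_divisor D \<and>
     (\<forall>U. zopen U \<and> U \<noteq> {} \<longrightarrow> divisor_sheaf D U = {f \<in> fun_field. scl f e \<in> E U}))"

section \<open>Sheaf operations\<close>

text \<open>Stalks of, and sheafification for, sub-presheaves of a constant sheaf.\<close>

definition stalk :: "('k::field point set \<Rightarrow> 'e set) \<Rightarrow> 'k point \<Rightarrow> 'e set" where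
  "stalk E x = {e. \<exists>W. zopen W \<and> x \<in> W \<and> e \<in> E W}"

definition sheafify :: "('k::field point set \<Rightarrow> 'e set) \<Rightarrow> 'k point set \<Rightarrow> 'e set" where
  "sheafify E U = {e. \<forall>x\<in>U. \<exists>W. zopen W \<and> x \<in> W \<and> W \<subseteq> U \<and> e \<in> E W}"

definition lin_span :: "('r \<Rightarrow> 'e \<Rightarrow> 'e::comm_monoid_add) \<Rightarrow> 'r set \<Rightarrow> 'e set \<Rightarrow> 'e set" where
  "lin_span scl R G =
     {\<Sum>i<n. scl (c i) (g i) | (n::nat) c g. \<forall>i<n. c i \<in> R \<and> g i \<in> G}"

definition coset :: "'e::ab_group_add set \<Rightarrow> 'e \<Rightarrow> 'e set" where
  "coset N v = {v + n | n. n \<in> N}"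

definition coset_add :: "'e::ab_group_add set \<Rightarrow> 'e set \<Rightarrow> 'e set \<Rightarrow> 'e set" where
  "coset_add N A B = {a + b + n | a b n. a \<in> A \<and> b \<in> B \<and> n \<in> N}"

definition coset_scale ::
  "('r \<Rightarrow> 'e \<Rightarrow> 'e) \<Rightarrow> 'e::ab_group_add set \<Rightarrow> 'r \<Rightarrow> 'e set \<Rightarrow> 'e set" where
  "coset_scale scl N c A = {scl c a + n | a n. a \<in> A \<and> n \<in> N}"

text \<open>
  The quotient sheaf \<open>M/N\<close>: a section over \<open>U\<close> is a family of elements of the
  \<open>M\<^sub>x/N\<^sub>x\<close>, \<open>x \<in> U\<close>, which locally comes from sections of \<open>M\<close>.
\<close>

definition quot_sections ::
  "('k::field point set \<Rightarrow> 'e::ab_group_add set) \<Rightarrow> ('k point set \<Rightarrow> 'e set)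
     \<Rightarrow> 'k point set \<Rightarrow> ('k point \<Rightarrow> 'e set) set" where
  "quot_sections M N U = {s. (\<forall>x. x \<notin> U \<longrightarrow> s x = {}) \<and>
     (\<forall>x\<in>U. \<exists>W. zopen W \<and> x \<in> W \<and> W \<subseteq> U \<and>
        (\<exists>t\<in>M W. \<forall>y\<in>W. s y = coset (stalk N y) t))}"

definition quot_stalk ::
  "('k::field point set \<Rightarrow> 'e::ab_group_add set) \<Rightarrow> ('k point set \<Rightarrow> 'e set)
     \<Rightarrow> 'k point \<Rightarrow> 'e set set" where
  "quot_stalk M N x = coset (stalk N x) ` stalk M x"

text \<open>The image of the sections of \<open>M/N\<close> in the generic stalk \<open>M\<^sub>\<eta>/N\<^sub>\<eta>\<close>.\<close>

definition quot_in_generic ::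
  "('k::field point set \<Rightarrow> 'e::ab_group_add set) \<Rightarrow> ('k point set \<Rightarrow> 'e set)
     \<Rightarrow> 'k point set \<Rightarrow> 'e set set" where
  "quot_in_generic M N U = (\<lambda>s. s eta) ` quot_sections M N U"

section \<open>Exterior squares\<close>

text \<open>
  The exterior square of a free module with basis \<open>e\<^sub>i\<close> is the module of alternating
  matrices, \<open>e\<^sub>i \<and> e\<^sub>j\<close> corresponding to the matrix with entry \<open>1\<close> at \<open>(i,j)\<close> and
  \<open>-1\<close> at \<open>(j,i)\<close>; so \<open>A\<close> represents the sum of all \<open>A\<^sub>i\<^sub>j e\<^sub>i \<and> e\<^sub>j\<close>, \<open>i < j\<close>.
\<close>

definition wedge :: "'f::field^5 \<Rightarrow> 'f^5 \<Rightarrow> 'f^5^5" where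
  "wedge v w = (\<chi> i j. v$i * w$j - v$j * w$i)"

definition mscale :: "'f::field \<Rightarrow> 'f^5^5 \<Rightarrow> 'f^5^5" where
  "mscale c A = (\<chi> i j. c * A$i$j)"

definition ext2_map :: "('f::field^5 \<Rightarrow> 'f^5) \<Rightarrow> 'f^5^5 \<Rightarrow> 'f^5^5" where
  "ext2_map L A = (\<Sum>(i, j) | i < j. mscale (A$i$j) (wedge (L (axis i 1)) (L (axis j 1))))"

section \<open>The sheaves and maps of the Horrocks--Mumford monad\<close>

abbreviation dz :: "5 \<Rightarrow> 'f::field^5" where  \<comment> \<open>the basis vector \<open>\<partial>/\<partial>z\<^sub>\<nu>\<close> of \<open>V\<close>\<close>
  "dz \<nu> \<equiv> axis \<nu> 1"

definition Vtw :: "int \<Rightarrow> 'k::field point set \<Rightarrow> ('k hfrac^5) set" where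
  "Vtw l U = {v. \<forall>\<nu>. v$\<nu> \<in> twist l U}"

definition euler :: "'k::field hfrac^5" where
  "euler = (\<chi> \<nu>. zf \<nu>)"

text \<open>
  \<open>\<T>\<^sub>\<eta>\<close> is written in coordinates with respect to its basis \<open>a\<^sub>1,\<dots>,a\<^sub>4\<close>: a vector \<open>t\<close>
  with \<open>t\<^sub>0 = 0\<close> represents \<open>t\<^sub>1a\<^sub>1 + \<dots> + t\<^sub>4a\<^sub>4\<close>. Since \<open>\<partial>/\<partial>z\<^sub>\<nu> \<otimes> f\<close> maps to \<open>(f/z\<^sub>\<nu>) a\<^sub>\<nu>\<close>
  and \<open>a\<^sub>0 = -a\<^sub>1-\<dots>-a\<^sub>4\<close>, the projection \<open>\<iota>\<^sup>*\<close> of the dual Euler sequence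
  becomes the following map, which is extended linearly to all degrees. That it is a
  cokernel of \<open>s : \<O> \<rightarrow> V(1)\<close> is shown in \<open>iota_star_eq_0_iff\<close> below.
\<close>

definition iota_star :: "'k::field hfrac^5 \<Rightarrow> 'k hfrac^5" where
  "iota_star v = (\<chi> i. v$i / zf i - v$0 / zf 0)"

definition tangent :: "'k::field point set \<Rightarrow> ('k hfrac^5) set" where
  "tangent = sheafify (\<lambda>W. iota_star ` Vtw 1 W)"

text \<open>\<open>\<T>\<close> being locally free, \<open>\<Lambda>\<^sup>2\<T>\<close> is the subsheaf of the constant sheaf
  \<open>\<Lambda>\<^sup>2\<T>\<^sub>\<eta>\<close> generated by the products of sections of \<open>\<T>\<close>.\<close>

definition ext2_tangent :: "'k::field point set \<Rightarrow> ('k hfrac^5^5) set" where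
  "ext2_tangent = sheafify (\<lambda>W. lin_span mscale (twist 0 W)
     {wedge v w | v w. v \<in> tangent W \<and> w \<in> tangent W})"

definition p0 :: "'k::field hfrac^5^5 \<Rightarrow> 'k hfrac^5^5" where
  "p0 = ext2_map iota_star"

text \<open>The pairing \<open>\<Lambda>\<^sup>2\<T>\<^sub>\<eta> \<times> \<Lambda>\<^sup>2\<T>\<^sub>\<eta> \<rightarrow> \<Lambda>\<^sup>4\<T>\<^sub>\<eta> = K\<close>,
  normalised by \<open>a\<^sub>1 \<and> a\<^sub>2 \<and> a\<^sub>3 \<and> a\<^sub>4 \<mapsto> 1\<close>.\<close>

definition ext2_pair :: "'f::field^5^5 \<Rightarrow> 'f^5^5 \<Rightarrow> 'f" where
  "ext2_pair A B = A$1$2 * B$3$4 - A$1$3 * B$2$4 + A$1$4 * B$2$3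
                 + A$2$3 * B$1$4 - A$2$4 * B$1$3 + A$3$4 * B$1$2"

text \<open>
  The elements of \<open>\<Omega>\<^sup>2 = (\<Lambda>\<^sup>2\<T>)\<^sup>*\<close>, of \<open>\<Lambda>\<^sup>2V\<^sup>* = (\<Lambda>\<^sup>2V)\<^sup>*\<close> and of \<open>V\<^sup>*\<close>
  (with coefficients in the field of fractions) are represented as linear forms, and dual
  maps as precomposition. The twist by \<open>\<O>(\<partial>\<P>\<^sup>4)\<close> does not change generic stalks.
\<close>

definition Phi :: "'f::field^5^5 \<Rightarrow> ('f^5^5 \<Rightarrow> 'f)" where
  "Phi A = (\<lambda>B. ext2_pair A B)"

definition p0_dual :: "('k::field hfrac^5^5 \<Rightarrow> 'k hfrac) \<Rightarrow> ('k hfrac^5^5 \<Rightarrow> 'k hfrac)" where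
  "p0_dual \<omega> = \<omega> \<circ> p0"

definition q0 :: "'k::field hfrac^5^5 \<Rightarrow> ('k hfrac^5^5 \<Rightarrow> 'k hfrac)" where
  "q0 = p0_dual \<circ> Phi"

definition f_up_plus :: "'f::field^5 \<Rightarrow> 'f^5^5" where
  "f_up_plus x = (\<Sum>\<nu>\<in>UNIV. mscale (x$\<nu>) (wedge (dz (\<nu> + 2)) (dz (\<nu> - 2))))"

definition f_up_minus :: "'f::field^5 \<Rightarrow> 'f^5^5" where
  "f_up_minus x = (\<Sum>\<nu>\<in>UNIV. mscale (x$\<nu>) (wedge (dz (\<nu> + 1)) (dz (\<nu> - 1))))"

definition f_low_plus :: "('f::field^5^5 \<Rightarrow> 'f) \<Rightarrow> ('f^5 \<Rightarrow> 'f)" where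
  "f_low_plus \<omega> = \<omega> \<circ> f_up_plus"

definition f_low_minus :: "('f::field^5^5 \<Rightarrow> 'f) \<Rightarrow> ('f^5 \<Rightarrow> 'f)" where
  "f_low_minus \<omega> = \<omega> \<circ> f_up_minus"

type_synonym 'k pairs = "('k hfrac^5^5) \<times> ('k hfrac^5^5)"

definition monad_p :: "'k::field hfrac^5 \<Rightarrow> 'k pairs" where
  "monad_p x = (p0 (f_up_plus x), p0 (f_up_minus x))"

definition monad_q :: "'k::field pairs \<Rightarrow> ('k hfrac^5 \<Rightarrow> 'k hfrac)" where
  "monad_q = (\<lambda>(v1, v2) x. f_low_minus (q0 v1) x - f_low_plus (q0 v2) x)"

definition ker_q :: "'k::field point set \<Rightarrow> 'k pairs set" where
  "ker_q U = {v \<in> ext2_tangent U \<times> ext2_tangent U. monad_q v = (\<lambda>_. 0)}"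

definition im_p :: "'k::field point set \<Rightarrow> 'k pairs set" where
  "im_p = sheafify (\<lambda>W. monad_p ` Vtw 2 W)"

definition HM :: "'k::field point set \<Rightarrow> 'k pairs set set" where
  "HM = quot_in_generic ker_q im_p"

definition HM_eta :: "'k::field pairs set set" where
  "HM_eta = quot_stalk ker_q im_p eta"

definition pscale :: "'k::field hfrac \<Rightarrow> 'k pairs \<Rightarrow> 'k pairs" where
  "pscale c = map_prod (mscale c) (mscale c)"

definition HM_add :: "'k::field pairs set \<Rightarrow> 'k pairs set \<Rightarrow> 'k pairs set" where
  "HM_add = coset_add (stalk im_p eta)"

definition HM_scale :: "'k::field hfrac \<Rightarrow> 'k pairs set \<Rightarrow> 'k pairs set" where
  "HM_scale = coset_scale pscale (stalk im_p eta)"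

section \<open>The trivialisation of the generic stalk\<close>

definition avec :: "5 \<Rightarrow> 'k::field hfrac^5" where
  "avec \<nu> = iota_star (axis \<nu> (zf \<nu>))"

definition brk :: "5 \<Rightarrow> 5 \<Rightarrow> 'k::field hfrac^5^5" where
  "brk i j = wedge (avec i) (avec j)"

definition alpha_plus :: "'k::field hfrac^5^5" where
  "alpha_plus = brk 1 3 + brk 2 3 + brk 2 4"

definition alpha_minus :: "'k::field hfrac^5^5" where
  "alpha_minus = brk 1 2 + brk 1 4 + brk 3 4"

definition hm_vec :: "'k::field hfrac \<times> 'k hfrac \<Rightarrow> 'k pairs" where
  "hm_vec = (\<lambda>(f, g). (mscale f alpha_minus, - mscale g alpha_plus))"

definition hm_map :: "'k::field hfrac \<times> 'k hfrac \<Rightarrow> 'k pairs set" where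
  "hm_map fg = coset (stalk im_p eta) (hm_vec fg)"

definition hval :: "5 \<Rightarrow> 'k::field hfrac set option" where
  "hval \<nu> = value_at (Hyp \<nu>) (zf (\<nu> + 1) * zf (\<nu> - 1) / (zf (\<nu> + 2) * zf (\<nu> - 2)))"

section \<open>Consistency of the coordinate descriptions\<close>

lemma Zvar_neq_0 [simp]: "Zvar \<nu> \<noteq> (0 :: 'k::field hpoly)"
  unfolding Zvar_def by (metis lookup_single_eq lookup_zero zero_neq_one)

lemma zf_neq_0 [simp]: "zf \<nu> \<noteq> (0 :: 'k::field hfrac)"
  by (simp add: zf_def Zero_fract_def eq_fract)

lemma keys_Zvar: "Poly_Mapping.keys (Zvar \<nu> :: 'k::field hpoly) = {Poly_Mapping.single \<nu> 1}"
  by (simp add: Zvar_def)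

lemma homog_Zvar: "homog 1 (Zvar \<nu> :: 'k::field hpoly)"
  by (simp add: homog_def keys_Zvar mdeg_def lookup_single when_def)

lemma homog_mult:
  fixes a b :: "'k::field hpoly"
  assumes "homog d a" "homog e b"
  shows "homog (d + e) (a * b)"
proof -
  have "mdeg m = d + e" if mk: "m \<in> Poly_Mapping.keys (a * b)" for m
  proof -
    obtain m1 m2 where "m = m1 + m2" "m1 \<in> Poly_Mapping.keys a" "m2 \<in> Poly_Mapping.keys b"
      using subsetD[OF keys_mult mk] by auto
    then show ?thesis
      using assms by (simp add: homog_def mdeg_def lookup_add sum.distrib)
  qed
  then show ?thesis by (simp add: homog_def)
qed

lemma zopen_subset: "zopen U \<Longrightarrow> U \<subseteq> Proj4"
  by (auto simp: zopen_def)

lemma Proj4_0: "x \<in> Proj4 \<Longrightarrow> 0 \<in> x"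
  by (simp add: Proj4_def homog_ideal_def)

lemma zf_mult_stalk:
  assumes "x \<in> Proj4" "f \<in> twist_stalk l x"
  shows "zf \<nu> * f \<in> twist_stalk (l + 1) x"
proof -
  from assms(2) obtain a b d e where *: "f = Fract a b" "homog d a" "homog e b"
    "int d = int e + l" "b \<notin> x"
    by (auto simp: twist_stalk_def)
  have "zf \<nu> * f = Fract (Zvar \<nu> * a) b" by (simp add: * zf_def)
  moreover have "homog (1 + d) (Zvar \<nu> * a)" using homog_mult[OF homog_Zvar] * by blast
  moreover have "int (1 + d) = int e + (l + 1)" using * by simp
  ultimately show ?thesis using * unfolding twist_stalk_def by blast
qed

lemma zf_divide_stalk:
  assumes "x \<in> Proj4" "f \<in> twist_stalk (l + 1) x" "Zvar \<nu> \<notin> x"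
  shows "f / zf \<nu> \<in> twist_stalk l x"
proof -
  from assms(2) obtain a b d e where *: "f = Fract a b" "homog d a" "homog e b"
    "int d = int e + (l + 1)" "b \<notin> x"
    by (auto simp: twist_stalk_def)
  have "f / zf \<nu> = Fract a (Zvar \<nu> * b)"
    by (simp add: * zf_def mult.commute)
  moreover have "homog (1 + e) (Zvar \<nu> * b)" using homog_mult[OF homog_Zvar] * by blast
  moreover have "int d = int (1 + e) + l" using * by simp
  moreover have "Zvar \<nu> * b \<notin> x" using assms * by (auto simp: Proj4_def)
  ultimately show ?thesis using * unfolding twist_stalk_def by blast
qed

text \<open>Exactness of \<open>0 \<rightarrow> \<O> \<rightarrow> V(1) \<rightarrow> \<T>\<close> on sections; by definition \<open>\<T>\<close> is the image
  sheaf of \<open>\<iota>\<^sup>*\<close>.\<close>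

lemma iota_star_eq_0_iff:
  fixes v :: "'k::field hfrac^5"
  assumes "zopen U" "U \<noteq> {}" "v \<in> Vtw 1 U"
  shows "iota_star v = 0 \<longleftrightarrow> (\<exists>c \<in> twist 0 U. v = c *s euler)"
proof
  assume *: "iota_star v = 0"
  define c where "c = v$0 / zf 0"
  have eq: "v$\<nu> = c * zf \<nu>" for \<nu>
  proof -
    have "iota_star v $ \<nu> = 0" using * by simp
    then have "v$\<nu> / zf \<nu> = c" by (simp add: iota_star_def c_def)
    then show ?thesis by (auto simp: field_simps)
  qed
  have "c \<in> twist_stalk 0 x" if "x \<in> U" for x
  proof -
    have x: "x \<in> Proj4" using that assms(1) zopen_subset by blast
    then obtain \<nu> where \<nu>: "Zvar \<nu> \<notin> x" by (auto simp: Proj4_def)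
    have "v$\<nu> \<in> twist_stalk (0 + 1) x" using assms(3) that by (simp add: Vtw_def twist_def)
    from zf_divide_stalk[OF x this \<nu>] show ?thesis by (simp add: eq)
  qed
  then show "\<exists>c \<in> twist 0 U. v = c *s euler"
    by (intro bexI[of _ c]) (auto simp: twist_def euler_def vec_eq_iff eq)
next
  assume "\<exists>c \<in> twist 0 U. v = c *s euler"
  then show "iota_star v = 0"
    by (auto simp: iota_star_def euler_def vec_eq_iff)
qed

lemma avec_eq_axis: "\<nu> \<noteq> 0 \<Longrightarrow> avec \<nu> = axis \<nu> 1"
  by (auto simp: avec_def iota_star_def axis_def vec_eq_iff)

lemma sum_avec: "(\<Sum>\<nu>\<in>UNIV. avec \<nu>) = (0 :: 'k::field hfrac^5)"
  by (auto simp: avec_def iota_star_def axis_def vec_eq_iff sum_subtractf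
      if_distrib[of "\<lambda>t. t / _"] cong: if_cong)

lemma ext2_pair_wedge_normalised: "ext2_pair (brk 1 2) (brk 3 4) = (1 :: 'k::field hfrac)"
  by (simp add: ext2_pair_def brk_def avec_eq_axis wedge_def axis_def)

lemma ext2_pair_wedge_alternating:
  "ext2_pair (wedge v w) (wedge v u) = (0 :: 'f::field)"
  "ext2_pair (wedge v w) (wedge u v) = (0 :: 'f::field)"
  "ext2_pair (wedge w v) (wedge v u) = (0 :: 'f::field)"
  "ext2_pair (wedge w v) (wedge u v) = (0 :: 'f::field)"
  by (simp_all add: ext2_pair_def wedge_def algebra_simps)

text \<open>\<^const>\<open>p0\<close> is indeed \<open>\<Lambda>\<^sup>2\<iota>\<^sup>*\<close>.\<close>

lemma sum_pairs_split:
  fixes g :: "5 \<Rightarrow> 5 \<Rightarrow> 'f::field"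
  assumes diag: "\<And>i. g i i = 0"
  shows "(\<Sum>i\<in>UNIV. \<Sum>j\<in>UNIV. g i j) = (\<Sum>(i, j) | i < j. g i j + g j i)"
proof -
  have un: "(UNIV :: (5 \<times> 5) set) =
      ({(i, j). i < j} \<union> prod.swap ` {(i, j). i < j}) \<union> {(i, j). i = j}"
    by (force simp: image_iff)
  have "(\<Sum>i\<in>UNIV. \<Sum>j\<in>UNIV. g i j) = (\<Sum>(i, j)\<in>UNIV. g i j)"
    by (simp add: sum.cartesian_product)
  also have "\<dots> = (\<Sum>(i, j)\<in>{(i, j). i < j} \<union> prod.swap ` {(i, j). i < j}. g i j)
      + (\<Sum>(i, j) | i = j. g i j)"
    unfolding un by (rule sum.union_disjoint) (auto simp: finite_subset[OF subset_UNIV])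
  also have "(\<Sum>(i, j) | i = j. g i j) = 0"
    by (rule sum.neutral) (auto simp: diag)
  also have "(\<Sum>(i, j)\<in>{(i, j). i < j} \<union> prod.swap ` {(i, j). i < j}. g i j)
      = (\<Sum>(i, j) | i < j. g i j) + (\<Sum>(i, j)\<in>prod.swap ` {(i, j). i < j}. g i j)"
    by (rule sum.union_disjoint) (auto simp: finite_subset[OF subset_UNIV])
  also have "(\<Sum>(i, j)\<in>prod.swap ` {(i, j). i < j}. g i j) = (\<Sum>(i, j) | i < j. g j i)"
    by (subst sum.reindex) (auto simp: case_prod_unfold inj_on_def)
  finally show ?thesis by (simp add: sum.distrib case_prod_unfold)
qed

lemma iota_star_expand:
  "iota_star v $ i = (\<Sum>\<mu>\<in>UNIV. v$\<mu> * (iota_star (axis \<mu> 1) $ i))"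
  for v :: "'k::field hfrac^5"
proof -
  have "(\<Sum>\<mu>\<in>UNIV. v$\<mu> * (iota_star (axis \<mu> 1) $ i)) =
      (\<Sum>\<mu>\<in>UNIV. (if \<mu> = i then v$\<mu> / zf i else 0) - (if \<mu> = 0 then v$\<mu> / zf 0 else 0))"
    by (intro sum.cong refl) (auto simp: iota_star_def axis_def algebra_simps)
  also have "\<dots> = iota_star v $ i"
    by (simp add: sum_subtractf iota_star_def)
  finally show ?thesis ..
qed

lemma p0_wedge: "p0 (wedge v w) = wedge (iota_star v) (iota_star w)"
  for v w :: "'k::field hfrac^5"
proof -
  have "p0 (wedge v w) $ i $ j = wedge (iota_star v) (iota_star w) $ i $ j" for i j
  proof -
    define x where "x = (\<lambda>\<mu>. iota_star (axis \<mu> 1 :: 'k hfrac^5) $ i)"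
    define y where "y = (\<lambda>\<mu>. iota_star (axis \<mu> 1 :: 'k hfrac^5) $ j)"
    have e: "iota_star v $ i = (\<Sum>\<mu>\<in>UNIV. v$\<mu> * x \<mu>)" "iota_star v $ j = (\<Sum>\<mu>\<in>UNIV. v$\<mu> * y \<mu>)"
         "iota_star w $ i = (\<Sum>\<mu>\<in>UNIV. w$\<mu> * x \<mu>)" "iota_star w $ j = (\<Sum>\<mu>\<in>UNIV. w$\<mu> * y \<mu>)"
      by (simp_all only: iota_star_expand[of v] iota_star_expand[of w] x_def y_def)
    have "p0 (wedge v w) $ i $ j =
        (\<Sum>(\<mu>, \<nu>) | \<mu> < \<nu>. (v$\<mu> * w$\<nu> - v$\<nu> * w$\<mu>) * (x \<mu> * y \<nu> - y \<mu> * x \<nu>))"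
      by (simp add: p0_def ext2_map_def mscale_def wedge_def x_def y_def case_prod_unfold)
    also have "\<dots> = (\<Sum>\<mu>\<in>UNIV. \<Sum>\<nu>\<in>UNIV. v$\<mu> * w$\<nu> * (x \<mu> * y \<nu> - y \<mu> * x \<nu>))"
      by (subst sum_pairs_split) (auto intro!: sum.cong simp: algebra_simps)
    also have "\<dots> = iota_star v $ i * iota_star w $ j - iota_star v $ j * iota_star w $ i"
      unfolding e sum_product sum_subtractf[symmetric]
      by (intro sum.cong refl) (simp add: algebra_simps)
    finally show ?thesis by (simp add: wedge_def)
  qed
  then show ?thesis by (simp add: vec_eq_iff)
qed

end

theory Submission
  imports Defs "Berlekamp_Zassenhaus.Unique_Factorization_Poly"
begin

text \<open>
  An alternating matrix \<open>B\<close> representing an element of \<open>\<Lambda>\<^sup>2\<T>\<^sub>\<eta>\<close> is determined by the ten numbers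
  \<open>B\<^sub>k\<^sub>l + B\<^sub>l\<^sub>m + B\<^sub>m\<^sub>k\<close>, and it belongs to the stalk of \<open>\<Lambda>\<^sup>2\<T>\<close> at \<open>x\<close> iff all products of these
  with \<open>z\<^sub>k z\<^sub>l z\<^sub>m\<close> belong to \<open>\<O>(3)\<^sub>x\<close>. In these coordinates the monad becomes explicit: at the generic
  point every class in \<open>ker q / im p\<close> has a unique representative \<open>(f \<alpha>\<^sup>-, -g \<alpha>\<^sup>+)\<close>, and \<open>(f, g)\<close> lies in
  the stalk at \<open>x\<close> iff there is \<open>w \<in> V(2)\<^sub>\<eta>\<close> such that, for all \<open>\<nu>\<close>,
  \<open>z\<^sub>\<nu>w\<^sub>\<nu>\<close>, \<open>z\<^sub>\<nu>z\<^sub>\<nu>\<^sub>+\<^sub>1z\<^sub>\<nu>\<^sub>-\<^sub>1f + z\<^sub>\<nu>\<^sub>+\<^sub>1w\<^sub>\<nu>\<^sub>+\<^sub>2 + z\<^sub>\<nu>\<^sub>-\<^sub>1w\<^sub>\<nu>\<^sub>-\<^sub>2\<close> and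
  \<open>z\<^sub>\<nu>z\<^sub>\<nu>\<^sub>+\<^sub>2z\<^sub>\<nu>\<^sub>-\<^sub>2g + z\<^sub>\<nu>\<^sub>-\<^sub>2w\<^sub>\<nu>\<^sub>+\<^sub>1 + z\<^sub>\<nu>\<^sub>+\<^sub>2w\<^sub>\<nu>\<^sub>-\<^sub>1\<close> lie in \<open>\<O>(3)\<^sub>x\<close>.
  As \<open>p\<close> is injective on fibres, \<open>w\<close> can be normalised near \<open>x\<close>, so that by unique factorisation the condition
  at \<open>x\<close> follows from the conditions at the prime divisors through \<open>x\<close>. At a prime divisor other than the
  \<open>H\<^sub>\<nu>\<close> the condition says that \<open>f\<close> and \<open>g\<close> are regular; at \<open>H\<^sub>\<nu>\<close> it says that both have at most a simple
  pole and that \<open>f - h\<^sub>\<nu>g\<close> is regular.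
\<close>

text \<open>The conditions at the prime divisors through x come with a witness w for each divisor,
  and these must be replaced by a single one. Two witnesses at the same point differ by an element
  of V(2)_x, so any w that is right up to regular terms will do. In a chart z_n \<noteq> 0 exactly
  five of the fifteen conditions contain a coordinate of w with the factor z_n. Required to vanish
  instead of being regular, they determine w over K independently of the divisor. The determinant of
  this system is z_n times \<open>deltaf n\<close>, up to sign. It may vanish at x, but only if all
  five coordinates are units at x; there the divisors already force f and g to be regular, and w = 0
  is a witness. The same dichotomy shows that p is injective on fibres. The function h_\<nu> has its
  origin in an elimination: at H_\<nu> only w_\<nu> can be singular, and it occurs both in
  conditions with f and in conditions with g. Removing it leaves the regularity of f - h_\<nu>
  g.\<close>

no_notation Matrix.vec_index (infixl "$" 100)
hide_fact (open) Matrix.vec_eq_iff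

section \<open>Arithmetic and case distinction in the index set Z/5\<close>

lemma num5_eqs [simp]:
  "(5::5) = 0" "(6::5) = 1" "(7::5) = 2" "(8::5) = 3" "(9::5) = 4"
  "(-1::5) = 4" "(-2::5) = 3" "(-3::5) = 2" "(-4::5) = 1"
  by simp_all

lemma exhaust_5: "(x::5) = 0 \<or> x = 1 \<or> x = 2 \<or> x = 3 \<or> x = 4"
proof (cases x)
  case (of_int z)
  then have "z = 0 \<or> z = 1 \<or> z = 2 \<or> z = 3 \<or> z = 4" by auto
  then show ?thesis using of_int by auto
qed

lemma UNIV_5: "(UNIV :: 5 set) = {0, 1, 2, 3, 4}"
  using exhaust_5 by auto

lemma forall_5: "(\<forall>x::5. P x) \<longleftrightarrow> P 0 \<and> P 1 \<and> P 2 \<and> P 3 \<and> P 4"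
  by (metis exhaust_5)

lemma sum_5: "(\<Sum>x\<in>(UNIV::5 set). f x) = f 0 + f 1 + f 2 + f 3 + f 4"
  unfolding UNIV_5 by (simp add: add.assoc)

section \<open>Factorisation of homogeneous polynomials\<close>

definition mon_lift :: "((5 \<Rightarrow>\<^sub>0 nat) \<Rightarrow> 'k \<Rightarrow> 'b) \<Rightarrow> 'k::field hpoly \<Rightarrow> 'b::comm_ring_1" where
  "mon_lift \<mu> a = (\<Sum>m\<in>Poly_Mapping.keys a. \<mu> m (Poly_Mapping.lookup a m))"

lemma hpoly_expand:
  "a = (\<Sum>m\<in>Poly_Mapping.keys a. Poly_Mapping.single m (Poly_Mapping.lookup a m))"
  by (rule poly_mapping_eqI) (simp add: lookup_sum lookup_single when_def in_keys_iff)

text \<open>A map on single terms that is additive in the coefficient and multiplicative on products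
  of terms extends to a ring homomorphism. Two instances follow: the passage to nested univariate
  polynomials and the grading by degree.\<close>

locale mon_mult =
  fixes \<mu> :: "(5 \<Rightarrow>\<^sub>0 nat) \<Rightarrow> 'k::field \<Rightarrow> 'b::comm_ring_1"
  assumes \<mu>_add: "\<mu> m (c + d) = \<mu> m c + \<mu> m d"
    and \<mu>_mult: "\<mu> (m + n) (c * d) = \<mu> m c * \<mu> n d"
    and \<mu>_one: "\<mu> 0 1 = 1"
begin

lemma \<mu>_0 [simp]: "\<mu> m 0 = 0"
  using \<mu>_add[of m 0 0] by simp

lemma lift_superset:
  assumes "finite S" "Poly_Mapping.keys a \<subseteq> S"
  shows "mon_lift \<mu> a = (\<Sum>m\<in>S. \<mu> m (Poly_Mapping.lookup a m))"
  unfolding mon_lift_def using assms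
  by (intro sum.mono_neutral_left) (auto simp: in_keys_iff)

lemma lift_add: "mon_lift \<mu> (a + b) = mon_lift \<mu> a + mon_lift \<mu> b"
proof -
  let ?S = "Poly_Mapping.keys a \<union> Poly_Mapping.keys b"
  have "Poly_Mapping.keys (a + b) \<subseteq> ?S" by (rule Poly_Mapping.keys_add)
  then show ?thesis
    by (simp add: lift_superset[where S = ?S] lookup_add \<mu>_add sum.distrib)
qed

lemma lift_0 [simp]: "mon_lift \<mu> 0 = 0"
  by (simp add: mon_lift_def)

lemma lift_single [simp]: "mon_lift \<mu> (Poly_Mapping.single m c) = \<mu> m c"
  by (simp add: mon_lift_def)

lemma lift_1 [simp]: "mon_lift \<mu> 1 = 1"
  using lift_single[of 0 1] by (simp add: \<mu>_one)

lemma lift_sum: "mon_lift \<mu> (\<Sum>i\<in>I. f i) = (\<Sum>i\<in>I. mon_lift \<mu> (f i))"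
  by (induction I rule: infinite_finite_induct) (simp_all add: lift_add)

lemma lift_mult: "mon_lift \<mu> (a * b) = mon_lift \<mu> a * mon_lift \<mu> b"
proof -
  have "a * b = (\<Sum>m\<in>Poly_Mapping.keys a. \<Sum>n\<in>Poly_Mapping.keys b.
      Poly_Mapping.single (m + n) (Poly_Mapping.lookup a m * Poly_Mapping.lookup b n))"
    using arg_cong2[OF hpoly_expand[of a] hpoly_expand[of b], of "(*)"]
    by (simp add: sum_product mult_single)
  then show ?thesis
    by (simp add: lift_sum \<mu>_mult) (simp add: mon_lift_def sum_product)
qed

end

text \<open>The exponent of z_0 belongs to the outermost polynomial layer, that of z_4 to the
  innermost one, next to the field.\<close>

definition mon5 :: "(5 \<Rightarrow>\<^sub>0 nat) \<Rightarrow> 'k::field \<Rightarrow> 'k poly poly poly poly poly" where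
  "mon5 m c = monom (monom (monom (monom (monom c (Poly_Mapping.lookup m 4))
     (Poly_Mapping.lookup m 3)) (Poly_Mapping.lookup m 2)) (Poly_Mapping.lookup m 1)) (Poly_Mapping.lookup m 0)"

interpretation mon5: mon_mult mon5
  by standard (simp_all add: mon5_def add_monom mult_monom lookup_add)

abbreviation to_poly :: "'k::field hpoly \<Rightarrow> 'k poly poly poly poly poly" where
  "to_poly \<equiv> mon_lift mon5"

lemma coeff_to_poly:
  "coeff (coeff (coeff (coeff (coeff (to_poly a) (Poly_Mapping.lookup m 0)) (Poly_Mapping.lookup m 1))
     (Poly_Mapping.lookup m 2)) (Poly_Mapping.lookup m 3)) (Poly_Mapping.lookup m 4) = Poly_Mapping.lookup a m"
proof -
  have eq: "m' = m \<longleftrightarrow> Poly_Mapping.lookup m' 0 = Poly_Mapping.lookup m 0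
    \<and> Poly_Mapping.lookup m' 1 = Poly_Mapping.lookup m 1 \<and> Poly_Mapping.lookup m' 2 = Poly_Mapping.lookup m 2
    \<and> Poly_Mapping.lookup m' 3 = Poly_Mapping.lookup m 3 \<and> Poly_Mapping.lookup m' 4 = Poly_Mapping.lookup m 4" for m'
    by (auto simp: poly_mapping_eq_iff fun_eq_iff forall_5)
  have "coeff (coeff (coeff (coeff (coeff (mon5 m' c) (Poly_Mapping.lookup m 0)) (Poly_Mapping.lookup m 1))
     (Poly_Mapping.lookup m 2)) (Poly_Mapping.lookup m 3)) (Poly_Mapping.lookup m 4) = (if m' = m then c else 0)" for m' and c :: 'a
    by (simp add: mon5_def eq)
  then show ?thesis
    by (simp add: mon_lift_def coeff_sum in_keys_iff)
qed

lemma inj_to_poly: "inj to_poly"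
proof (rule injI)
  fix a b :: "'k::field hpoly" assume "to_poly a = to_poly b"
  then show "a = b" by (intro poly_mapping_eqI) (metis coeff_to_poly)
qed

lemma poly_monom_induct:
  assumes "P 0" "\<And>p q. P p \<Longrightarrow> P q \<Longrightarrow> P (p + q)" "\<And>c n. P (monom c n)"
  shows "P (p :: 'a::comm_monoid_add poly)"
proof -
  have "P (\<Sum>i\<in>I. monom (coeff p i) i)" for I
    by (induction I rule: infinite_finite_induct) (use assms in auto)
  then show ?thesis by (metis poly_as_sum_of_monoms)
qed

text \<open>The range is additively closed and contains all fully nested monomials. The layers are
  filled from the innermost to the outermost, each time by writing a polynomial as a sum of its
  monomials.\<close>

lemma surj_to_poly: "surj (to_poly :: 'k::field hpoly \<Rightarrow> _)"
proof -
  let ?S = "range (to_poly :: 'k hpoly \<Rightarrow> _)"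
  have 0: "0 \<in> ?S" by (rule image_eqI[where x = 0]) simp_all
  have add: "p + q \<in> ?S" if "p \<in> ?S" "q \<in> ?S" for p q
  proof -
    from that obtain a b where "p = to_poly a" "q = to_poly b" by blast
    then have "p + q = to_poly (a + b)" by (simp add: mon5.lift_add)
    then show ?thesis by blast
  qed
  have 5: "monom (monom (monom (monom (monom c e) d) n) b) a \<in> ?S" for a b n d e c
  proof -
    define f where "f = (\<lambda>i::5. if i = 0 then a else if i = 1 then b else if i = 2 then n
      else if i = 3 then d else e)"
    define m where "m = Abs_poly_mapping f"
    have "Poly_Mapping.lookup m = f" unfolding m_def by simp
    then have "mon5 m c = monom (monom (monom (monom (monom c e) d) n) b) a"
      by (simp add: mon5_def f_def)
    then have "to_poly (Poly_Mapping.single m c) = monom (monom (monom (monom (monom c e) d) n) b) a"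
      by simp
    then show ?thesis by (rule range_eqI[OF sym])
  qed
  have 4: "monom (monom (monom (monom q d) n) b) a \<in> ?S" for a b n d q
    by (induction q rule: poly_monom_induct) (use 0 add 5 in \<open>simp_all add: add_monom[symmetric]\<close>)
  have 3: "monom (monom (monom q n) b) a \<in> ?S" for a b n q
    by (induction q rule: poly_monom_induct) (use 0 add 4 in \<open>simp_all add: add_monom[symmetric]\<close>)
  have 2: "monom (monom q b) a \<in> ?S" for a b q
    by (induction q rule: poly_monom_induct) (use 0 add 3 in \<open>simp_all add: add_monom[symmetric]\<close>)
  have 1: "monom q a \<in> ?S" for a q
    by (induction q rule: poly_monom_induct) (use 0 add 2 in \<open>simp_all add: add_monom[symmetric]\<close>)
  have "q \<in> ?S" for q
    by (induction q rule: poly_monom_induct) (use 0 add 1 in simp_all)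
  then show ?thesis by blast
qed

text \<open>By surjectivity every cofactor on the polynomial side comes from an
  \<open>hpoly\<close>, and injectivity brings the equation back; hence primality can be pulled
  back.\<close>

lemma to_poly_dvd_iff: "to_poly a dvd to_poly b \<longleftrightarrow> a dvd b"
proof
  assume "to_poly a dvd to_poly b"
  then obtain q where "to_poly b = to_poly a * q" by (rule dvdE)
  moreover obtain c where "q = to_poly c" using surjD[OF surj_to_poly] by blast
  ultimately have "to_poly b = to_poly (a * c)" by (simp add: mon5.lift_mult)
  then have "b = a * c" by (rule injD[OF inj_to_poly])
  then show "a dvd b" by simp
next
  assume "a dvd b"
  then obtain c where "b = a * c" by (rule dvdE)
  then show "to_poly a dvd to_poly b" by (simp add: mon5.lift_mult)
qed

lemma prime_elem_to_poly: "prime_elem (to_poly a) \<Longrightarrow> prime_elem a"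
proof (rule prime_elemI)
  assume p: "prime_elem (to_poly a)"
  show "a \<noteq> 0" using p mon5.lift_0 by (auto simp: prime_elem_def)
  show "\<not> a dvd 1" using p to_poly_dvd_iff[of a 1] by (auto simp: prime_elem_def)
  fix b c assume "a dvd b * c"
  then have "to_poly a dvd to_poly b * to_poly c"
    by (simp add: to_poly_dvd_iff flip: mon5.lift_mult)
  with p have "to_poly a dvd to_poly b \<or> to_poly a dvd to_poly c"
    by (rule prime_elem_dvd_multD)
  then show "a dvd b \<or> a dvd c" by (simp only: to_poly_dvd_iff)
qed

text \<open>By Gauss's lemma the iterated polynomial ring over a field is factorial, so irreducible
  factors there are prime and pull back to primes. \<open>mset_factors\<close> does not cover units;
  a unit is returned as \<open>u\<close> with the empty multiset.\<close>

theorem hpoly_factorization: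
  fixes a :: "'k::field hpoly"
  assumes "a \<noteq> 0"
  obtains u F where "u dvd 1" "a = u * prod_mset F" "\<And>p. p \<in># F \<Longrightarrow> prime_elem p"
proof (cases "a dvd 1")
  case True
  then show ?thesis using that[of a "{#}"] by simp
next
  case False
  have "to_poly a \<noteq> 0" using assms injD[OF inj_to_poly, of a 0] by auto
  moreover have "\<not> to_poly a dvd 1" using False to_poly_dvd_iff[of a 1] by simp
  ultimately obtain F where F: "mset_factors F (to_poly a)" using mset_factors_exist by blast
  define g where "g = inv_into UNIV (to_poly :: 'k hpoly \<Rightarrow> _)"
  have g: "to_poly (g q) = q" for q unfolding g_def using surj_to_poly by (rule surj_f_inv_f)
  have "to_poly (prod_mset (image_mset g F)) = prod_mset F"
    by (induction F) (simp_all add: mon5.lift_mult g)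
  then have "to_poly a = to_poly (prod_mset (image_mset g F))"
    using F by (simp add: mset_factors_def)
  then have "a = prod_mset (image_mset g F)" by (rule injD[OF inj_to_poly])
  moreover have "prime_elem p" if "p \<in># image_mset g F" for p
  proof -
    from that obtain q where "q \<in># F" "p = g q" by auto
    then have "irreducible (to_poly p)" using mset_factorsD(1)[OF F] by (simp add: g)
    then show ?thesis by (intro prime_elem_to_poly) simp
  qed
  ultimately show ?thesis using that[of 1 "image_mset g F"] by simp
qed

section \<open>Degrees and divisors of homogeneous polynomials\<close>

definition grmon :: "(5 \<Rightarrow>\<^sub>0 nat) \<Rightarrow> 'k::field \<Rightarrow> 'k hpoly poly" where
  "grmon m c = monom (Poly_Mapping.single m c) (mdeg m)"

lemma mdeg_add: "mdeg (m + n) = mdeg m + mdeg n"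
  by (simp add: mdeg_def lookup_add sum.distrib)

interpretation gr: mon_mult grmon
  by standard (simp_all add: grmon_def single_add add_monom mult_monom mult_single mdeg_add,
      simp add: mdeg_def)

text \<open>The ring homomorphism \<open>a(z) \<mapsto> a(t z)\<close>; it turns homogeneous components into coefficients.\<close>

abbreviation gr :: "'k::field hpoly \<Rightarrow> 'k hpoly poly" where
  "gr \<equiv> mon_lift grmon"

lemma coeff_gr: "coeff (gr a) d = hcomp d a"
proof -
  have "coeff (gr a) d = (\<Sum>m\<in>Poly_Mapping.keys a. if mdeg m = d
      then Poly_Mapping.single m (Poly_Mapping.lookup a m) else 0)"
    by (simp add: mon_lift_def grmon_def coeff_sum)
  also have "\<dots> = hcomp d a"
    unfolding hcomp_def by (subst sum.inter_filter[symmetric]) simp_all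
  finally show ?thesis .
qed

lemma lookup_hcomp: "Poly_Mapping.lookup (hcomp d a) m = (if mdeg m = d then Poly_Mapping.lookup a m else 0)"
proof -
  have "Poly_Mapping.lookup (hcomp d a) m =
      (\<Sum>n | n \<in> Poly_Mapping.keys a \<and> mdeg n = d. if n = m then Poly_Mapping.lookup a n else 0)"
    by (simp add: hcomp_def lookup_sum lookup_single when_def)
  also have "\<dots> = (if mdeg m = d then Poly_Mapping.lookup a m else 0)"
    by (subst sum.delta) (auto simp: in_keys_iff)
  finally show ?thesis .
qed

lemma homog_hcomp: "homog d (hcomp d a)"
  by (auto simp: homog_def in_keys_iff lookup_hcomp split: if_splits)

lemma hcomp_homog: "homog d a \<Longrightarrow> hcomp e a = (if e = d then a else 0)"
  by (rule poly_mapping_eqI) (auto simp: homog_def in_keys_iff lookup_hcomp)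

lemma gr_homog: "homog d a \<Longrightarrow> gr a = monom a d"
  by (rule poly_eqI) (simp add: coeff_gr hcomp_homog)

lemma homogI: "(\<And>e. e \<noteq> d \<Longrightarrow> hcomp e a = 0) \<Longrightarrow> homog d a"
proof (unfold homog_def, rule ballI, rule ccontr)
  fix m assume *: "\<And>e. e \<noteq> d \<Longrightarrow> hcomp e a = 0" "m \<in> Poly_Mapping.keys a" "mdeg m \<noteq> d"
  then have "Poly_Mapping.lookup (hcomp (mdeg m) a) m = 0" by simp
  with *(2) show False by (simp add: lookup_hcomp in_keys_iff)
qed

text \<open>Under \<open>gr\<close> the homogeneous factor becomes a monomial in t, and
  multiplication by it shifts the coefficients by its degree.\<close>

lemma hcomp_mult_homog:
  assumes "homog e b"
  shows "hcomp d (a * b) = (if d < e then 0 else hcomp (d - e) a * b)"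
  unfolding coeff_gr[symmetric] gr.lift_mult gr_homog[OF assms]
  by (subst mult.commute) (simp add: coeff_monom_mult coeff_gr)

text \<open>Degree and order of vanishing at 0 are additive and agree on a monomial. As the order
  never exceeds the degree, they agree on each factor as well, which forces the factor to be a
  monomial.\<close>

lemma monom_factor:
  fixes p q :: "'a::idom poly"
  assumes "p * q = monom c d" "c \<noteq> 0"
  obtains e where "p = monom (coeff p e) e"
proof -
  have nz: "p \<noteq> 0" "q \<noteq> 0" using assms by auto
  have "degree p + degree q = d" using assms nz by (metis degree_monom_eq degree_mult_eq)
  moreover have "Polynomial.order 0 p + Polynomial.order 0 q = d"
  proof -
    have "Polynomial.order 0 (monom c d) = d"
      using assms(2) by (rule order_0_monom)
    then show ?thesis using assms nz by (metis monom_eq_0_iff order_mult)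
  qed
  moreover have "Polynomial.order 0 p \<le> degree p" "Polynomial.order 0 q \<le> degree q" using nz by (simp_all add: order_degree)
  ultimately have o: "Polynomial.order 0 p = degree p" by simp
  have "[:- 0, 1:] ^ Polynomial.order 0 p dvd p" by (rule order_1)
  then have "monom 1 (degree p) dvd p" by (simp add: o monom_altdef)
  then obtain r where r: "p = monom 1 (degree p) * r" by (rule dvdE)
  then have "degree p = degree p + degree r"
    using nz by (metis degree_monom_eq degree_mult_eq mult_zero_left mult_zero_right zero_neq_one)
  then obtain s where "r = [:s:]" by (metis add_cancel_right_right degree_eq_zeroE)
  with r have "p = monom s (degree p)" by (metis monom_0 mult_monom add_0_right mult_1)
  then have "p = monom (coeff p (degree p)) (degree p)" by (metis lead_coeff_monom)
  then show ?thesis by (rule that)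
qed

text \<open>The image of a homogeneous product under \<open>gr\<close> is a monomial in t, so
  \<open>monom_factor\<close> applies to the image of \<open>a\<close>.\<close>

lemma homog_factor:
  assumes "homog d (a * b)" "a * b \<noteq> 0"
  obtains e where "homog e a"
proof -
  have "gr a * gr b = monom (a * b) d" using gr_homog[OF assms(1)] by (simp add: gr.lift_mult)
  then obtain e where "gr a = monom (coeff (gr a) e) e" using assms(2) by (rule monom_factor)
  then have "hcomp e' a = 0" if "e' \<noteq> e" for e' using that by (metis coeff_gr coeff_monom)
  then show ?thesis using that homogI by blast
qed

lemma homog_dvd: "homog d b \<Longrightarrow> b \<noteq> 0 \<Longrightarrow> a dvd b \<Longrightarrow> \<exists>e. homog e a"
  by (auto elim!: dvdE intro: homog_factor)

lemma homog_unique: "homog d a \<Longrightarrow> homog e a \<Longrightarrow> a \<noteq> 0 \<Longrightarrow> d = e"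
proof -
  assume "homog d a" "homog e a" "a \<noteq> 0"
  moreover from this obtain m where "m \<in> Poly_Mapping.keys a" using keys_eq_empty[of a] by blast
  ultimately show "d = e" unfolding homog_def by metis
qed

lemma homog_0_unit:
  assumes "homog 0 a" "a \<noteq> 0"
  shows "a dvd 1"
proof -
  have "m = 0" if "m \<in> Poly_Mapping.keys a" for m
    using that assms(1) by (intro poly_mapping_eqI) (auto simp: homog_def mdeg_def)
  then have "a = Poly_Mapping.single 0 (Poly_Mapping.lookup a 0)"
    by (intro poly_mapping_eqI) (auto simp: lookup_single when_def in_keys_iff)
  then obtain c where a: "a = Poly_Mapping.single 0 c" ..
  with assms(2) have "c \<noteq> 0" by auto
  with a have "a * Poly_Mapping.single 0 (inverse c) = 1" by (simp add: mult_single)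
  then show ?thesis by (metis dvd_triv_left)
qed

lemma homog_0 [simp]: "homog d 0"
  by (simp add: homog_def)

lemma homog_1 [simp]: "homog 0 1"
  by (simp add: homog_def mdeg_def)

lemma homog_add: "homog d a \<Longrightarrow> homog d b \<Longrightarrow> homog d (a + b)"
  using Poly_Mapping.keys_add[of a b] by (auto simp: homog_def)

lemma homog_uminus: "homog d a \<Longrightarrow> homog d (- a)"
  by (simp add: homog_def in_keys_iff)

lemma homog_power: "homog d a \<Longrightarrow> homog (n * d) (a ^ n)"
  by (induction n) (simp_all add: homog_mult)

section \<open>Stalks of \<open>\<O>(l)\<close> and the Zariski topology\<close>

lemma twist_stalkI:
  "homog d a \<Longrightarrow> homog e b \<Longrightarrow> int d = int e + l \<Longrightarrow> b \<notin> x \<Longrightarrow> Fract a b \<in> twist_stalk l x"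
  unfolding twist_stalk_def by blast

lemma twist_stalkE:
  assumes "f \<in> twist_stalk l x" "x \<in> Proj4"
  obtains a b d e where "f = Fract a b" "homog d a" "homog e b" "int d = int e + l" "b \<notin> x" "b \<noteq> 0"
  using assms Proj4_0 unfolding twist_stalk_def by blast

lemma Proj4_mult: "x \<in> Proj4 \<Longrightarrow> a \<notin> x \<Longrightarrow> b \<notin> x \<Longrightarrow> a * b \<notin> x"
  by (auto simp: Proj4_def)

lemma Proj4_1: "x \<in> Proj4 \<Longrightarrow> 1 \<notin> x"
  by (simp add: Proj4_def)

lemma Proj4_power: "x \<in> Proj4 \<Longrightarrow> a \<notin> x \<Longrightarrow> a ^ n \<notin> x"
  by (induction n) (auto simp: Proj4_1 Proj4_mult)

lemma Proj4_dvd: "x \<in> Proj4 \<Longrightarrow> a \<in> x \<Longrightarrow> a dvd b \<Longrightarrow> b \<in> x"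
  by (auto simp: Proj4_def homog_ideal_def mult.commute elim!: dvdE)

lemma Proj4_add: "x \<in> Proj4 \<Longrightarrow> a \<in> x \<Longrightarrow> b \<in> x \<Longrightarrow> a + b \<in> x"
  by (auto simp: Proj4_def homog_ideal_def)

lemma Proj4_Zvar:
  assumes "x \<in> Proj4" obtains \<nu> where "Zvar \<nu> \<notin> x"
  using assms by (auto simp: Proj4_def)

lemma homog_Zvar_power: "homog n (Zvar \<nu> ^ n)"
  using homog_power[OF homog_Zvar, of n \<nu>] by simp

lemma ts_0 [simp]:
  assumes "x \<in> Proj4" shows "0 \<in> twist_stalk l x"
proof -
  obtain \<nu> where \<nu>: "Zvar \<nu> \<notin> x" using assms by (rule Proj4_Zvar)
  have "Fract 0 (Zvar \<nu> ^ nat (- l)) \<in> twist_stalk l x"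
    by (rule twist_stalkI[of "nat l" _ "nat (- l)"])
      (use assms \<nu> in \<open>auto simp: Proj4_power homog_Zvar_power\<close>)
  then show ?thesis by (simp add: fract_collapse)
qed

lemma ts_1 [simp]:
  assumes "x \<in> Proj4" shows "1 \<in> twist_stalk 0 x"
  unfolding One_fract_def
  by (rule twist_stalkI[of 0 _ 0]) (use assms Proj4_1 in auto)

lemma ts_zf [simp]:
  assumes "x \<in> Proj4" shows "zf \<nu> \<in> twist_stalk 1 x"
  unfolding zf_def
  by (rule twist_stalkI[of 1 _ 0]) (use assms Proj4_1 homog_Zvar in auto)

lemma ts_add [intro]:
  assumes "x \<in> Proj4" "f \<in> twist_stalk l x" "g \<in> twist_stalk l x"
  shows "f + g \<in> twist_stalk l x"
proof -
  obtain a b d e where f: "f = Fract a b" "homog d a" "homog e b" "int d = int e + l" "b \<notin> x" "b \<noteq> 0"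
    using assms(2,1) by (rule twist_stalkE)
  obtain a' b' d' e' where g: "g = Fract a' b'" "homog d' a'" "homog e' b'" "int d' = int e' + l" "b' \<notin> x" "b' \<noteq> 0"
    using assms(3,1) by (rule twist_stalkE)
  have "homog (d + e') (a * b')" "homog (d' + e) (a' * b)" "homog (e + e') (b * b')"
    using f g by (auto intro!: homog_mult)
  moreover have "d' + e = d + e'" using f g by linarith
  ultimately have "Fract (a * b' + a' * b) (b * b') \<in> twist_stalk l x"
    by (intro twist_stalkI[of "d + e'" _ "e + e'"]) (use f g assms in \<open>auto simp: homog_add Proj4_mult\<close>)
  then show ?thesis using f g by simp
qed

lemma ts_mult:
  assumes "x \<in> Proj4" "f \<in> twist_stalk l x" "g \<in> twist_stalk m x" "n = l + m"
  shows "f * g \<in> twist_stalk n x"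
proof -
  obtain a b d e where f: "f = Fract a b" "homog d a" "homog e b" "int d = int e + l" "b \<notin> x" "b \<noteq> 0"
    using assms(2,1) by (rule twist_stalkE)
  obtain a' b' d' e' where g: "g = Fract a' b'" "homog d' a'" "homog e' b'" "int d' = int e' + m" "b' \<notin> x" "b' \<noteq> 0"
    using assms(3,1) by (rule twist_stalkE)
  have "Fract (a * a') (b * b') \<in> twist_stalk n x"
    by (intro twist_stalkI[of "d + d'" _ "e + e'"])
      (use f g assms in \<open>auto simp: homog_mult Proj4_mult\<close>)
  then show ?thesis using f g by simp
qed

lemma ts_uminus_iff [simp]:
  assumes "x \<in> Proj4" shows "- f \<in> twist_stalk l x \<longleftrightarrow> f \<in> twist_stalk l x"
proof -
  have *: "- f \<in> twist_stalk l x" if f: "f \<in> twist_stalk l x" for f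
  proof -
    obtain a b d e where f: "f = Fract a b" "homog d a" "homog e b" "int d = int e + l" "b \<notin> x" "b \<noteq> 0"
      using f assms(1) by (rule twist_stalkE)
    have "Fract (- a) b \<in> twist_stalk l x"
      by (intro twist_stalkI[of d _ e]) (use f in \<open>auto simp: homog_uminus\<close>)
    then show ?thesis using f by simp
  qed
  show ?thesis using *[of f] *[of "- f"] by auto
qed

lemma ts_diff:
  assumes "x \<in> Proj4" "f \<in> twist_stalk l x" "g \<in> twist_stalk l x"
  shows "f - g \<in> twist_stalk l x"
  using ts_add[of x f l "- g"] assms by simp

lemma ts_inverse:
  assumes "homog e b" "b \<notin> x" "x \<in> Proj4"
  shows "inverse (Fract b 1) \<in> twist_stalk (- int e) x"
proof -
  have "Fract 1 b \<in> twist_stalk (- int e) x"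
    by (rule twist_stalkI[of 0 _ e]) (use assms in auto)
  then show ?thesis by simp
qed

lemma ts_zf_mult_iff:
  assumes "x \<in> Proj4" "Zvar \<nu> \<notin> x"
  shows "zf \<nu> * f \<in> twist_stalk (l + 1) x \<longleftrightarrow> f \<in> twist_stalk l x"
  using zf_mult_stalk[of x f l \<nu>] zf_divide_stalk[of x "zf \<nu> * f" l \<nu>] assms by auto

lemma ts_mono: "y \<subseteq> x \<Longrightarrow> twist_stalk l x \<subseteq> twist_stalk l y"
  unfolding twist_stalk_def by blast

lemma eta_Proj4: "(eta :: 'k::field point) \<in> Proj4"
proof -
  have "hcomp d 0 = (0 :: 'k hpoly)" for d by (rule poly_mapping_eqI) (simp add: lookup_hcomp)
  then show ?thesis by (auto simp: eta_def Proj4_def homog_ideal_def)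
qed

lemma eta_subset: "x \<in> Proj4 \<Longrightarrow> eta \<subseteq> x"
  by (simp add: eta_def Proj4_0)

lemma ts_eta: "x \<in> Proj4 \<Longrightarrow> f \<in> twist_stalk l x \<Longrightarrow> f \<in> twist_stalk l eta"
  using ts_mono[OF eta_subset] by blast

lemma fun_field_eq: "fun_field = twist_stalk 0 eta"
  by (simp add: fun_field_def local_ring_def)

lemma ts_eta_inverse:
  assumes "f \<in> twist_stalk l eta" "m = - l"
  shows "inverse f \<in> twist_stalk m eta"
proof -
  obtain a b d e where f: "f = Fract a b" "homog d a" "homog e b" "int d = int e + l" "b \<notin> eta" "b \<noteq> 0"
    using assms(1) eta_Proj4 by (rule twist_stalkE)
  show ?thesis
  proof (cases "a = 0")
    \<comment> \<open>Here \<open>inverse 0 = 0\<close> by convention, and 0 lies in the stalk of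
      every degree.\<close>
    case True
    then show ?thesis using f by (simp add: eta_Proj4 fract_collapse)
  next
    case False
    then have "Fract b a \<in> twist_stalk m eta"
      by (intro twist_stalkI[of e _ d]) (use f assms in \<open>auto simp: eta_def\<close>)
    then show ?thesis using f by simp
  qed
qed

lemma ts_eta_zf_divide:
  assumes "f \<in> twist_stalk (l + 1) eta"
  shows "f / zf \<nu> \<in> twist_stalk l eta"
  using zf_divide_stalk[OF eta_Proj4 assms] by (simp add: eta_def)

section \<open>Zariski-open sets and the spreading out of germs\<close>

lemma homog_ideal_principal:
  assumes "homog e b" shows "homog_ideal {a. b dvd a}"
proof -
  have "b dvd hcomp d a" if "b dvd a" for d a
  proof -
    from that obtain c where "a = b * c" by (rule dvdE)
    then show ?thesis by (simp add: mult.commute[of b] hcomp_mult_homog[OF assms])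
  qed
  then show ?thesis by (auto simp: homog_ideal_def)
qed

lemma zopen_basic:
  assumes "homog e b" shows "zopen {x \<in> Proj4. b \<notin> x}"
proof -
  have "{x \<in> Proj4. b \<notin> x} = {x \<in> Proj4. \<not> {a. b dvd a} \<subseteq> x}"
    by (auto dest: Proj4_dvd)
  then show ?thesis unfolding zopen_def using homog_ideal_principal[OF assms] by blast
qed

lemma zopen_Int:
  assumes "zopen U" "zopen V" shows "zopen (U \<inter> V)"
proof -
  obtain I J where I: "homog_ideal I" "U = {x \<in> Proj4. \<not> I \<subseteq> x}"
    and J: "homog_ideal J" "V = {x \<in> Proj4. \<not> J \<subseteq> x}"
    using assms unfolding zopen_def by blast
  have "\<not> I \<inter> J \<subseteq> x" if x: "x \<in> Proj4" and ij: "\<not> I \<subseteq> x" "\<not> J \<subseteq> x" for x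
  proof -
    obtain a b where ab: "a \<in> I" "a \<notin> x" "b \<in> J" "b \<notin> x" using ij by blast
    have "b * a \<in> I" "a * b \<in> J" using ab I(1) J(1) by (simp_all add: homog_ideal_def)
    then have "a * b \<in> I \<inter> J" by (simp add: mult.commute)
    then show ?thesis using ab x Proj4_mult by blast
  qed
  then have "U \<inter> V = {x \<in> Proj4. \<not> I \<inter> J \<subseteq> x}" unfolding I J by blast
  moreover have "homog_ideal (I \<inter> J)" using I(1) J(1) unfolding homog_ideal_def by blast
  ultimately show ?thesis unfolding zopen_def by blast
qed

lemma zopen_Proj4: "zopen (Proj4 :: 'k::field point set)"
proof -
  have "{x \<in> Proj4. 1 \<notin> x} = (Proj4 :: 'k point set)" using Proj4_1 by auto
  then show ?thesis using zopen_basic[OF homog_1, where 'a = 'k] by simp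
qed

lemma zopen_generization: "zopen U \<Longrightarrow> x \<in> U \<Longrightarrow> y \<in> Proj4 \<Longrightarrow> y \<subseteq> x \<Longrightarrow> y \<in> U"
  by (auto simp: zopen_def)

lemma eta_in_zopen: "zopen U \<Longrightarrow> x \<in> U \<Longrightarrow> eta \<in> U"
  using zopen_generization eta_Proj4 eta_subset zopen_subset by blast

text \<open>The neighbourhood is cut out by the denominator of one fraction that represents the
  germ.\<close>

lemma stalk_nbhd1:
  assumes "x \<in> U" "zopen U" "f \<in> twist_stalk l x"
  obtains W where "zopen W" "x \<in> W" "W \<subseteq> U" "f \<in> twist l W"
proof -
  have x: "x \<in> Proj4" using assms zopen_subset by blast
  obtain a b d e where f: "f = Fract a b" "homog d a" "homog e b" "int d = int e + l" "b \<notin> x" "b \<noteq> 0"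
    using assms(3) x by (rule twist_stalkE)
  let ?W = "U \<inter> {x \<in> Proj4. b \<notin> x}"
  have "f \<in> twist l ?W" unfolding twist_def using f by (auto intro: twist_stalkI)
  moreover have "zopen ?W" by (rule zopen_Int[OF assms(2) zopen_basic[OF f(3)]])
  ultimately show ?thesis using that f x assms by blast
qed

lemma twist_mono: "f \<in> twist l U \<Longrightarrow> W \<subseteq> U \<Longrightarrow> f \<in> twist l W"
  unfolding twist_def by blast

lemma stalk_nbhd:
  assumes "finite I" "x \<in> U" "zopen U" "\<And>i. i \<in> I \<Longrightarrow> f i \<in> twist_stalk (l i) x"
  shows "\<exists>W. zopen W \<and> x \<in> W \<and> W \<subseteq> U \<and> (\<forall>i\<in>I. f i \<in> twist (l i) W)"
  using assms(1,4)
proof (induction I)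
  case empty
  then show ?case using assms by blast
next
  case (insert j I)
  then obtain W where W: "zopen W" "x \<in> W" "W \<subseteq> U" "\<forall>i\<in>I. f i \<in> twist (l i) W" by auto
  moreover have "f j \<in> twist_stalk (l j) x" using insert by simp
  ultimately obtain W' where W': "zopen W'" "x \<in> W'" "W' \<subseteq> W" "f j \<in> twist (l j) W'"
    by (blast elim: stalk_nbhd1)
  have "\<forall>i\<in>insert j I. f i \<in> twist (l i) W'" using W W' twist_mono by blast
  then show ?case using W W' by blast
qed

section \<open>Prime divisors\<close>

text \<open>The prime ideal \<open>x\<close> contains one of the prime factors of \<open>a\<close>,
  and a divisor of a nonzero homogeneous polynomial is homogeneous. This supplies the prime divisors
  through a given point.\<close>

lemma prime_factor_in_point:
  fixes a :: "'k::field hpoly"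
  assumes "x \<in> Proj4" "a \<in> x" "a \<noteq> 0" "homog d a"
  obtains p e where "prime_elem p" "homog e p" "p dvd a" "p \<in> x"
proof -
  obtain u F where F: "u dvd 1" "a = u * prod_mset F" "\<And>p. p \<in># F \<Longrightarrow> prime_elem p"
    by (rule hpoly_factorization[OF assms(3)]) blast
  have "u \<notin> x" using Proj4_dvd[OF assms(1) _ F(1)] Proj4_1[OF assms(1)] by blast
  then have "prod_mset F \<in> x" using Proj4_mult[OF assms(1), of u "prod_mset F"] F(2) assms(2) by blast
  then have "\<exists>p. p \<in># F \<and> p \<in> x"
  proof (induction F)
    case empty
    then show ?case using Proj4_1[OF assms(1)] by simp
  next
    case (add q F)
    then have "q \<in> x \<or> prod_mset F \<in> x" using Proj4_mult[OF assms(1), of q "prod_mset F"] by auto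
    then show ?case using add.IH by auto
  qed
  then obtain p where p: "p \<in># F" "p \<in> x" by blast
  then have pa: "p dvd a" using F(2) by (simp add: dvd_prod_mset)
  obtain e where "homog e p" using homog_dvd[OF assms(4,3) pa] by blast
  then show ?thesis using that[of p e] p pa F(3)[OF p(1)] by blast
qed

lemma hcomp_mdeg_neq_0: "m \<in> Poly_Mapping.keys a \<Longrightarrow> hcomp (mdeg m) a \<noteq> 0"
  using lookup_hcomp[of "mdeg m" a m] by (auto simp: in_keys_iff)

lemma prime_elem_homog_pos:
  fixes p :: "'k::field hpoly"
  assumes "prime_elem p" "homog e p" shows "e > 0"
  using assms homog_0_unit[of p] by (cases e) (auto simp: prime_elem_def)

lemma prime_dvd_prime:
  fixes p q :: "'a::idom"
  assumes "prime_elem p" "prime_elem q" "p dvd q" shows "q dvd p"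
proof (rule ccontr)
  assume n: "\<not> q dvd p"
  obtain c where c: "q = p * c" using assms(3) by (rule dvdE)
  have "q dvd p * c" unfolding c[symmetric] by simp
  then have "q dvd c" using prime_elem_dvd_multD[OF assms(2)] n by blast
  then obtain d where d: "c = q * d" by (rule dvdE)
  have "q * (p * d) = p * (q * d)" by (simp add: ac_simps)
  also have "\<dots> = q * 1" unfolding d[symmetric] c[symmetric] by simp
  finally have "p * d = 1" using assms(2) by (simp add: prime_elem_def)
  then have "p dvd 1" by (rule dvdI[OF sym])
  then show False using assms(1) by (simp add: prime_elem_def)
qed

lemma prime_elem_associated:
  fixes p q :: "'a::idom"
  assumes "prime_elem p" "p dvd q" "q dvd p" shows "prime_elem q"
proof (rule prime_elemI)
  show "q \<noteq> 0" using assms by (auto simp: prime_elem_def)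
  show "\<not> q dvd 1" using assms dvd_trans[of p q 1] by (auto simp: prime_elem_def)
  fix a b assume "q dvd a * b"
  then have "p dvd a * b" using assms(2) dvd_trans by blast
  then have "p dvd a \<or> p dvd b" using assms(1) by (simp add: prime_elem_def)
  then show "q dvd a \<or> q dvd b" using assms(3) dvd_trans by blast
qed

lemma homog_mult_degree:
  fixes a b :: "'k::field hpoly"
  assumes "homog d (a * b)" "homog e a" "a * b \<noteq> 0"
  obtains e' where "homog e' b" "d = e + e'"
proof -
  have "homog d (b * a)" "b * a \<noteq> 0" using assms by (simp_all add: mult.commute)
  then obtain e' where e': "homog e' b" by (rule homog_factor)
  have "d = e + e'" using assms homog_mult[OF assms(2) e'] homog_unique by blast
  then show ?thesis using that e' by blast
qed

lemma Zvar_dvd_Zvar: "Zvar i dvd (Zvar j :: 'k::field hpoly) \<longleftrightarrow> i = j"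
proof
  assume "Zvar i dvd (Zvar j :: 'k hpoly)"
  then obtain c :: "'k hpoly" where c: "Zvar j = Zvar i * c" by (rule dvdE)
  have "Poly_Mapping.single j 1 \<in> Poly_Mapping.keys (Zvar i * c)"
    unfolding c[symmetric] by (simp add: keys_Zvar)
  then obtain n where "Poly_Mapping.single j 1 = Poly_Mapping.single i (1::nat) + n"
    using keys_mult[of "Zvar i" c] by (auto simp: keys_Zvar)
  then have "Poly_Mapping.lookup (Poly_Mapping.single j (1::nat)) i = 1 + Poly_Mapping.lookup n i"
    by (simp add: lookup_add)
  then show "i = j" by (auto simp: lookup_single when_def split: if_splits)
qed simp

lemma Zvar_not_unit: "\<not> Zvar i dvd (1 :: 'k::field hpoly)"
proof
  assume "Zvar i dvd (1 :: 'k hpoly)"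
  then have "Zvar i dvd (Zvar (i + 1) :: 'k hpoly)" by (rule unit_imp_dvd)
  then show False by (simp add: Zvar_dvd_Zvar)
qed

text \<open>A prime factor of a form of degree 1 has positive degree, hence degree 1, and its
  cofactor is a nonzero constant.\<close>

lemma prime_elem_Zvar: "prime_elem (Zvar \<nu> :: 'k::field hpoly)"
proof -
  obtain u F where F: "u dvd 1" "Zvar \<nu> = u * prod_mset F" "\<And>p. p \<in># F \<Longrightarrow> prime_elem (p :: 'k hpoly)"
    by (rule hpoly_factorization[OF Zvar_neq_0[of \<nu>]]) blast
  have "F \<noteq> {#}" using F Zvar_not_unit by force
  then obtain p where p: "p \<in># F" by blast
  then have "p dvd Zvar \<nu>" using F(2) by (simp add: dvd_prod_mset)
  then obtain c where c: "Zvar \<nu> = p * c" by (rule dvdE)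
  obtain e where e: "homog e p" using homog_dvd[OF homog_Zvar Zvar_neq_0 \<open>p dvd Zvar \<nu>\<close>] by blast
  obtain e' where e': "homog e' c" "1 = e + e'"
  proof (rule homog_mult_degree)
    show "homog 1 (p * c)" unfolding c[symmetric] by (rule homog_Zvar)
    show "p * c \<noteq> 0" unfolding c[symmetric] by (rule Zvar_neq_0)
  qed (use e in simp_all)
  then have "e' = 0" using prime_elem_homog_pos[OF F(3)[OF p] e] by simp
  then have "c dvd 1" using e' c Zvar_neq_0[of \<nu>, where 'k = 'k] by (intro homog_0_unit) auto
  then obtain c' where "c * c' = 1" by (metis dvdE)
  then have "p = Zvar \<nu> * c'" unfolding c by (simp add: mult.assoc)
  then show ?thesis using prime_elem_associated[OF F(3)[OF p] \<open>p dvd Zvar \<nu>\<close>] by simp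
qed

lemma principal_Proj4:
  fixes p :: "'k::field hpoly"
  assumes "prime_elem p" "homog e p" shows "{a. p dvd a} \<in> Proj4"
proof -
  have "\<exists>\<nu>. \<not> p dvd Zvar \<nu>"
  proof (rule ccontr)
    assume "\<not> ?thesis"
    then have "p dvd Zvar 0" "p dvd Zvar 1" by auto
    then have "Zvar 0 dvd (Zvar 1 :: 'k hpoly)"
      by (intro dvd_trans[OF prime_dvd_prime[OF assms(1) prime_elem_Zvar]])
    then show False by (simp add: Zvar_dvd_Zvar)
  qed
  then show ?thesis
    using homog_ideal_principal[OF assms(2)] assms(1) by (simp add: Proj4_def prime_elem_def)
qed

text \<open>A point strictly in between would contain a homogeneous prime \<open>q\<close> divisible
  by \<open>p\<close>. Then \<open>p\<close> and \<open>q\<close> are associated, and the point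
  already contains \<open>p\<close>.\<close>

lemma principal_prime_divisor:
  fixes p :: "'k::field hpoly"
  assumes "prime_elem p" "homog e p" shows "{a. p dvd a} \<in> prime_divisors"
proof -
  have "\<not> (eta \<subset> y \<and> y \<subset> {a. p dvd a})" if y: "y \<in> Proj4" for y
  proof
    assume *: "eta \<subset> y \<and> y \<subset> {a. p dvd a}"
    then obtain a where a: "a \<in> y" "a \<noteq> 0" unfolding eta_def by blast
    obtain m where "m \<in> Poly_Mapping.keys a" using a(2) keys_eq_empty[of a] by blast
    then have nz: "hcomp (mdeg m) a \<noteq> 0" by (rule hcomp_mdeg_neq_0)
    have "hcomp (mdeg m) a \<in> y" using y a(1) unfolding Proj4_def homog_ideal_def by blast
    then obtain q e' where q: "prime_elem q" "homog e' q" "q dvd hcomp (mdeg m) a" "q \<in> y"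
      by (rule prime_factor_in_point[OF y _ nz homog_hcomp])
    have "y \<subseteq> {a. p dvd a}" using * by (rule psubset_imp_subset[OF conjunct2])
    from subsetD[OF this q(4)] have "p dvd q" by simp
    then have "q dvd p" by (rule prime_dvd_prime[OF assms(1) q(1)])
    then have "p \<in> y" by (rule Proj4_dvd[OF y q(4)])
    then have "{a. p dvd a} \<subseteq> y" using Proj4_dvd[OF y] by (intro subsetI) simp
    from psubset_subset_trans[OF conjunct2[OF *] this] show False by simp
  qed
  moreover have "p \<in> {a. p dvd a}" "p \<notin> eta" using assms(1) by (simp_all add: eta_def prime_elem_def)
  then have "{a. p dvd a} \<noteq> eta" by metis
  ultimately show ?thesis using principal_Proj4[OF assms] unfolding prime_divisors_def by simp
qed

text \<open>\<open>P\<close> contains a homogeneous prime \<open>q\<close>. The ideal generated by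
  \<open>q\<close> is a point different from \<open>eta\<close> and contained in \<open>P\<close>,
  so it equals \<open>P\<close> because \<open>P\<close> has codimension one.\<close>

lemma prime_divisorE:
  fixes P :: "'k::field point"
  assumes "P \<in> prime_divisors"
  obtains p e where "prime_elem p" "homog e p" "P = {a. p dvd a}"
proof -
  have P: "P \<in> Proj4" "P \<noteq> eta" using assms unfolding prime_divisors_def by blast+
  then obtain a where a: "a \<in> P" "a \<noteq> 0" using Proj4_0[of P] unfolding eta_def by blast
  obtain m where "m \<in> Poly_Mapping.keys a" using a(2) keys_eq_empty[of a] by blast
  then have nz: "hcomp (mdeg m) a \<noteq> 0" by (rule hcomp_mdeg_neq_0)
  have "hcomp (mdeg m) a \<in> P" using P(1) a(1) unfolding Proj4_def homog_ideal_def by blast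
  then obtain q e where q: "prime_elem q" "homog e q" "q dvd hcomp (mdeg m) a" "q \<in> P"
    by (rule prime_factor_in_point[OF P(1) _ nz homog_hcomp])
  have "q \<in> {a. q dvd a}" "q \<notin> eta" using q(1) by (simp_all add: eta_def prime_elem_def)
  then have "eta \<subset> {a. q dvd a}" using eta_subset[OF principal_Proj4[OF q(1,2)]] by (metis psubsetI)
  moreover have "{a. q dvd a} \<subseteq> P" using Proj4_dvd[OF P(1) q(4)] by (intro subsetI) simp
  moreover have "\<not> (eta \<subset> y \<and> y \<subset> P)" if "y \<in> Proj4" for y
    using assms that unfolding prime_divisors_def by blast
  ultimately have "P = {a. q dvd a}" using principal_Proj4[OF q(1,2)] by (metis psubsetI)
  then show ?thesis by (rule that[OF q(1,2)])
qed

lemma prime_divisor_Proj4: "P \<in> prime_divisors \<Longrightarrow> P \<in> Proj4"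
  by (simp add: prime_divisors_def)

lemma Hyp_eq: "Hyp \<nu> = {a. Zvar \<nu> dvd a}"
  by (auto simp: Hyp_def)

lemma Hyp_prime_divisor: "Hyp \<nu> \<in> prime_divisors"
  unfolding Hyp_eq using prime_elem_Zvar homog_Zvar by (rule principal_prime_divisor)

lemma Zvar_in_Hyp: "Zvar \<mu> \<in> Hyp \<nu> \<longleftrightarrow> \<mu> = \<nu>"
  by (auto simp: Hyp_eq Zvar_dvd_Zvar)

lemma prime_divisor_eq_Hyp:
  fixes P :: "'k::field point"
  assumes "P \<in> prime_divisors" "Zvar \<nu> \<in> P" shows "P = Hyp \<nu>"
proof -
  have "Hyp \<nu> \<subseteq> P"
    using Proj4_dvd[OF prime_divisor_Proj4[OF assms(1)] assms(2)] by (auto simp: Hyp_eq)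
  moreover have "(eta :: 'k point) \<subset> Hyp \<nu>"
  proof
    show "(eta :: 'k point) \<subseteq> Hyp \<nu>" by (rule eta_subset[OF prime_divisor_Proj4[OF Hyp_prime_divisor]])
    have "(Zvar \<nu> :: 'k hpoly) \<in> Hyp \<nu>" "(Zvar \<nu> :: 'k hpoly) \<notin> eta"
      by (simp_all add: Zvar_in_Hyp eta_def)
    then show "(eta :: 'k point) \<noteq> Hyp \<nu>" by metis
  qed
  moreover have "\<not> (eta \<subset> y \<and> y \<subset> P)" if "y \<in> Proj4" for y
    using assms that unfolding prime_divisors_def by blast
  ultimately show ?thesis using prime_divisor_Proj4[OF Hyp_prime_divisor] by blast
qed

text \<open>A denominator of minimal degree is not divisible by any homogeneous prime contained in \<open>x\<close>.\<close>

theorem twist_stalk_codim1: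
  fixes x :: "'k::field point"
  assumes x: "x \<in> Proj4" and f: "f \<in> twist_stalk l eta"
    and P: "\<And>P. P \<in> prime_divisors \<Longrightarrow> P \<subseteq> x \<Longrightarrow> f \<in> twist_stalk l P"
  shows "f \<in> twist_stalk l x"
proof (cases "f = 0")
  case True
  then show ?thesis using x by simp
next
  case nz: False
  define rep where "rep = (\<lambda>e. \<exists>a b d. f = Fract a b \<and> homog d a \<and> homog e b \<and> int d = int e + l \<and> b \<noteq> 0)"
  have "\<exists>e. rep e" by (rule twist_stalkE[OF f eta_Proj4]) (auto simp: rep_def)
  then have rep: "rep (LEAST e. rep e)" by (rule LeastI_ex)
  define e where "e = (LEAST e. rep e)"
  have le: "e \<le> n" if "rep n" for n using that unfolding e_def by (rule Least_le)
  from rep obtain a b d where ab: "f = Fract a b" "homog d a" "homog e b" "int d = int e + l" "b \<noteq> 0"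
    unfolding rep_def e_def by blast
  have "b \<notin> x"
  proof
    assume "b \<in> x"
    then obtain p m where p: "prime_elem p" "homog m p" "p dvd b" "p \<in> x"
      by (rule prime_factor_in_point[OF x _ ab(5,3)])
    let ?P = "{a. p dvd a}"
    have "?P \<subseteq> x" using Proj4_dvd[OF x p(4)] by (intro subsetI) simp
    then have "f \<in> twist_stalk l ?P" by (rule P[OF principal_prime_divisor[OF p(1,2)]])
    then obtain a' b' d' e' where ab': "f = Fract a' b'" "homog d' a'" "homog e' b'"
        "int d' = int e' + l" "b' \<notin> ?P" "b' \<noteq> 0"
      by (rule twist_stalkE[OF _ principal_Proj4[OF p(1,2)]])
    then have "a * b' = a' * b" using ab by (simp add: eq_fract)
    then have "p dvd a * b'" using p(3) by simp
    then have pa: "p dvd a" using ab'(5) prime_elem_dvd_multD[OF p(1), of a b'] by simp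
    obtain b1 where b1: "b = p * b1" using p(3) by (rule dvdE)
    obtain a1 where a1: "a = p * a1" using pa by (rule dvdE)
    have p0: "p \<noteq> 0" using p(1) by (simp add: prime_elem_def)
    obtain e1 where e1: "homog e1 b1" "e = m + e1"
      by (rule homog_mult_degree[of e p b1 m]) (use ab b1 p in auto)
    have a0: "a \<noteq> 0" using nz ab by (auto simp: fract_collapse)
    obtain d1 where d1: "homog d1 a1" "d = m + d1"
      by (rule homog_mult_degree[of d p a1 m]) (use ab a0 a1 p in auto)
    then have "int d1 = int e1 + l" using ab e1 by simp
    moreover have "f = Fract a1 b1" using ab a1 b1 p0 by (simp add: mult_fract_cancel)
    ultimately have "rep e1" unfolding rep_def using e1 d1 b1 ab by auto
    then have "e \<le> e1" by (rule le)
    then show False using e1 prime_elem_homog_pos[OF p(1,2)] by simp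
  qed
  then show ?thesis using ab by (auto intro: twist_stalkI)
qed

section \<open>The valuation of a prime divisor\<close>

abbreviation emb :: "'k::field hpoly \<Rightarrow> 'k hfrac" where
  "emb a \<equiv> Fract a 1"

lemma emb_mult: "emb (a * b) = emb a * emb b" by simp

lemma emb_power: "emb (a ^ n) = emb a ^ n"
  by (induction n) (simp_all add: One_fract_def emb_mult del: mult_fract)

lemma emb_eq_0 [simp]: "emb a = 0 \<longleftrightarrow> a = 0"
  by (simp add: Zero_fract_def eq_fract)

lemma Fract_eq_emb: "Fract a b = emb a / emb b"
  by simp

text \<open>The condition on \<pi> inside \<open>ordP\<close>, which admits every such \<pi>;
  independence of the choice is part of \<open>ordP_eqI\<close>.\<close>

definition uniformizer :: "'k::field point \<Rightarrow> 'k hfrac \<Rightarrow> bool" where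
  "uniformizer P \<pi> \<longleftrightarrow> max_ideal P = (\<lambda>r. \<pi> * r) ` local_ring P"

definition local_units :: "'k::field point \<Rightarrow> 'k hfrac set" where
  "local_units P = {u. u \<noteq> 0 \<and> u \<in> local_ring P \<and> inverse u \<in> local_ring P}"

lemma local_ring_mult: "P \<in> Proj4 \<Longrightarrow> f \<in> local_ring P \<Longrightarrow> g \<in> local_ring P \<Longrightarrow> f * g \<in> local_ring P"
  unfolding local_ring_def using ts_mult[of P f 0 g 0 0] by simp

lemma local_ring_1: "P \<in> Proj4 \<Longrightarrow> 1 \<in> local_ring P"
  unfolding local_ring_def by simp

lemma local_ring_fun_field: "P \<in> Proj4 \<Longrightarrow> f \<in> local_ring P \<Longrightarrow> f \<in> fun_field"
  unfolding local_ring_def fun_field_eq by (rule ts_eta)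

lemma local_ring_power: "P \<in> Proj4 \<Longrightarrow> f \<in> local_ring P \<Longrightarrow> f ^ n \<in> local_ring P"
  by (induction n) (simp_all add: local_ring_1 local_ring_mult)

lemma fun_field_mult: "f \<in> fun_field \<Longrightarrow> g \<in> fun_field \<Longrightarrow> f * g \<in> fun_field"
  unfolding fun_field_def by (rule local_ring_mult[OF eta_Proj4])

lemma fun_field_inverse: "f \<in> fun_field \<Longrightarrow> inverse f \<in> fun_field"
  unfolding fun_field_eq by (rule ts_eta_inverse) simp_all

lemma fun_field_divide: "f \<in> fun_field \<Longrightarrow> g \<in> fun_field \<Longrightarrow> f / g \<in> fun_field"
  by (simp add: divide_inverse fun_field_mult fun_field_inverse)

lemma fun_field_powi: "f \<in> fun_field \<Longrightarrow> f powi n \<in> fun_field"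
  unfolding power_int_def fun_field_def
  using fun_field_inverse[of f] by (auto intro!: local_ring_power[OF eta_Proj4] simp: fun_field_def)

lemma fun_field_0 [simp]: "0 \<in> fun_field"
  by (simp add: fun_field_eq eta_Proj4)

lemma fun_field_add: "f \<in> fun_field \<Longrightarrow> g \<in> fun_field \<Longrightarrow> f + g \<in> fun_field"
  unfolding fun_field_eq by (rule ts_add[OF eta_Proj4])

lemma fun_field_uminus: "f \<in> fun_field \<Longrightarrow> - f \<in> fun_field"
  unfolding fun_field_eq by (simp add: eta_Proj4)

lemma local_units_mult: "P \<in> Proj4 \<Longrightarrow> u \<in> local_units P \<Longrightarrow> v \<in> local_units P \<Longrightarrow> u * v \<in> local_units P"
  by (simp add: local_units_def local_ring_mult)

lemma local_units_powi: "P \<in> Proj4 \<Longrightarrow> u \<in> local_units P \<Longrightarrow> u powi n \<in> local_units P"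
  by (auto simp: local_units_def power_int_def local_ring_power power_inverse[symmetric] simp del: power_inverse)

lemma max_ideal_mult:
  assumes "P \<in> Proj4" "r \<in> local_ring P" "m \<in> max_ideal P" shows "r * m \<in> max_ideal P"
proof -
  obtain a b d where m: "m = Fract a b" "homog d a" "homog d b" "a \<in> P" "b \<notin> P"
    using assms(3) unfolding max_ideal_def by blast
  obtain a' b' d' e' where r: "r = Fract a' b'" "homog d' a'" "homog e' b'" "int d' = int e' + 0" "b' \<notin> P" "b' \<noteq> 0"
    using assms(2,1) unfolding local_ring_def by (rule twist_stalkE)
  have "r * m = Fract (a' * a) (b' * b)" using m r by simp
  moreover have "homog (d' + d) (a' * a)" "homog (d' + d) (b' * b)"
    using m r by (simp_all add: homog_mult)
  moreover have "a' * a \<in> P" using Proj4_dvd[OF assms(1) m(4)] by simp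
  moreover have "b' * b \<notin> P" using Proj4_mult[OF assms(1)] m r by simp
  ultimately show ?thesis unfolding max_ideal_def by blast
qed

lemma one_notin_max_ideal:
  assumes "P \<in> Proj4" shows "1 \<notin> max_ideal P"
proof
  assume "1 \<in> max_ideal P"
  then obtain a b where ab: "1 = Fract a b" "a \<in> P" "b \<notin> P"
    unfolding max_ideal_def by blast
  then have "b \<noteq> 0" using Proj4_0[OF assms] by auto
  then have "a = b" using ab by (simp add: One_fract_def eq_fract)
  then show False using ab by simp
qed

lemma local_unit_notin_max_ideal:
  assumes "P \<in> Proj4" "u \<in> local_units P" shows "u \<notin> max_ideal P"
  using max_ideal_mult[OF assms(1), of "inverse u" u] one_notin_max_ideal[OF assms(1)] assms(2)
  by (auto simp: local_units_def)

lemma uniformizer_in_max_ideal: "P \<in> Proj4 \<Longrightarrow> uniformizer P \<pi> \<Longrightarrow> \<pi> \<in> max_ideal P"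
  unfolding uniformizer_def using local_ring_1 by force

lemma uniformizer_mult: "uniformizer P \<pi> \<Longrightarrow> r \<in> local_ring P \<Longrightarrow> \<pi> * r \<in> max_ideal P"
  unfolding uniformizer_def by blast

lemma max_ideal_local_ring: "f \<in> max_ideal P \<Longrightarrow> f \<in> local_ring P"
  unfolding max_ideal_def local_ring_def by (auto intro: twist_stalkI)

text \<open>If \<open>n\<close> exceeded \<open>m\<close>, the unit \<open>v\<close> would be \<pi>
  times a regular function. Since \<open>u\<close> need only be regular, the lemma serves twice: for
  the uniqueness of the order, and for the nonnegative order of regular functions.\<close>

lemma uniformizer_powi_le:
  assumes P: "P \<in> Proj4" and \<pi>: "uniformizer P \<pi>" "\<pi> \<noteq> 0"
    and u: "u \<in> local_ring P" "v \<in> local_units P" and eq: "u * \<pi> powi n = v * \<pi> powi m"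
  shows "n \<le> m"
proof (rule ccontr)
  assume "\<not> n \<le> m"
  then obtain k where k: "n = m + 1 + int k" by (metis add.commute add.left_commute zless_iff_Suc_zadd not_le of_nat_Suc)
  have "v * \<pi> powi m = (\<pi> * (u * \<pi> ^ k)) * \<pi> powi m"
    using eq[symmetric] \<pi>(2) by (simp add: k power_int_add ac_simps)
  then have "v = \<pi> * (u * \<pi> ^ k)" using \<pi>(2) by simp
  moreover have "u * \<pi> ^ k \<in> local_ring P"
    using local_ring_mult[OF P u(1) local_ring_power[OF P]] max_ideal_local_ring
      uniformizer_in_max_ideal[OF P \<pi>(1)] by blast
  ultimately have "v \<in> max_ideal P" using uniformizer_mult[OF \<pi>(1)] by simp
  then show False using local_unit_notin_max_ideal[OF P u(2)] by simp
qed

text \<open>Two uniformizers divide each other in the local ring, so their quotient is a unit. A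
  power of it is absorbed by the unit part, and the exponents are then compared for one fixed
  \<pi>.\<close>

lemma ordP_eqI:
  assumes P: "P \<in> Proj4" and \<pi>: "uniformizer P \<pi>" "\<pi> \<noteq> 0" and u: "u \<in> local_units P"
  shows "ordP P (u * \<pi> powi n) = Fin n"
proof -
  let ?f = "u * \<pi> powi n"
  have f: "?f \<noteq> 0" using u \<pi> by (simp add: local_units_def)
  have "(THE n. \<exists>\<pi> u. max_ideal P = (\<lambda>r. \<pi> * r) ` local_ring P
      \<and> u \<in> local_ring P \<and> inverse u \<in> local_ring P \<and> ?f = u * power_int \<pi> n) = n"
  proof (rule the_equality)
    show "\<exists>\<pi> u. max_ideal P = (\<lambda>r. \<pi> * r) ` local_ring P
      \<and> u \<in> local_ring P \<and> inverse u \<in> local_ring P \<and> ?f = u * power_int \<pi> n"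
      using \<pi>(1) u by (intro exI[of _ \<pi>] exI[of _ u]) (simp add: uniformizer_def local_units_def)
  next
    fix m assume "\<exists>\<pi> u. max_ideal P = (\<lambda>r. \<pi> * r) ` local_ring P
      \<and> u \<in> local_ring P \<and> inverse u \<in> local_ring P \<and> ?f = u * power_int \<pi> m"
    then obtain \<pi>' v where \<pi>': "uniformizer P \<pi>'" and v: "v \<in> local_ring P" "inverse v \<in> local_ring P"
      and eq: "?f = v * \<pi>' powi m" unfolding uniformizer_def by blast
    have "v \<noteq> 0" using eq f by auto
    with v have v': "v \<in> local_units P" by (simp add: local_units_def)
    obtain r where r: "\<pi>' = \<pi> * r" "r \<in> local_ring P"
      using uniformizer_in_max_ideal[OF P \<pi>'] \<pi>(1) unfolding uniformizer_def by blast
    obtain r' where r': "\<pi> = \<pi>' * r'" "r' \<in> local_ring P"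
      using uniformizer_in_max_ideal[OF P \<pi>(1)] \<pi>' unfolding uniformizer_def by blast
    have "\<pi> * (r * r') = \<pi> * 1" using r(1) r'(1) by (metis mult.assoc mult_1_right)
    then have rr: "r * r' = 1" using \<pi>(2) by simp
    then have "r \<noteq> 0" "inverse r = r'" by (auto simp: inverse_unique)
    then have "r \<in> local_units P" using r r' by (simp add: local_units_def)
    then have w: "v * r powi m \<in> local_units P"
      using P v' by (simp add: local_units_mult local_units_powi)
    have eq': "u * \<pi> powi n = (v * r powi m) * \<pi> powi m"
      unfolding eq r(1) by (simp add: power_int_mult_distrib)
    have "n \<le> m" "m \<le> n"
      using uniformizer_powi_le[OF P \<pi> _ w eq'] uniformizer_powi_le[OF P \<pi> _ u eq'[symmetric]] u w
      by (simp_all add: local_units_def)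
    then show "m = n" by simp
  qed
  then show ?thesis using f unfolding ordP_def by simp
qed

text \<open>Division by \<open>p\<close> lowers the degree by \<open>e > 0\<close>, so the process
  stops. The degrees are recorded because the quotients formed later have to be corrected to degree
  0.\<close>

lemma homog_multiplicity:
  fixes a p :: "'k::field hpoly"
  assumes p: "prime_elem p" "homog e p"
  shows "homog d a \<Longrightarrow> a \<noteq> 0 \<Longrightarrow>
    \<exists>n a' d'. a = p ^ n * a' \<and> \<not> p dvd a' \<and> homog d' a' \<and> d = n * e + d'"
proof (induction d arbitrary: a rule: less_induct)
  case (less d)
  show ?case
  proof (cases "p dvd a")
    case False
    then show ?thesis using less.prems by (intro exI[of _ 0] exI[of _ a] exI[of _ d]) simp
  next
    case True
    then obtain c where c: "a = p * c" by (rule dvdE)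
    obtain d' where d': "homog d' c" "d = e + d'"
      by (rule homog_mult_degree[of d p c e]) (use less.prems c p in auto)
    have "d' < d" using d' prime_elem_homog_pos[OF p] by simp
    moreover have "c \<noteq> 0" using c less.prems by auto
    ultimately obtain n a' d'' where "c = p ^ n * a'" "\<not> p dvd a'" "homog d'' a'" "d' = n * e + d''"
      using less.IH d'(1) by blast
    then show ?thesis using c d'
      by (intro exI[of _ "Suc n"] exI[of _ a'] exI[of _ d'']) (simp add: mult.assoc)
  qed
qed

lemma local_unitI:
  assumes "P \<in> Proj4" "homog d a" "homog d b" "a \<notin> P" "b \<notin> P"
  shows "Fract a b \<in> local_units P"
proof -
  have "a \<noteq> 0" "b \<noteq> 0" using assms Proj4_0 by auto
  moreover have "Fract a b \<in> local_ring P" "Fract b a \<in> local_ring P"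
    unfolding local_ring_def by (auto intro!: twist_stalkI assms)
  ultimately show ?thesis by (simp add: local_units_def Zero_fract_def eq_fract)
qed

text \<open>The power of z_\<nu>, a unit at \<open>P\<close> up to degree, only brings
  \<open>p\<close> to degree 0.\<close>

lemma uniformizer_principal:
  fixes p :: "'k::field hpoly"
  assumes p: "prime_elem p" "homog e p" and P: "P = {a. p dvd a}" and \<nu>: "Zvar \<nu> \<notin> P"
  shows "uniformizer P (Fract p (Zvar \<nu> ^ e))"
proof -
  have P4: "P \<in> Proj4" unfolding P using p by (rule principal_Proj4)
  let ?\<pi> = "Fract p (Zvar \<nu> ^ e)"
  have "f \<in> (\<lambda>r. ?\<pi> * r) ` local_ring P" if f: "f \<in> max_ideal P" for f
  proof -
    obtain a b d where ab: "f = Fract a b" "homog d a" "homog d b" "a \<in> P" "b \<notin> P"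
      using f unfolding max_ideal_def by blast
    have "p dvd a" using ab(4) P by simp
    then obtain c where c: "a = p * c" by (rule dvdE)
    have hc: "homog d (c * Zvar \<nu> ^ e)"
    proof (cases "a = 0")
      case True
      then have "c = 0" using c p by (simp add: prime_elem_def)
      then show ?thesis by simp
    next
      case False
      obtain d' where "homog d' c" "d = e + d'"
        by (rule homog_mult_degree[of d p c e]) (use ab c p False in auto)
      then show ?thesis using homog_mult[of d' c e "Zvar \<nu> ^ e"] by (simp add: homog_Zvar_power add.commute)
    qed
    have "Fract (c * Zvar \<nu> ^ e) b \<in> local_ring P"
      unfolding local_ring_def by (rule twist_stalkI[of d _ d]) (use hc ab in auto)
    moreover have "f = ?\<pi> * Fract (c * Zvar \<nu> ^ e) b"
    proof -
      have "b \<noteq> 0" using ab Proj4_0[OF P4] by auto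
      then show ?thesis unfolding ab(1) c by (simp add: eq_fract)
    qed
    ultimately show ?thesis by blast
  qed
  moreover have "?\<pi> * r \<in> max_ideal P" if r: "r \<in> local_ring P" for r
  proof -
    obtain a b d d' where ab: "r = Fract a b" "homog d a" "homog d' b" "int d = int d' + 0" "b \<notin> P" "b \<noteq> 0"
      using r P4 unfolding local_ring_def by (rule twist_stalkE)
    have "?\<pi> * r = Fract (p * a) (Zvar \<nu> ^ e * b)" using ab by simp
    moreover have "homog (e + d) (p * a)" "homog (e + d) (Zvar \<nu> ^ e * b)"
      using ab p homog_Zvar_power by (auto intro!: homog_mult)
    moreover have "p * a \<in> P" unfolding P by simp
    moreover have "Zvar \<nu> ^ e * b \<notin> P" using P4 \<nu> ab by (simp add: Proj4_mult Proj4_power)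
    ultimately show ?thesis unfolding max_ideal_def by blast
  qed
  ultimately show ?thesis unfolding uniformizer_def by blast
qed

text \<open>After \<open>p ^ i\<close> and \<open>p ^ j\<close> have been split off, the powers of
  \<open>z\<close> restore equal degrees above and below, so that the first quotient on the right
  can be a local unit of degree 0.\<close>

lemma powi_quotient:
  fixes p z a b :: "'a::field"
  assumes "p \<noteq> 0" "z \<noteq> 0" "b \<noteq> 0"
  shows "p ^ i * a / (p ^ j * b) = a * z ^ (i * e) / (b * z ^ (j * e)) * (p / z ^ e) powi (int i - int j)"
proof -
  have "(p / z ^ e) powi (int i - int j) = (p / z ^ e) ^ i / (p / z ^ e) ^ j"
    using assms by (simp add: power_int_diff)
  also have "\<dots> = (p ^ i * z ^ (j * e)) / (p ^ j * z ^ (i * e))"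
    by (simp add: power_divide power_mult[symmetric] mult.commute)
  finally show ?thesis using assms by (simp add: field_simps)
qed

lemma prime_divisor_uniformizer:
  fixes P :: "'k::field point"
  assumes "P \<in> prime_divisors"
  obtains \<pi> where "uniformizer P \<pi>" "\<pi> \<noteq> 0" "\<pi> \<in> fun_field"
    "\<And>f. f \<in> fun_field \<Longrightarrow> f \<noteq> 0 \<Longrightarrow> \<exists>u n. u \<in> local_units P \<and> f = u * \<pi> powi n"
proof -
  have P4: "P \<in> Proj4" using assms by (rule prime_divisor_Proj4)
  obtain p e where p: "prime_elem p" "homog e p" and P: "P = {a. p dvd a}"
    using assms by (rule prime_divisorE)
  obtain \<nu> where \<nu>: "Zvar \<nu> \<notin> P" using P4 by (rule Proj4_Zvar)
  let ?\<pi> = "Fract p (Zvar \<nu> ^ e)"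
  have un: "uniformizer P ?\<pi>" using p P \<nu> by (rule uniformizer_principal)
  have p0: "p \<noteq> 0" using p(1) by (simp add: prime_elem_def)
  have \<pi>0: "?\<pi> \<noteq> 0" using p0 by (simp add: Zero_fract_def eq_fract)
  have "\<exists>u n. u \<in> local_units P \<and> f = u * ?\<pi> powi n" if f: "f \<in> fun_field" "f \<noteq> 0" for f
  proof -
    obtain a b d d' where ab: "f = Fract a b" "homog d a" "homog d' b" "int d = int d' + 0" "b \<notin> eta" "b \<noteq> 0"
      using f(1) eta_Proj4 unfolding fun_field_eq by (rule twist_stalkE)
    have "d' = d" using ab(4) by simp
    have "a \<noteq> 0" using f ab by (auto simp: fract_collapse)
    from homog_multiplicity[OF p ab(2) this] obtain i a' da
      where a': "a = p ^ i * a'" "\<not> p dvd a'" "homog da a'" "d = i * e + da" by blast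
    from homog_multiplicity[OF p ab(3) \<open>b \<noteq> 0\<close>] obtain j b' db
      where b': "b = p ^ j * b'" "\<not> p dvd b'" "homog db b'" "d' = j * e + db" by blast
    let ?z = "Zvar \<nu> :: 'k hpoly"
    let ?u = "Fract (a' * ?z ^ (i * e)) (b' * ?z ^ (j * e))"
    have "homog (da + i * e) (a' * ?z ^ (i * e))" "homog (db + j * e) (b' * ?z ^ (j * e))"
      using a' b' homog_Zvar_power by (auto intro!: homog_mult)
    moreover have "a' * ?z ^ (i * e) \<notin> P" "b' * ?z ^ (j * e) \<notin> P"
      by (intro Proj4_mult[OF P4] Proj4_power[OF P4] \<nu>; use a' b' P in simp)+
    moreover have "da + i * e = d" "db + j * e = d" using a'(4) b'(4) \<open>d' = d\<close> by simp_all
    ultimately have u: "?u \<in> local_units P"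
      by (intro local_unitI[OF P4, of d]) simp_all
    have nz: "a' \<noteq> 0" "b' \<noteq> 0"
      by (rule contrapos_nn[OF a'(2)], simp) (rule contrapos_nn[OF b'(2)], simp)
    have "f = ?u * ?\<pi> powi (int i - int j)"
      unfolding ab(1) a'(1) b'(1) Fract_eq_emb[of "p ^ i * a'" "p ^ j * b'"]
        Fract_eq_emb[of "a' * _" "b' * _"] Fract_eq_emb[of p "_ ^ e"] emb_mult emb_power
      by (rule powi_quotient) (use nz p0 in simp_all)
    then show ?thesis using u by blast
  qed
  moreover have "?\<pi> \<in> fun_field"
    using uniformizer_in_max_ideal[OF P4 un] max_ideal_local_ring local_ring_fun_field[OF P4] by blast
  ultimately show ?thesis using that un \<pi>0 by blast
qed

section \<open>Rules for orders, local rings and maximal ideals\<close>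

lemma ordP_0 [simp]: "ordP P 0 = Pinf"
  by (simp add: ordP_def)

lemma ordP_Fin: "f \<noteq> 0 \<Longrightarrow> \<exists>n. ordP P f = Fin n"
  by (simp add: ordP_def)

lemma ordP_mult:
  assumes P: "P \<in> prime_divisors" and fg: "f \<in> fun_field" "g \<in> fun_field"
  shows "ordP P (f * g) = ordP P f + ordP P g"
proof (cases "f = 0 \<or> g = 0")
  case True
  then show ?thesis
    by (cases "f = 0"; cases "g = 0") (auto dest: ordP_Fin[of _ P])
next
  case False
  have P4: "P \<in> Proj4" using P by (rule prime_divisor_Proj4)
  obtain \<pi> where \<pi>: "uniformizer P \<pi>" "\<pi> \<noteq> 0"
    "\<And>f. f \<in> fun_field \<Longrightarrow> f \<noteq> 0 \<Longrightarrow> \<exists>u n. u \<in> local_units P \<and> f = u * \<pi> powi n"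
    using P by (rule prime_divisor_uniformizer) blast
  obtain u n where f: "u \<in> local_units P" "f = u * \<pi> powi n" using \<pi>(3) fg False by blast
  obtain v m where g: "v \<in> local_units P" "g = v * \<pi> powi m" using \<pi>(3) fg False by blast
  have fg: "f * g = (u * v) * \<pi> powi (n + m)" using f g \<pi>(2) by (simp add: power_int_add)
  have "ordP P (f * g) = Fin (n + m)"
    unfolding fg by (rule ordP_eqI[OF P4 \<pi>(1,2) local_units_mult[OF P4 f(1) g(1)]])
  then show ?thesis
    unfolding f(2) g(2) ordP_eqI[OF P4 \<pi>(1,2) f(1)] ordP_eqI[OF P4 \<pi>(1,2) g(1)] by simp
qed

lemma local_ring_iff_ordP:
  assumes P: "P \<in> prime_divisors" and f: "f \<in> fun_field"
  shows "f \<in> local_ring P \<longleftrightarrow> 0 \<le> ordP P f"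
proof (cases "f = 0")
  case True
  then show ?thesis using prime_divisor_Proj4[OF P] by (simp add: local_ring_def)
next
  case False
  have P4: "P \<in> Proj4" using P by (rule prime_divisor_Proj4)
  obtain \<pi> where \<pi>: "uniformizer P \<pi>" "\<pi> \<noteq> 0"
    "\<And>f. f \<in> fun_field \<Longrightarrow> f \<noteq> 0 \<Longrightarrow> \<exists>u n. u \<in> local_units P \<and> f = u * \<pi> powi n"
    using P by (rule prime_divisor_uniformizer) blast
  obtain u n where u: "u \<in> local_units P" "f = u * \<pi> powi n" using \<pi>(3) f False by blast
  have o: "ordP P f = Fin n" using ordP_eqI[OF P4 \<pi>(1,2) u(1)] u(2) by simp
  have \<pi>l: "\<pi> \<in> local_ring P"
    using uniformizer_in_max_ideal[OF P4 \<pi>(1)] by (rule max_ideal_local_ring)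
  show ?thesis
  proof
    assume "f \<in> local_ring P"
    then have "0 \<le> n"
      using uniformizer_powi_le[OF P4 \<pi>(1,2), of f u 0 n] u by simp
    then show "0 \<le> ordP P f" by (simp add: o zero_extended_def)
  next
    assume "0 \<le> ordP P f"
    then have "0 \<le> n" by (simp add: o zero_extended_def)
    then have "\<pi> powi n \<in> local_ring P" by (simp add: power_int_def local_ring_power[OF P4 \<pi>l])
    then show "f \<in> local_ring P" unfolding u(2)
      by (intro local_ring_mult[OF P4]) (use u(1) in \<open>simp_all add: local_units_def\<close>)
  qed
qed

lemma ordP_uniformizer:
  assumes "P \<in> Proj4" "uniformizer P \<pi>" "\<pi> \<noteq> 0" shows "ordP P \<pi> = Fin 1"
  using ordP_eqI[OF assms, of 1 1] assms(1) by (simp add: local_units_def local_ring_1)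

text \<open>Membership means regularity after division by a uniformizer, and this division lowers
  the order by 1.\<close>

lemma max_ideal_iff_ordP:
  assumes P: "P \<in> prime_divisors" and f: "f \<in> fun_field"
  shows "f \<in> max_ideal P \<longleftrightarrow> Fin 1 \<le> ordP P f"
proof -
  have P4: "P \<in> Proj4" using P by (rule prime_divisor_Proj4)
  obtain \<pi> where \<pi>: "uniformizer P \<pi>" "\<pi> \<noteq> 0" "\<pi> \<in> fun_field"
    using P by (rule prime_divisor_uniformizer) blast
  have K: "f / \<pi> \<in> fun_field" using f \<pi> by (simp add: fun_field_divide)
  have "f \<in> max_ideal P \<longleftrightarrow> f / \<pi> \<in> local_ring P"
  proof
    assume "f \<in> max_ideal P"
    then obtain r where "f = \<pi> * r" "r \<in> local_ring P" using \<pi>(1) unfolding uniformizer_def by blast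
    then show "f / \<pi> \<in> local_ring P" using \<pi>(2) by simp
  next
    assume "f / \<pi> \<in> local_ring P"
    then show "f \<in> max_ideal P" using uniformizer_mult[OF \<pi>(1)] \<pi>(2) by force
  qed
  also have "\<dots> \<longleftrightarrow> 0 \<le> ordP P (f / \<pi>)" using P K by (rule local_ring_iff_ordP)
  also have "\<dots> \<longleftrightarrow> Fin 1 \<le> ordP P f"
  proof -
    have "ordP P f = ordP P (f / \<pi>) + Fin 1"
      using ordP_mult[OF P K \<pi>(3)] \<pi>(2) ordP_uniformizer[OF P4 \<pi>(1,2)] by simp
    then show ?thesis by (cases "ordP P (f / \<pi>)") (auto simp: zero_extended_def)
  qed
  finally show ?thesis .
qed

lemma ordP_attains:
  assumes P: "P \<in> prime_divisors"
  obtains f where "f \<in> fun_field" "f \<noteq> 0" "ordP P f = Fin n"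
proof -
  have P4: "P \<in> Proj4" using P by (rule prime_divisor_Proj4)
  obtain \<pi> where \<pi>: "uniformizer P \<pi>" "\<pi> \<noteq> 0" "\<pi> \<in> fun_field"
    using P by (rule prime_divisor_uniformizer) blast
  have "ordP P (1 * \<pi> powi n) = Fin n"
    by (rule ordP_eqI[OF P4 \<pi>(1,2)]) (simp add: local_units_def local_ring_1 P4)
  then show ?thesis using that[of "\<pi> powi n"] \<pi> by (simp add: fun_field_powi)
qed

lemma ordP_local_unit:
  assumes P: "P \<in> prime_divisors" and u: "u \<in> local_units P"
  shows "ordP P u = Fin 0"
proof -
  have P4: "P \<in> Proj4" using P by (rule prime_divisor_Proj4)
  obtain \<pi> where \<pi>: "uniformizer P \<pi>" "\<pi> \<noteq> 0"
    using P by (rule prime_divisor_uniformizer) blast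
  show ?thesis using ordP_eqI[OF P4 \<pi> u, of 0] by simp
qed

lemma zf_local_unit:
  assumes "P \<in> Proj4" "Zvar \<mu> \<notin> P" "Zvar \<nu> \<notin> P"
  shows "zf \<mu> / zf \<nu> \<in> local_units P"
  using local_unitI[OF assms(1) homog_Zvar homog_Zvar assms(2,3)] by (simp add: zf_def)

lemma ordP_Hyp_zf:
  assumes "\<mu> \<noteq> \<nu>" shows "ordP (Hyp \<nu>) (zf \<nu> / zf \<mu>) = Fin 1"
proof (rule ordP_uniformizer)
  show "Hyp \<nu> \<in> Proj4" by (rule prime_divisor_Proj4[OF Hyp_prime_divisor])
  have "uniformizer (Hyp \<nu>) (Fract (Zvar \<nu>) (Zvar \<mu> ^ 1))"
    by (rule uniformizer_principal[OF prime_elem_Zvar homog_Zvar Hyp_eq]) (use assms in \<open>simp add: Zvar_in_Hyp\<close>)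
  then show "uniformizer (Hyp \<nu>) (zf \<nu> / zf \<mu>)" by (simp add: zf_def)
qed simp

text \<open>Every such divisor is generated by one of the finitely many prime factors of
  \<open>a\<close>. A factor of \<open>a\<close> may fail to be homogeneous, but one that lies in
  \<open>P\<close> is associated to the homogeneous generator of \<open>P\<close>.\<close>

lemma finite_prime_divisors_containing:
  fixes a :: "'k::field hpoly"
  assumes "a \<noteq> 0" shows "finite {P \<in> prime_divisors. a \<in> P}"
proof -
  obtain u F where F: "u dvd 1" "a = u * prod_mset F" "\<And>p. p \<in># F \<Longrightarrow> prime_elem p"
    by (rule hpoly_factorization[OF assms]) blast
  have "P \<in> (\<lambda>p. {a. p dvd a}) ` set_mset F" if P: "P \<in> prime_divisors" "a \<in> P" for P
  proof -
    obtain p e where p: "prime_elem p" "homog e p" and Pp: "P = {a. p dvd a}"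
      using P(1) by (rule prime_divisorE)
    have P4: "P \<in> Proj4" using P(1) by (rule prime_divisor_Proj4)
    have "u \<notin> P" using Proj4_dvd[OF P4 _ F(1)] Proj4_1[OF P4] by metis
    then have "prod_mset F \<in> P" using Proj4_mult[OF P4, of u "prod_mset F"] F(2) P(2) by metis
    then have "\<exists>q. q \<in># F \<and> q \<in> P"
    proof (induction F)
      case empty
      then show ?case using Proj4_1[OF P4] by simp
    next
      case (add q F)
      then have "q \<in> P \<or> prod_mset F \<in> P" using Proj4_mult[OF P4, of q "prod_mset F"] by auto
      then show ?case using add.IH by auto
    qed
    then obtain q where q: "q \<in># F" "q \<in> P" by metis
    have "p dvd q" using q(2) Pp by simp
    moreover from this have "q dvd p" by (rule prime_dvd_prime[OF p(1) F(3)[OF q(1)]])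
    ultimately have "P = {a. q dvd a}"
      unfolding Pp by (intro Collect_cong iffI) (erule (1) dvd_trans[rotated], erule (1) dvd_trans[rotated])
    then show ?thesis using q(1) by (rule image_eqI)
  qed
  then have "{P \<in> prime_divisors. a \<in> P} \<subseteq> (\<lambda>p. {a. p dvd a}) ` set_mset F" by (intro subsetI) simp
  then show ?thesis by (rule finite_subset) simp
qed

lemma finite_ordP_neq_0:
  fixes f :: "'k::field hfrac"
  assumes "f \<in> fun_field" "f \<noteq> 0"
  shows "finite {P \<in> prime_divisors. ordP P f \<noteq> Fin 0}"
proof -
  obtain a b d d' where ab: "f = Fract a b" "homog d a" "homog d' b" "int d = int d' + 0" "b \<notin> eta" "b \<noteq> 0"
    using assms(1) eta_Proj4 unfolding fun_field_eq by (rule twist_stalkE)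
  have "a \<noteq> 0" using assms ab by (auto simp: fract_collapse)
  have "a \<in> P \<or> b \<in> P" if P: "P \<in> prime_divisors" "ordP P f \<noteq> Fin 0" for P
  proof (rule ccontr)
    assume "\<not> ?thesis"
    then have "f \<in> local_units P"
      unfolding ab(1) using ab by (intro local_unitI[OF prime_divisor_Proj4[OF P(1)], of d]) auto
    then show False using ordP_local_unit[OF P(1)] P(2) by simp
  qed
  then have "{P \<in> prime_divisors. ordP P f \<noteq> Fin 0} \<subseteq>
      {P \<in> prime_divisors. a \<in> P} \<union> {P \<in> prime_divisors. b \<in> P}" by (intro subsetI) auto
  then show ?thesis
    by (rule finite_subset) (simp add: finite_prime_divisors_containing \<open>a \<noteq> 0\<close> \<open>b \<noteq> 0\<close>)
qed

section \<open>The exterior square of the tangent sheaf\<close>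

text \<open>For alternating \<open>B\<close> this is the coefficient of e_k \<and> e_l \<and> e_m in
  (e_0 + ... + e_4) \<and> B. It does not change if a multiple of e_0 + ... + e_4 is wedged with a
  vector and added to \<open>B\<close>, so it respects the relation between a_0, ..., a_4.\<close>

definition tri :: "'f::field^5^5 \<Rightarrow> 5 \<Rightarrow> 5 \<Rightarrow> 5 \<Rightarrow> 'f" where
  "tri B k l m = B$k$l + B$l$m + B$m$k"

definition alternating :: "'f::field^5^5 \<Rightarrow> bool" where
  "alternating B \<longleftrightarrow> (\<forall>i j. B$i$j = - B$j$i) \<and> (\<forall>i. B$i$i = 0)"

definition ext2_generic :: "('f::field^5^5) set" where
  "ext2_generic = {B. alternating B \<and> (\<forall>j. B$0$j = 0)}"

text \<open>If \<open>B = p\<^sub>0 A\<close>, then \<open>z\<^sub>k z\<^sub>l z\<^sub>m tri B k l m\<close> is a coefficient of \<open>s \<and> A \<in> \<Lambda>\<^sup>3V(3)\<close>,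
  and \<open>s \<and> _\<close> embeds \<open>\<Lambda>\<^sup>2\<T>\<close> as a subbundle of \<open>\<Lambda>\<^sup>3V(3)\<close>.\<close>

definition ext2_stalk :: "'k::field point \<Rightarrow> ('k hfrac^5^5) set" where
  "ext2_stalk x = {B \<in> ext2_generic. \<forall>k l m. zf k * zf l * zf m * tri B k l m \<in> twist_stalk 3 x}"

lemma alternatingD: "alternating B \<Longrightarrow> B$i$j = - B$j$i" "alternating B \<Longrightarrow> B$i$i = 0"
  unfolding alternating_def by (drule conjunct1, drule spec, erule spec) (drule conjunct2, erule spec)

lemma ext2_genericD:
  assumes "B \<in> ext2_generic"
  shows "alternating B" "B$i$j = - B$j$i" "B$i$i = 0" "B$0$j = 0" "B$i$0 = 0"
proof -
  show *: "alternating B" "B$0$j = 0" using assms by (simp_all add: ext2_generic_def)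
  show "B$i$j = - B$j$i" "B$i$i = 0" using *(1) by (rule alternatingD)+
  show "B$i$0 = 0" using alternatingD(1)[OF *(1), of i 0] assms by (simp add: ext2_generic_def)
qed

lemma alternating_wedge: "alternating (wedge v w)"
  by (simp add: alternating_def wedge_def)

lemma mscale_nth [simp]: "mscale c A $ i $ j = c * A$i$j"
  by (simp add: mscale_def)

lemma ext2_genericI:
  assumes "\<And>i j. B$i$j = - B$j$i" "\<And>i. B$i$i = 0" "\<And>j. B$0$j = 0"
  shows "B \<in> ext2_generic"
  unfolding ext2_generic_def alternating_def using assms by blast

lemma ext2_generic_0: "0 \<in> ext2_generic"
  by (simp add: ext2_generic_def alternating_def)

lemma ext2_generic_add:
  assumes "A \<in> ext2_generic" "B \<in> ext2_generic" shows "A + B \<in> ext2_generic"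
proof (rule ext2_genericI)
  fix i j
  show "(A + B)$i$j = - (A + B)$j$i"
    using ext2_genericD(2)[OF assms(1), of i j] ext2_genericD(2)[OF assms(2), of i j] by simp
qed (simp_all add: ext2_genericD(3,4)[OF assms(1)] ext2_genericD(3,4)[OF assms(2)])

lemma ext2_generic_mscale:
  assumes "A \<in> ext2_generic" shows "mscale c A \<in> ext2_generic"
proof (rule ext2_genericI)
  fix i j
  show "mscale c A$i$j = - mscale c A$j$i"
    using ext2_genericD(2)[OF assms(1), of i j] by simp
qed (simp_all add: ext2_genericD(3,4)[OF assms(1)])

lemma ext2_generic_uminus:
  assumes "A \<in> ext2_generic" shows "- A \<in> ext2_generic"
proof (rule ext2_genericI)
  fix i j
  show "(- A)$i$j = - (- A)$j$i"
    using ext2_genericD(2)[OF assms(1), of i j] by simp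
qed (simp_all add: ext2_genericD(3,4)[OF assms(1)])

lemma tri_add: "tri (A + B) k l m = tri A k l m + tri B k l m"
  and tri_diff: "tri (A - B) k l m = tri A k l m - tri B k l m"
  and tri_uminus: "tri (- A) k l m = - tri A k l m"
  and tri_mscale: "tri (mscale c A) k l m = c * tri A k l m"
  and tri_0: "tri 0 k l m = 0"
  by (simp_all add: tri_def algebra_simps)

lemma iota_star_axis: "iota_star (axis a 1) $ i = (if a = i then 1 / zf i else 0) - (if a = 0 then 1 / zf 0 else 0)"
  by (auto simp: iota_star_def axis_def)

text \<open>By alternation the sum over ordered pairs becomes a full double sum. Each column of
  \<open>iota_star\<close> has at most two contributions, so four terms survive, and the one with
  \<open>A$0$0\<close> vanishes.\<close>

lemma p0_nth:
  fixes A :: "'k::field hfrac^5^5"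
  assumes "alternating A"
  shows "p0 A $ i $ j = A$i$j / (zf i * zf j) - A$0$j / (zf 0 * zf j) - A$i$0 / (zf i * zf 0)"
proof -
  define x where "x = (\<lambda>a. iota_star (axis a 1 :: 'k hfrac^5) $ i)"
  define y where "y = (\<lambda>a. iota_star (axis a 1 :: 'k hfrac^5) $ j)"
  have x: "(\<Sum>a\<in>UNIV. g a * x a) = g i / zf i - g 0 / zf 0" for g
    unfolding x_def iota_star_axis
    by (simp add: right_diff_distrib sum_subtractf if_distrib[of "\<lambda>t. _ * t"] cong: if_cong)
  have y: "(\<Sum>a\<in>UNIV. g a * y a) = g j / zf j - g 0 / zf 0" for g
    unfolding y_def iota_star_axis
    by (simp add: right_diff_distrib sum_subtractf if_distrib[of "\<lambda>t. _ * t"] cong: if_cong)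
  have "p0 A $ i $ j = (\<Sum>(a, b) | a < b. A$a$b * (x a * y b - y a * x b))"
    by (simp add: p0_def ext2_map_def wedge_def x_def y_def case_prod_unfold)
  also have "\<dots> = (\<Sum>(a, b) | a < b. A$a$b * y b * x a + A$b$a * y a * x b)"
  proof (intro sum.cong refl, clarify)
    fix a b :: 5
    have "A$b$a = - A$a$b" by (rule alternatingD(1)[OF assms])
    then show "A$a$b * (x a * y b - y a * x b) = A$a$b * y b * x a + A$b$a * y a * x b"
      by (simp add: algebra_simps)
  qed
  also have "\<dots> = (\<Sum>a\<in>UNIV. \<Sum>b\<in>UNIV. A$a$b * y b * x a)"
    by (rule sum_pairs_split[symmetric]) (simp add: alternatingD(2)[OF assms])
  also have "\<dots> = (\<Sum>a\<in>UNIV. (A$a$j / zf j - A$a$0 / zf 0) * x a)"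
    by (simp add: y flip: sum_distrib_right)
  also have "\<dots> = A$i$j / (zf i * zf j) - A$0$j / (zf 0 * zf j) - A$i$0 / (zf i * zf 0)"
    unfolding x by (simp add: alternatingD(2)[OF assms] diff_divide_distrib mult.commute)
  finally show ?thesis .
qed

lemma p0_ext2_generic:
  fixes A :: "'k::field hfrac^5^5"
  assumes "alternating A" shows "p0 A \<in> ext2_generic"
proof -
  note A = alternatingD[OF assms]
  show ?thesis
  proof (rule ext2_genericI)
    fix i j
    show "p0 A $ i $ j = - p0 A $ j $ i"
      unfolding p0_nth[OF assms] using A(1)[of i j] A(1)[of 0 i] A(1)[of 0 j] by (simp add: mult.commute)
    show "p0 A $ i $ i = 0" "p0 A $ 0 $ j = 0"
      unfolding p0_nth[OF assms] using A(1)[of 0 i] A(2) by (simp_all add: mult.commute)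
  qed
qed

text \<open>The terms of \<open>p0_nth\<close> with index 0 cancel in the cyclic sum: the
  elimination of a_0 leaves no trace in these coordinates.\<close>

lemma tri_p0:
  fixes A :: "'k::field hfrac^5^5"
  assumes "alternating A"
  shows "zf k * zf l * zf m * tri (p0 A) k l m = zf k * A$l$m + zf l * A$m$k + zf m * A$k$l"
proof -
  have *: "A$i$0 = - A$0$i" for i using assms by (rule alternatingD(1))
  show ?thesis unfolding tri_def p0_nth[OF assms] *[of k] *[of l] *[of m] by (simp add: field_simps)
qed

lemma ext2_stalk_wedge:
  assumes x: "x \<in> Proj4" and v: "\<And>i. v$i \<in> twist_stalk 1 x" and w: "\<And>i. w$i \<in> twist_stalk 1 x"
  shows "wedge (iota_star v) (iota_star w) \<in> ext2_stalk x"
proof -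
  have A: "wedge v w $ i $ j \<in> twist_stalk 2 x" for i j
    using ts_mult[OF x v w, of 2] by (auto simp: wedge_def intro!: ts_diff[OF x])
  have "zf k * wedge v w $ i $ j \<in> twist_stalk 3 x" for k i j
    by (rule ts_mult[OF x ts_zf[OF x] A]) simp
  then show ?thesis
    unfolding p0_wedge[symmetric] ext2_stalk_def
    by (auto simp: p0_ext2_generic alternating_wedge tri_p0 intro!: ts_add[OF x])
qed

lemma ext2_stalk_add: "x \<in> Proj4 \<Longrightarrow> A \<in> ext2_stalk x \<Longrightarrow> B \<in> ext2_stalk x \<Longrightarrow> A + B \<in> ext2_stalk x"
  unfolding ext2_stalk_def by (auto simp: ext2_generic_add tri_add distrib_left)

lemma ext2_stalk_uminus: "x \<in> Proj4 \<Longrightarrow> A \<in> ext2_stalk x \<Longrightarrow> - A \<in> ext2_stalk x"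
  unfolding ext2_stalk_def by (auto simp: ext2_generic_uminus tri_uminus)

lemma ext2_stalk_0: "x \<in> Proj4 \<Longrightarrow> 0 \<in> ext2_stalk x"
  unfolding ext2_stalk_def by (auto simp: ext2_generic_0 tri_0)

lemma ext2_stalk_mscale:
  assumes "x \<in> Proj4" "c \<in> twist_stalk 0 x" "A \<in> ext2_stalk x" shows "mscale c A \<in> ext2_stalk x"
proof -
  have "c * (zf k * zf l * zf m * tri A k l m) \<in> twist_stalk 3 x" for k l m
    using assms by (intro ts_mult[of x c 0 _ 3]) (auto simp: ext2_stalk_def)
  then show ?thesis using assms(3)
    by (auto simp: ext2_stalk_def ext2_generic_mscale tri_mscale ac_simps)
qed

lemma ext2_stalk_sum:
  assumes "x \<in> Proj4" "\<And>i. i \<in> I \<Longrightarrow> A i \<in> ext2_stalk x"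
  shows "(\<Sum>i\<in>I. A i) \<in> ext2_stalk x"
  using assms(2)
  by (induction I rule: infinite_finite_induct) (auto simp: ext2_stalk_0 assms(1) intro: ext2_stalk_add[OF assms(1)])

section \<open>Sections of \<open>ext2_tangent\<close> and the stalkwise description\<close>

lemma tangent_stalk:
  assumes "v \<in> tangent W" "x \<in> W"
  obtains v' where "v = iota_star v'" "\<forall>i. v'$i \<in> twist_stalk 1 x"
proof -
  from assms obtain W' v' where "x \<in> W'" "v = iota_star v'" "v' \<in> Vtw 1 W'"
    unfolding tangent_def sheafify_def by blast
  then show ?thesis using that by (auto simp: Vtw_def twist_def)
qed

lemma ext2_tangent_imp_stalk:
  assumes "zopen U" "B \<in> ext2_tangent U" "x \<in> U"
  shows "B \<in> ext2_stalk x"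
proof -
  have x: "x \<in> Proj4" using assms zopen_subset by blast
  obtain W where W: "x \<in> W" "B \<in> lin_span mscale (twist 0 W) {wedge v w | v w. v \<in> tangent W \<and> w \<in> tangent W}"
    using assms unfolding ext2_tangent_def sheafify_def by blast
  from W(2) obtain n :: nat and c g where B: "B = (\<Sum>i<n. mscale (c i) (g i))"
    and cg: "\<forall>i<n. c i \<in> twist 0 W \<and> g i \<in> {wedge v w | v w. v \<in> tangent W \<and> w \<in> tangent W}"
    unfolding lin_span_def by blast
  have "mscale (c i) (g i) \<in> ext2_stalk x" if "i < n" for i
  proof -
    have "g i \<in> {wedge v w | v w. v \<in> tangent W \<and> w \<in> tangent W}" using cg that by simp
    then obtain v w where g: "g i = wedge v w" "v \<in> tangent W" "w \<in> tangent W" by blast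
    obtain v' where v: "v = iota_star v'" "\<forall>i. v'$i \<in> twist_stalk 1 x" using g(2) W(1) by (rule tangent_stalk)
    obtain w' where w: "w = iota_star w'" "\<forall>i. w'$i \<in> twist_stalk 1 x" using g(3) W(1) by (rule tangent_stalk)
    have "c i \<in> twist_stalk 0 x" using cg that W(1) by (auto simp: twist_def)
    moreover have "g i \<in> ext2_stalk x" unfolding g(1) v(1) w(1) using v(2) w(2) by (intro ext2_stalk_wedge[OF x]) simp_all
    ultimately show ?thesis by (rule ext2_stalk_mscale[OF x])
  qed
  then show ?thesis unfolding B by (intro ext2_stalk_sum[OF x]) simp
qed

lemma lin_span_sum:
  assumes "finite I" "\<And>i. i \<in> I \<Longrightarrow> c i \<in> R \<and> g i \<in> G"
  shows "(\<Sum>i\<in>I. scl (c i) (g i)) \<in> lin_span scl R G"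
proof -
  obtain h where h: "bij_betw h {0..<card I} I" using ex_bij_betw_nat_finite[OF assms(1)] by blast
  have "(\<Sum>i\<in>I. scl (c i) (g i)) = (\<Sum>j<card I. scl (c (h j)) (g (h j)))"
    using sum.reindex_bij_betw[OF h, of "\<lambda>i. scl (c i) (g i)"] by (simp add: atLeast0LessThan)
  moreover have "\<forall>j<card I. c (h j) \<in> R \<and> g (h j) \<in> G"
    using assms(2) bij_betwE[OF h] by auto
  ultimately show ?thesis unfolding lin_span_def
    by (intro CollectI exI[of _ "card I"] exI[of _ "\<lambda>j. c (h j)"] exI[of _ "\<lambda>j. g (h j)"] conjI)
qed

text \<open>For \<open>B\<close> in \<open>ext2_generic\<close>, the preimage under
  \<open>p0\<close> whose row and column \<nu> vanish: \<open>tri B \<nu> i j\<close> is the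
  coefficient of a_i \<and> a_j after a_\<nu>, instead of a_0, has been eliminated. If
  \<open>B\<close> lies in \<open>ext2_stalk x\<close>, the product of z_\<nu> with each entry is in
  O(3)_x, so the lift is regular where z_\<nu> is a unit.\<close>

definition ext2_lift :: "5 \<Rightarrow> 'k::field hfrac^5^5 \<Rightarrow> 'k hfrac^5^5" where
  "ext2_lift \<nu> B = (\<chi> i j. zf i * zf j * tri B \<nu> i j)"

lemma p0_ext2_lift:
  assumes "B \<in> ext2_generic" shows "p0 (ext2_lift \<nu> B) = B"
proof -
  note B = ext2_genericD(2-5)[OF assms]
  have "ext2_lift \<nu> B$i$j = - ext2_lift \<nu> B$j$i" for i j
    using B(1)[of \<nu> i] B(1)[of i j] B(1)[of j \<nu>] by (simp add: ext2_lift_def tri_def algebra_simps)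
  moreover have "ext2_lift \<nu> B$i$i = 0" for i
    using B(1)[of \<nu> i] B(2) by (simp add: ext2_lift_def tri_def)
  ultimately have "alternating (ext2_lift \<nu> B)" unfolding alternating_def by blast
  then show ?thesis
    by (simp add: vec_eq_iff p0_nth) (simp add: ext2_lift_def tri_def B(3,4))
qed

lemma ext2_stalk_imp_tangent:
  fixes B :: "'k::field hfrac^5^5"
  assumes U: "zopen U" and B: "\<And>x. x \<in> U \<Longrightarrow> B \<in> ext2_stalk x"
  shows "B \<in> ext2_tangent U"
proof -
  have "\<exists>W. zopen W \<and> x \<in> W \<and> W \<subseteq> U \<and> B \<in> lin_span mscale (twist 0 W)
      {wedge v w | v w. v \<in> tangent W \<and> w \<in> tangent W}" if xU: "x \<in> U" for x
  proof -
    have x: "x \<in> Proj4" using xU U zopen_subset by blast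
    obtain \<nu> where \<nu>: "Zvar \<nu> \<notin> x" using x by (rule Proj4_Zvar)
    define z where "z = (zf \<nu> :: 'k hfrac)"
    define C where "C = ext2_lift \<nu> B"
    \<comment> \<open>Coefficients in \<open>lin_span\<close> have degree 0, while sections of V(1)
      have degree 1. So each of the two wedge factors receives one z_\<nu>, and the coefficient is
      divided by its square.\<close>
    define c where "c = (\<lambda>ij. C $ fst ij $ snd ij / z / z)"
    have Bx: "B \<in> ext2_stalk x" using B xU .
    have "c ij \<in> twist_stalk 0 x" for ij
    proof -
      have "zf \<nu> * C $ fst ij $ snd ij \<in> twist_stalk (2 + 1) x"
        using Bx by (simp add: C_def ext2_lift_def ext2_stalk_def flip: mult.assoc)
      then have "C $ fst ij $ snd ij \<in> twist_stalk (1 + 1) x" using ts_zf_mult_iff[OF x \<nu>, of _ 2] by simp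
      then have "C $ fst ij $ snd ij / z \<in> twist_stalk (0 + 1) x"
        unfolding z_def using zf_divide_stalk[OF x _ \<nu>, of _ 1] by simp
      then show ?thesis unfolding c_def z_def by (rule zf_divide_stalk[OF x _ \<nu>])
    qed
    then obtain W where W: "zopen W" "x \<in> W" "W \<subseteq> U" "\<forall>ij\<in>UNIV. c ij \<in> twist 0 W"
      using stalk_nbhd[of "UNIV :: (5 \<times> 5) set" x U c "\<lambda>_. 0"] xU U by auto
    define e where "e = (\<lambda>i. iota_star (axis i z :: 'k hfrac^5))"
    have e: "e i \<in> tangent W" for i
    proof -
      have "axis i z $ j \<in> twist 1 W" for j
        using zopen_subset[OF W(1)] by (auto simp: axis_def z_def twist_def)
      then have "axis i z \<in> Vtw 1 W" by (simp add: Vtw_def)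
      then show ?thesis unfolding e_def tangent_def sheafify_def using W(1) by blast
    qed
    have ez: "e i = z *s iota_star (axis i 1)" for i
      by (auto simp: e_def vec_eq_iff iota_star_def axis_def algebra_simps)
    have z0: "z \<noteq> 0" by (simp add: z_def)
    have "B = p0 C" unfolding C_def using Bx by (simp add: p0_ext2_lift ext2_stalk_def)
    also have "\<dots> = (\<Sum>ij\<in>{(i, j). i < j}. mscale (c ij) (wedge (e (fst ij)) (e (snd ij))))"
      unfolding p0_def ext2_map_def
    proof (intro sum.cong refl, clarify)
      fix i j :: 5
      show "mscale (C$i$j) (wedge (iota_star (axis i 1)) (iota_star (axis j 1))) =
          mscale (c (i, j)) (wedge (e (fst (i, j))) (e (snd (i, j))))"
        using z0 by (simp add: vec_eq_iff ez c_def wedge_def field_simps)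
    qed
    also have "\<dots> \<in> lin_span mscale (twist 0 W) {wedge v w | v w. v \<in> tangent W \<and> w \<in> tangent W}"
    proof (rule lin_span_sum)
      show "finite {(i, j). i < (j :: 5)}" by (rule finite_subset[OF subset_UNIV]) simp
      fix ij :: "5 \<times> 5"
      show "c ij \<in> twist 0 W \<and> wedge (e (fst ij)) (e (snd ij)) \<in>
          {wedge v w | v w. v \<in> tangent W \<and> w \<in> tangent W}" using W(4) e by blast
    qed
    finally show ?thesis using W by blast
  qed
  then show ?thesis unfolding ext2_tangent_def sheafify_def by blast
qed

lemma ext2_tangent_iff: "zopen U \<Longrightarrow> B \<in> ext2_tangent U \<longleftrightarrow> (\<forall>x\<in>U. B \<in> ext2_stalk x)"
  using ext2_tangent_imp_stalk ext2_stalk_imp_tangent by blast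

lemma ext2_stalk_nbhd:
  assumes "B \<in> ext2_stalk x" "x \<in> U" "zopen U"
  obtains W where "zopen W" "x \<in> W" "W \<subseteq> U" "\<And>y. y \<in> W \<Longrightarrow> B \<in> ext2_stalk y"
proof -
  let ?f = "\<lambda>(k, l, m). zf k * zf l * zf m * tri B k l m"
  have "\<exists>W. zopen W \<and> x \<in> W \<and> W \<subseteq> U \<and> (\<forall>i\<in>(UNIV :: (5 \<times> 5 \<times> 5) set). ?f i \<in> twist 3 W)"
    by (rule stalk_nbhd) (use assms in \<open>auto simp: ext2_stalk_def\<close>)
  then obtain W where W: "zopen W" "x \<in> W" "W \<subseteq> U" "\<And>i. ?f i \<in> twist 3 W" by blast
  have "B \<in> ext2_stalk y" if "y \<in> W" for y
    using W(4) that assms(1) by (force simp: ext2_stalk_def twist_def)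
  then show ?thesis using that W by blast
qed

section \<open>The monad in coordinates\<close>

text \<open>These are the pairings of \<open>B\<close> with \<open>[\<nu>+1,\<nu>-1]\<close> and with \<open>[\<nu>+2,\<nu>-2]\<close>.\<close>

definition xcoord :: "'f::field^5^5 \<Rightarrow> 5 \<Rightarrow> 'f" where
  "xcoord B \<nu> = tri B \<nu> (\<nu> + 2) (\<nu> - 2)"

definition ycoord :: "'f::field^5^5 \<Rightarrow> 5 \<Rightarrow> 'f" where
  "ycoord B \<nu> = tri B \<nu> (\<nu> + 1) (\<nu> - 1)"

lemmas coord_simps = xcoord_def ycoord_def tri_add tri_diff tri_uminus tri_mscale tri_0

lemma minus_eq_plus_5: "(i::5) - 1 = i + 4" "i - 2 = i + 3" "i - 3 = i + 2" "i - 4 = i + 1"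
  by (simp_all add: diff_eq_eq add.assoc)

text \<open>The ten three-element subsets of Z/5 form two orbits under translation, those of {0, 2,
  -2} and {0, 1, -1}. Since \<open>tri\<close> is invariant under cyclic permutations, changes sign
  under a transposition and vanishes on repeated indices, these ten values decide all
  triples.\<close>

lemma ext2_stalk_iff:
  fixes B :: "'k::field hfrac^5^5"
  assumes x: "x \<in> Proj4" and B: "B \<in> ext2_generic"
  shows "B \<in> ext2_stalk x \<longleftrightarrow> (\<forall>\<nu>. zf \<nu> * zf (\<nu> + 2) * zf (\<nu> - 2) * xcoord B \<nu> \<in> twist_stalk 3 x
    \<and> zf \<nu> * zf (\<nu> + 1) * zf (\<nu> - 1) * ycoord B \<nu> \<in> twist_stalk 3 x)" (is "_ \<longleftrightarrow> ?R")
proof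
  assume "B \<in> ext2_stalk x"
  then show ?R by (simp add: ext2_stalk_def xcoord_def ycoord_def)
next
  assume R: ?R
  define Q where "Q = (\<lambda>k l m. zf k * zf l * zf m * tri B k l m \<in> twist_stalk 3 x)"
  have cyc: "Q l m k \<longleftrightarrow> Q k l m" for k l m
  proof -
    have "zf l * zf m * zf k * tri B l m k = zf k * zf l * zf m * tri B k l m"
      by (simp add: tri_def ac_simps)
    then show ?thesis by (simp only: Q_def)
  qed
  have swap: "Q k m l \<longleftrightarrow> Q k l m" for k l m
  proof -
    have "tri B k m l = - tri B k l m"
      using ext2_genericD(2)[OF B, of k m] ext2_genericD(2)[OF B, of m l] ext2_genericD(2)[OF B, of l k]
      by (simp add: tri_def)
    then have "zf k * zf m * zf l * tri B k m l = - (zf k * zf l * zf m * tri B k l m)"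
      by (simp add: ac_simps)
    then show ?thesis by (simp only: Q_def ts_uminus_iff[OF x])
  qed
  have "tri B k k m = 0" for k m
    using ext2_genericD(2)[OF B, of k m] ext2_genericD(3)[OF B, of k] by (simp add: tri_def)
  then have eq: "Q k k m" for k m using x by (simp add: Q_def)
  then have eq': "Q k m k" "Q k m m" for k m using cyc by blast+
  have Q2: "Q k (k + 2) (k + 3)" and Q1: "Q k (k + 1) (k + 4)" for k
    using R by (simp_all add: Q_def xcoord_def ycoord_def minus_eq_plus_5)
  have Q12: "Q k (k + 1) (k + 2)" for k using Q1[of "k + 1"] cyc[of "k + 1" "k + 2" k] by (simp add: add.assoc)
  have Q13: "Q k (k + 1) (k + 3)" for k using Q2[of "k + 3"] cyc[of k "k + 1" "k + 3"] by (simp add: add.assoc)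
  have Q24: "Q k (k + 2) (k + 4)" for k using Q2[of "k + 2"] cyc[of "k + 2" "k + 4" k] by (simp add: add.assoc)
  have Q34: "Q k (k + 3) (k + 4)" for k using Q1[of "k + 4"] cyc[of k "k + 3" "k + 4"] by (simp add: add.assoc)
  note Qs = Q1 Q2 Q12 Q13 Q24 Q34
  note Qs' = Qs[THEN swap[THEN iffD2]]
  have Q: "Q k (k + a) (k + b)" for k a b
    using exhaust_5[of a] exhaust_5[of b] by (elim disjE) (simp_all add: eq eq' Qs Qs')
  have "Q k l m" for k l m using Q[of k "l - k" "m - k"] by simp
  then show "B \<in> ext2_stalk x" using B by (simp add: ext2_stalk_def Q_def)
qed

section \<open>The maps p and q in coordinates\<close>

lemma f_up_plus_nth:
  "f_up_plus w $ i $ j = (if j = i + 1 then w$(i + 3) else if i = j + 1 then - w$(j + 3) else 0)"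
proof -
  have "\<forall>i j. f_up_plus w $ i $ j = (if j = i + 1 then w$(i + 3) else if i = j + 1 then - w$(j + 3) else 0)"
    unfolding forall_5 by (simp add: f_up_plus_def sum_5 wedge_def axis_def)
  then show ?thesis by blast
qed

lemma f_up_minus_nth:
  "f_up_minus w $ i $ j = (if i = j + 2 then w$(j + 1) else if j = i + 2 then - w$(i + 1) else 0)"
proof -
  have "\<forall>i j. f_up_minus w $ i $ j = (if i = j + 2 then w$(j + 1) else if j = i + 2 then - w$(i + 1) else 0)"
    unfolding forall_5 by (simp add: f_up_minus_def sum_5 wedge_def axis_def)
  then show ?thesis by blast
qed

lemma alternating_f_up: "alternating (f_up_plus w)" "alternating (f_up_minus w)"
  unfolding alternating_def forall_5 by (simp_all add: f_up_plus_nth f_up_minus_nth)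

lemma coord_p0_f_up_plus:
  "zf \<nu> * zf (\<nu> + 2) * zf (\<nu> - 2) * xcoord (p0 (f_up_plus w)) \<nu> = zf \<nu> * w$\<nu>"
  "zf \<nu> * zf (\<nu> + 1) * zf (\<nu> - 1) * ycoord (p0 (f_up_plus w)) \<nu>
    = zf (\<nu> + 1) * w$(\<nu> + 2) + zf (\<nu> - 1) * w$(\<nu> - 2)"
  unfolding xcoord_def ycoord_def tri_p0[OF alternating_f_up(1)]
  by (simp_all add: f_up_plus_nth minus_eq_plus_5 add.assoc)

lemma coord_p0_f_up_minus:
  "zf \<nu> * zf (\<nu> + 2) * zf (\<nu> - 2) * xcoord (p0 (f_up_minus w)) \<nu>
    = - (zf (\<nu> - 2) * w$(\<nu> + 1) + zf (\<nu> + 2) * w$(\<nu> - 1))"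
  "zf \<nu> * zf (\<nu> + 1) * zf (\<nu> - 1) * ycoord (p0 (f_up_minus w)) \<nu> = zf \<nu> * w$\<nu>"
  unfolding xcoord_def ycoord_def tri_p0[OF alternating_f_up(2)]
  by (simp_all add: f_up_minus_nth minus_eq_plus_5 add.assoc)

lemma p0_sum_mscale:
  fixes A :: "5 \<Rightarrow> 'k::field hfrac^5^5"
  shows "p0 (\<Sum>\<nu>\<in>UNIV. mscale (c \<nu>) (A \<nu>)) = (\<Sum>\<nu>\<in>UNIV. mscale (c \<nu>) (p0 (A \<nu>)))"
proof -
  have p0: "p0 C $ i $ j = (\<Sum>ab | fst ab < snd ab. C $ fst ab $ snd ab *
      wedge (iota_star (axis (fst ab) 1)) (iota_star (axis (snd ab) 1)) $ i $ j)" for C :: "'k hfrac^5^5" and i j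
    by (simp add: p0_def ext2_map_def case_prod_unfold)
  have "p0 (\<Sum>\<nu>\<in>UNIV. mscale (c \<nu>) (A \<nu>)) $ i $ j = (\<Sum>\<nu>\<in>UNIV. mscale (c \<nu>) (p0 (A \<nu>))) $ i $ j" for i j
    unfolding sum_5 by (simp add: p0 sum_distrib_left distrib_right sum.distrib mult.assoc)
  then show ?thesis by (simp add: vec_eq_iff)
qed

lemma ext2_pair_mscale: "ext2_pair B (mscale a X) = a * ext2_pair B X"
  by (simp add: ext2_pair_def distrib_left right_diff_distrib mult.left_commute)

lemma ext2_pair_sum_mscale:
  "ext2_pair B (\<Sum>\<nu>\<in>UNIV. mscale (c \<nu>) (A \<nu>)) = (\<Sum>\<nu>\<in>(UNIV :: 5 set). c \<nu> * ext2_pair B (A \<nu>))"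
proof -
  have add: "ext2_pair B (X + Y) = ext2_pair B X + ext2_pair B Y" for X Y
    by (simp add: ext2_pair_def distrib_left)
  show ?thesis by (simp add: sum_5 add ext2_pair_mscale)
qed

lemma avec_nth: "avec a $ i = (if a = i then 1 else 0) - (if a = 0 then 1 else 0)"
  by (simp add: avec_def iota_star_def axis_def)

lemma wedge_iota_star_dz:
  "wedge (iota_star (dz a)) (iota_star (dz b)) = mscale (1 / (zf a * zf b)) (brk a b :: 'k::field hfrac^5^5)"
proof -
  have "iota_star (dz c) $ i = avec c $ i / (zf c :: 'k hfrac)" for c i
    by (simp add: iota_star_axis avec_nth)
  then show ?thesis by (simp add: vec_eq_iff wedge_def brk_def diff_divide_distrib mult.commute)
qed

lemma ext2_pair_brk:
  fixes B :: "'k::field hfrac^5^5"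
  assumes B: "B \<in> ext2_generic"
  shows "ext2_pair B (brk (\<nu> + 1) (\<nu> - 1)) = xcoord B \<nu>"
    and "ext2_pair B (brk (\<nu> + 2) (\<nu> - 2)) = ycoord B \<nu>"
proof -
  note D = ext2_genericD(2)[OF B]
  note B0 = D[of 2 1] D[of 3 1] D[of 4 1] D[of 3 2] D[of 4 2] D[of 4 3] ext2_genericD(3-5)[OF B]
  show "ext2_pair B (brk (\<nu> + 1) (\<nu> - 1)) = xcoord B \<nu>"
    using exhaust_5[of \<nu>]
    by (elim disjE) (simp_all add: ext2_pair_def brk_def wedge_def avec_nth xcoord_def tri_def B0)
  show "ext2_pair B (brk (\<nu> + 2) (\<nu> - 2)) = ycoord B \<nu>"
    using exhaust_5[of \<nu>]
    by (elim disjE) (simp_all add: ext2_pair_def brk_def wedge_def avec_nth ycoord_def tri_def B0)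
qed

text \<open>Under \<open>p0\<close> the product of two vectors \<open>dz\<close> becomes the
  corresponding \<open>brk\<close> divided by two coordinates. Hence \<open>f_low_minus\<close>
  reads off the x-coordinates of \<open>v1\<close>, and \<open>f_low_plus\<close> the y-coordinates
  of \<open>v2\<close>.\<close>

lemma monad_q_eq:
  fixes v1 v2 :: "'k::field hfrac^5^5"
  assumes "v1 \<in> ext2_generic" "v2 \<in> ext2_generic"
  shows "monad_q (v1, v2) u = (\<Sum>\<nu>\<in>UNIV. u$\<nu> *
    (xcoord v1 \<nu> / (zf (\<nu> + 1) * zf (\<nu> - 1)) - ycoord v2 \<nu> / (zf (\<nu> + 2) * zf (\<nu> - 2))))"
  unfolding monad_q_def f_low_minus_def f_low_plus_def q0_def p0_dual_def Phi_def f_up_plus_def f_up_minus_def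
  by (simp add: p0_sum_mscale ext2_pair_sum_mscale p0_wedge wedge_iota_star_dz ext2_pair_mscale ext2_pair_brk assms right_diff_distrib sum_subtractf)

lemma monad_q_eq_0_iff:
  fixes v1 v2 :: "'k::field hfrac^5^5"
  assumes "v1 \<in> ext2_generic" "v2 \<in> ext2_generic"
  shows "monad_q (v1, v2) = (\<lambda>_. 0) \<longleftrightarrow>
    (\<forall>\<nu>. xcoord v1 \<nu> * (zf (\<nu> + 2) * zf (\<nu> - 2)) = ycoord v2 \<nu> * (zf (\<nu> + 1) * zf (\<nu> - 1)))"
proof -
  define t where "t = (\<lambda>\<nu>. xcoord v1 \<nu> / (zf (\<nu> + 1) * zf (\<nu> - 1)) - ycoord v2 \<nu> / (zf (\<nu> + 2) * zf (\<nu> - 2)))"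
  have q: "monad_q (v1, v2) u = (\<Sum>\<nu>\<in>UNIV. u$\<nu> * t \<nu>)" for u
    unfolding t_def by (rule monad_q_eq[OF assms])
  have "monad_q (v1, v2) (axis \<nu> 1) = t \<nu>" for \<nu>
    unfolding q by (simp add: axis_def if_distrib[of "\<lambda>s. s * _"] cong: if_cong)
  then have "t \<nu> = 0" if "monad_q (v1, v2) = (\<lambda>_. 0)" for \<nu> using that by metis
  moreover have "monad_q (v1, v2) = (\<lambda>_. 0)" if "\<forall>\<nu>. t \<nu> = 0"
    using that by (intro ext) (simp add: q)
  ultimately have "monad_q (v1, v2) = (\<lambda>_. 0) \<longleftrightarrow> (\<forall>\<nu>. t \<nu> = 0)" by blast
  also have "\<dots> \<longleftrightarrow> (\<forall>\<nu>. xcoord v1 \<nu> * (zf (\<nu> + 2) * zf (\<nu> - 2)) = ycoord v2 \<nu> * (zf (\<nu> + 1) * zf (\<nu> - 1)))"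
    by (simp add: t_def frac_eq_eq)
  finally show ?thesis .
qed

text \<open>The characteristic property of the two vectors: \<open>alpha_minus\<close> is killed by
  all x-coordinates and \<open>alpha_plus\<close> by all y-coordinates, which determines each up to
  a scalar (see \<open>xcoord_eq_0_imp\<close> and \<open>ycoord_eq_0_imp\<close>). The value 1 of
  the other coordinates fixes the scalar.\<close>

lemma alpha_nth:
  "alpha_minus \<in> ext2_generic" "xcoord alpha_minus \<nu> = 0" "ycoord alpha_minus \<nu> = 1"
  "alpha_plus \<in> ext2_generic" "xcoord alpha_plus \<nu> = 1" "ycoord alpha_plus \<nu> = 0"
proof -
  show "alpha_minus \<in> ext2_generic" "alpha_plus \<in> ext2_generic"
    unfolding ext2_generic_def alternating_def forall_5
    by (simp_all add: alpha_minus_def alpha_plus_def brk_def avec_eq_axis wedge_def axis_def)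
  show "xcoord alpha_minus \<nu> = 0" "ycoord alpha_minus \<nu> = 1" "xcoord alpha_plus \<nu> = 1" "ycoord alpha_plus \<nu> = 0"
    using exhaust_5[of \<nu>] unfolding xcoord_def ycoord_def tri_def
    by (elim disjE; simp add: alpha_minus_def alpha_plus_def brk_def avec_eq_axis wedge_def axis_def)+
qed

lemma hm_vec_generic: "fst (hm_vec (f, g)) \<in> ext2_generic" "snd (hm_vec (f, g)) \<in> ext2_generic"
  by (simp_all add: hm_vec_def ext2_generic_mscale ext2_generic_uminus alpha_nth)

lemma monad_p_generic: "fst (monad_p w) \<in> ext2_generic" "snd (monad_p w) \<in> ext2_generic"
  by (simp_all add: monad_p_def p0_ext2_generic alternating_f_up)

lemma monad_q_add:
  assumes "fst u \<in> ext2_generic" "snd u \<in> ext2_generic" "fst v \<in> ext2_generic" "snd v \<in> ext2_generic"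
    "monad_q u = (\<lambda>_. 0)" "monad_q v = (\<lambda>_. 0)"
  shows "monad_q (u + v) = (\<lambda>_. 0)"
  using assms monad_q_eq_0_iff[of "fst u" "snd u"] monad_q_eq_0_iff[of "fst v" "snd v"]
    monad_q_eq_0_iff[of "fst (u + v)" "snd (u + v)"]
  by (simp add: ext2_generic_add coord_simps distrib_right plus_prod_def)

lemma monad_q_uminus:
  assumes "fst v \<in> ext2_generic" "snd v \<in> ext2_generic" "monad_q v = (\<lambda>_. 0)"
  shows "monad_q (- v) = (\<lambda>_. 0)"
  using assms monad_q_eq_0_iff[of "fst v" "snd v"] monad_q_eq_0_iff[of "fst (- v)" "snd (- v)"]
  by (simp add: ext2_generic_uminus coord_simps uminus_prod_def)

lemma monad_q_hm_vec: "monad_q (hm_vec (f, g)) = (\<lambda>_. 0)"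
  using monad_q_eq_0_iff[OF hm_vec_generic[of f g]]
  by (simp add: hm_vec_def) (simp add: xcoord_def ycoord_def tri_mscale tri_uminus
      alpha_nth[unfolded xcoord_def ycoord_def])

text \<open>The x-coordinates of the first component of p(w) and the y-coordinates of the second,
  each multiplied by its two variables, are both w_\<nu>, so the two terms of q cancel.\<close>

lemma monad_q_monad_p: "monad_q (monad_p w) = (\<lambda>_. 0)"
proof -
  have "xcoord (fst (monad_p w)) \<nu> * (zf (\<nu> + 2) * zf (\<nu> - 2)) = w$\<nu>" for \<nu>
    using coord_p0_f_up_plus(1)[of \<nu> w] by (simp add: monad_p_def ac_simps)
  moreover have "ycoord (snd (monad_p w)) \<nu> * (zf (\<nu> + 1) * zf (\<nu> - 1)) = w$\<nu>" for \<nu>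
    using coord_p0_f_up_minus(2)[of \<nu> w] by (simp add: monad_p_def ac_simps)
  ultimately show ?thesis
    using monad_q_eq_0_iff[OF monad_p_generic[of w]] by simp
qed

section \<open>Regularity of representatives; stalks of kernel and image\<close>

definition hm_cond :: "'k::field point \<Rightarrow> 'k hfrac \<Rightarrow> 'k hfrac \<Rightarrow> 'k hfrac^5 \<Rightarrow> bool" where
  "hm_cond x f g w \<longleftrightarrow> (\<forall>\<nu>. zf \<nu> * w$\<nu> \<in> twist_stalk 3 x
    \<and> zf \<nu> * zf (\<nu> + 1) * zf (\<nu> - 1) * f + zf (\<nu> + 1) * w$(\<nu> + 2) + zf (\<nu> - 1) * w$(\<nu> - 2) \<in> twist_stalk 3 x
    \<and> zf \<nu> * zf (\<nu> + 2) * zf (\<nu> - 2) * g + zf (\<nu> - 2) * w$(\<nu> + 1) + zf (\<nu> + 2) * w$(\<nu> - 1) \<in> twist_stalk 3 x)"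

text \<open>Four families of coordinates give only three conditions, because the x-coordinates of
  the first component and the y-coordinates of the second both yield z_\<nu> w_\<nu>. The sign in
  \<open>hm_vec\<close> gives the family with g an overall minus, which does not affect
  membership.\<close>

lemma hm_cond_iff:
  fixes f g :: "'k::field hfrac"
  assumes x: "x \<in> Proj4"
  shows "fst (hm_vec (f, g) + monad_p w) \<in> ext2_stalk x \<and> snd (hm_vec (f, g) + monad_p w) \<in> ext2_stalk x
    \<longleftrightarrow> hm_cond x f g w"
proof -
  let ?A = "mscale f alpha_minus + p0 (f_up_plus w)" and ?B = "- mscale g alpha_plus + p0 (f_up_minus w)"
  have gen: "?A \<in> ext2_generic" "?B \<in> ext2_generic"
    by (intro ext2_generic_add ext2_generic_mscale ext2_generic_uminus alpha_nth p0_ext2_generic alternating_f_up)+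
  have al: "xcoord (alpha_minus :: 'k hfrac^5^5) \<nu> = 0" "ycoord (alpha_minus :: 'k hfrac^5^5) \<nu> = 1"
    "xcoord (alpha_plus :: 'k hfrac^5^5) \<nu> = 1" "ycoord (alpha_plus :: 'k hfrac^5^5) \<nu> = 0" for \<nu>
    by (rule alpha_nth)+
  have xy: "xcoord ?A \<nu> = xcoord (p0 (f_up_plus w)) \<nu>" "ycoord ?A \<nu> = f + ycoord (p0 (f_up_plus w)) \<nu>"
    "xcoord ?B \<nu> = - g + xcoord (p0 (f_up_minus w)) \<nu>" "ycoord ?B \<nu> = ycoord (p0 (f_up_minus w)) \<nu>" for \<nu>
    using al[of \<nu>] by (simp_all add: coord_simps)
  have e: "zf \<nu> * zf (\<nu> + 2) * zf (\<nu> - 2) * xcoord ?A \<nu> = zf \<nu> * w$\<nu>"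
    "zf \<nu> * zf (\<nu> + 1) * zf (\<nu> - 1) * ycoord ?A \<nu> =
      zf \<nu> * zf (\<nu> + 1) * zf (\<nu> - 1) * f + zf (\<nu> + 1) * w$(\<nu> + 2) + zf (\<nu> - 1) * w$(\<nu> - 2)"
    "zf \<nu> * zf (\<nu> + 2) * zf (\<nu> - 2) * xcoord ?B \<nu> =
      - (zf \<nu> * zf (\<nu> + 2) * zf (\<nu> - 2) * g + zf (\<nu> - 2) * w$(\<nu> + 1) + zf (\<nu> + 2) * w$(\<nu> - 1))"
    "zf \<nu> * zf (\<nu> + 1) * zf (\<nu> - 1) * ycoord ?B \<nu> = zf \<nu> * w$\<nu>" for \<nu>
    unfolding xy distrib_left coord_p0_f_up_plus coord_p0_f_up_minus by simp_all
  have "fst (hm_vec (f, g) + monad_p w) = ?A" "snd (hm_vec (f, g) + monad_p w) = ?B"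
    by (simp_all add: hm_vec_def monad_p_def)
  then show ?thesis
    unfolding hm_cond_def
    by (simp only: ext2_stalk_iff[OF x gen(1)] ext2_stalk_iff[OF x gen(2)] e ts_uminus_iff[OF x]) blast
qed

lemma ker_q_iff:
  assumes "zopen U"
  shows "v \<in> ker_q U \<longleftrightarrow> (\<forall>x\<in>U. fst v \<in> ext2_stalk x \<and> snd v \<in> ext2_stalk x) \<and> monad_q v = (\<lambda>_. 0)"
  unfolding ker_q_def using ext2_tangent_iff[OF assms] by (cases v) auto

lemma stalk_ker_q:
  assumes "x \<in> Proj4"
  shows "stalk ker_q x = {v. fst v \<in> ext2_stalk x \<and> snd v \<in> ext2_stalk x \<and> monad_q v = (\<lambda>_. 0)}"
proof (intro equalityI subsetI)
  fix v assume "v \<in> stalk ker_q x"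
  then obtain W where "zopen W" "x \<in> W" "v \<in> ker_q W" unfolding stalk_def by blast
  then show "v \<in> {v. fst v \<in> ext2_stalk x \<and> snd v \<in> ext2_stalk x \<and> monad_q v = (\<lambda>_. 0)}"
    by (simp add: ker_q_iff)
next
  fix v assume v: "v \<in> {v. fst v \<in> ext2_stalk x \<and> snd v \<in> ext2_stalk x \<and> monad_q v = (\<lambda>_. 0)}"
  obtain W where W: "zopen W" "x \<in> W" "W \<subseteq> Proj4" "\<And>y. y \<in> W \<Longrightarrow> fst v \<in> ext2_stalk y"
    by (rule ext2_stalk_nbhd[of "fst v" x Proj4]) (use v assms zopen_Proj4 in auto)
  obtain W' where W': "zopen W'" "x \<in> W'" "W' \<subseteq> W" "\<And>y. y \<in> W' \<Longrightarrow> snd v \<in> ext2_stalk y"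
    by (rule ext2_stalk_nbhd[of "snd v" x W]) (use v W in auto)
  have "v \<in> ker_q W'" using W W' v by (auto simp: ker_q_iff)
  then show "v \<in> stalk ker_q x" using W' unfolding stalk_def by blast
qed

lemma stalk_im_p:
  assumes "x \<in> Proj4"
  shows "stalk im_p x = monad_p ` {w. \<forall>\<nu>. w$\<nu> \<in> twist_stalk 2 x}"
proof (intro equalityI subsetI)
  fix v assume "v \<in> stalk im_p x"
  then obtain W w where "x \<in> W" "v = monad_p w" "w \<in> Vtw 2 W"
    unfolding stalk_def im_p_def sheafify_def by blast
  then show "v \<in> monad_p ` {w. \<forall>\<nu>. w$\<nu> \<in> twist_stalk 2 x}" by (auto simp: Vtw_def twist_def)
next
  fix v assume "v \<in> monad_p ` {w. \<forall>\<nu>. w$\<nu> \<in> twist_stalk 2 x}"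
  then obtain w where w: "v = monad_p w" "\<forall>\<nu>. w$\<nu> \<in> twist_stalk 2 x" by blast
  obtain W where W: "zopen W" "x \<in> W" "\<forall>\<nu>. w$\<nu> \<in> twist 2 W"
    using stalk_nbhd[of "UNIV :: 5 set" x Proj4 "\<lambda>\<nu>. w$\<nu>" "\<lambda>_. 2"] assms w(2) zopen_Proj4 by auto
  then have "v \<in> im_p W" unfolding im_p_def sheafify_def using w by (auto simp: Vtw_def)
  then show "v \<in> stalk im_p x" using W unfolding stalk_def by blast
qed

lemma monad_p_add: "monad_p (v + w) = monad_p v + monad_p w"
proof -
  have *: "f_up_plus u = (\<Sum>\<nu>\<in>UNIV. mscale (u$\<nu>) (wedge (dz (\<nu> + 2)) (dz (\<nu> - 2))))"
     "f_up_minus u = (\<Sum>\<nu>\<in>UNIV. mscale (u$\<nu>) (wedge (dz (\<nu> + 1)) (dz (\<nu> - 1))))" for u :: "'a hfrac^5"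
    by (simp_all add: f_up_plus_def f_up_minus_def)
  have m: "mscale (a + b) C = mscale a C + mscale b C" for a b and C :: "'a hfrac^5^5"
    by (simp add: vec_eq_iff distrib_right)
  show ?thesis unfolding monad_p_def * p0_sum_mscale by (simp add: m sum.distrib)
qed

lemma monad_p_scale: "monad_p (c *s w) = pscale c (monad_p w)"
proof -
  have *: "f_up_plus u = (\<Sum>\<nu>\<in>UNIV. mscale (u$\<nu>) (wedge (dz (\<nu> + 2)) (dz (\<nu> - 2))))"
     "f_up_minus u = (\<Sum>\<nu>\<in>UNIV. mscale (u$\<nu>) (wedge (dz (\<nu> + 1)) (dz (\<nu> - 1))))" for u :: "'a hfrac^5"
    by (simp_all add: f_up_plus_def f_up_minus_def)
  show ?thesis unfolding monad_p_def * p0_sum_mscale pscale_def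
    by (simp add: vec_eq_iff sum_distrib_left mult.assoc)
qed

lemma monad_p_uminus: "monad_p (- w) = - monad_p w"
proof -
  have "monad_p (- w) + monad_p w = monad_p 0" using monad_p_add[of "- w" w] by simp
  moreover have "monad_p 0 = (0 :: 'a pairs)" using monad_p_add[of 0 "0 :: 'a hfrac^5"] by simp
  ultimately show ?thesis by (simp add: eq_neg_iff_add_eq_0)
qed

section \<open>The generic stalk\<close>

lemma coset_eq_iff:
  fixes N :: "'e::ab_group_add set"
  assumes "0 \<in> N" "\<And>a b. a \<in> N \<Longrightarrow> b \<in> N \<Longrightarrow> a + b \<in> N" "\<And>a. a \<in> N \<Longrightarrow> - a \<in> N"
  shows "coset N u = coset N v \<longleftrightarrow> u - v \<in> N"
proof
  assume "coset N u = coset N v"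
  moreover have "u \<in> coset N u" using assms(1) by (force simp: coset_def)
  ultimately obtain n where "u = v + n" "n \<in> N" by (auto simp: coset_def)
  then show "u - v \<in> N" by simp
next
  have sub: "coset N u \<subseteq> coset N v" if "u - v \<in> N" for u v
  proof
    fix a assume "a \<in> coset N u"
    then obtain n where n: "a = u + n" "n \<in> N" by (auto simp: coset_def)
    then have "a = v + ((u - v) + n)" by simp
    then show "a \<in> coset N v" using assms(2)[OF that n(2)] unfolding coset_def by blast
  qed
  assume "u - v \<in> N"
  moreover from assms(3)[OF this] have "v - u \<in> N" by simp
  ultimately show "coset N u = coset N v" using sub by blast
qed

lemma coset_add_coset:
  fixes N :: "'e::ab_group_add set"
  assumes "0 \<in> N" "\<And>a b. a \<in> N \<Longrightarrow> b \<in> N \<Longrightarrow> a + b \<in> N"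
  shows "coset_add N (coset N u) (coset N v) = coset N (u + v)"
proof (intro equalityI subsetI)
  fix a assume "a \<in> coset_add N (coset N u) (coset N v)"
  then obtain m n k where "a = (u + m) + (v + n) + k" "m \<in> N" "n \<in> N" "k \<in> N"
    unfolding coset_add_def coset_def by blast
  then have "a = (u + v) + (m + n + k)" "m + n + k \<in> N" by (simp_all add: assms(2))
  then show "a \<in> coset N (u + v)" unfolding coset_def by blast
next
  fix a assume "a \<in> coset N (u + v)"
  then obtain n where "a = (u + 0) + (v + 0) + n" "n \<in> N" unfolding coset_def by auto
  then show "a \<in> coset_add N (coset N u) (coset N v)"
    unfolding coset_add_def coset_def using assms(1) by blast
qed

lemma coset_scale_coset:
  fixes N :: "'e::ab_group_add set"
  assumes "0 \<in> N" "\<And>a b. a \<in> N \<Longrightarrow> b \<in> N \<Longrightarrow> a + b \<in> N" "\<And>a. a \<in> N \<Longrightarrow> scl c a \<in> N"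
    "\<And>a b. scl c (a + b) = scl c a + scl c b"
  shows "coset_scale scl N c (coset N u) = coset N (scl c u)"
proof (intro equalityI subsetI)
  fix a assume "a \<in> coset_scale scl N c (coset N u)"
  then obtain m n where "a = scl c (u + m) + n" "m \<in> N" "n \<in> N"
    unfolding coset_scale_def coset_def by blast
  then have "a = scl c u + (scl c m + n)" "scl c m + n \<in> N" by (simp_all add: assms add.assoc)
  then show "a \<in> coset N (scl c u)" unfolding coset_def by blast
next
  fix a assume "a \<in> coset N (scl c u)"
  then obtain n where "a = scl c (u + 0) + n" "n \<in> N" unfolding coset_def by auto
  then show "a \<in> coset_scale scl N c (coset N u)"
    unfolding coset_scale_def coset_def using assms(1) by blast
qed

lemma stalk_im_p_group:
  assumes x: "x \<in> Proj4"
  shows "0 \<in> stalk im_p x" "a \<in> stalk im_p x \<Longrightarrow> b \<in> stalk im_p x \<Longrightarrow> a + b \<in> stalk im_p x"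
    "a \<in> stalk im_p x \<Longrightarrow> - a \<in> stalk im_p x"
proof -
  have S: "monad_p w \<in> stalk im_p x" if "\<And>\<nu>. w$\<nu> \<in> twist_stalk 2 x" for w
    unfolding stalk_im_p[OF x] using that by blast
  have S': "\<exists>w. v = monad_p w \<and> (\<forall>\<nu>. w$\<nu> \<in> twist_stalk 2 x)" if "v \<in> stalk im_p x" for v
    using that unfolding stalk_im_p[OF x] by blast
  have "monad_p 0 = (0 :: 'a pairs)" using monad_p_add[of 0 "0 :: 'a hfrac^5"] by simp
  then show "0 \<in> stalk im_p x" using S[of 0] x by simp
  show "a + b \<in> stalk im_p x" if ab: "a \<in> stalk im_p x" "b \<in> stalk im_p x"
  proof -
    obtain v w where "a = monad_p v" "b = monad_p w" "\<forall>\<nu>. v$\<nu> \<in> twist_stalk 2 x" "\<forall>\<nu>. w$\<nu> \<in> twist_stalk 2 x"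
      using S'[OF ab(1)] S'[OF ab(2)] by blast
    then show ?thesis using S[of "v + w"] by (simp add: monad_p_add ts_add[OF x])
  qed
  show "- a \<in> stalk im_p x" if a: "a \<in> stalk im_p x"
  proof -
    obtain v where "a = monad_p v" "\<forall>\<nu>. v$\<nu> \<in> twist_stalk 2 x" using S'[OF a] by blast
    then show ?thesis using S[of "- v"] x by (simp add: monad_p_uminus)
  qed
qed

lemma pscale_add: "pscale c (a + b) = pscale c a + pscale c b"
  by (cases a; cases b) (simp add: pscale_def vec_eq_iff distrib_left)

lemma stalk_im_p_pscale:
  assumes "c \<in> fun_field" "a \<in> stalk im_p eta" shows "pscale c a \<in> stalk im_p eta"
proof -
  obtain w where w: "a = monad_p w" "\<forall>\<nu>. w$\<nu> \<in> twist_stalk 2 eta"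
    using assms(2) unfolding stalk_im_p[OF eta_Proj4] by blast
  have "(c *s w)$\<nu> \<in> twist_stalk 2 eta" for \<nu>
    using ts_mult[OF eta_Proj4, of c 0 "w$\<nu>" 2 2] assms(1) w(2) by (simp add: fun_field_eq)
  then show ?thesis unfolding stalk_im_p[OF eta_Proj4] w(1) monad_p_scale[symmetric] by blast
qed

lemma hm_vec_add: "hm_vec (u + v) = hm_vec u + hm_vec v"
  by (cases u; cases v) (simp add: hm_vec_def vec_eq_iff distrib_right)

lemma hm_vec_diff: "hm_vec (u - v) = hm_vec u - hm_vec v"
  by (cases u; cases v) (simp add: hm_vec_def vec_eq_iff left_diff_distrib)

lemma hm_vec_0: "hm_vec (0, 0) = 0"
  by (simp add: hm_vec_def zero_prod_def vec_eq_iff)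

lemma hm_vec_scale: "hm_vec (c * f, c * g) = pscale c (hm_vec (f, g))"
  by (simp add: hm_vec_def pscale_def vec_eq_iff mult.assoc)

lemma hm_map_eq_iff: "hm_map u = hm_map v \<longleftrightarrow> hm_vec u - hm_vec v \<in> stalk im_p eta"
  unfolding hm_map_def by (rule coset_eq_iff[OF stalk_im_p_group[OF eta_Proj4]])

lemma hm_map_add: "hm_map (u + v) = HM_add (hm_map u) (hm_map v)"
  unfolding hm_map_def HM_add_def hm_vec_add
  by (rule coset_add_coset[OF stalk_im_p_group(1,2)[OF eta_Proj4], symmetric])

lemma hm_map_scale:
  assumes "c \<in> fun_field" shows "hm_map (c * f, c * g) = HM_scale c (hm_map (f, g))"
  unfolding hm_map_def HM_scale_def hm_vec_scale
  by (rule coset_scale_coset[where c = c and scl = pscale and N = "stalk im_p eta", symmetric])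
    (simp_all add: stalk_im_p_group[OF eta_Proj4] stalk_im_p_pscale[OF assms] pscale_add)

lemma monad_p_0: "monad_p 0 = 0"
  using monad_p_add[of 0 "0 :: 'a::field hfrac^5"] by simp

lemma Zvar_notin_eta: "Zvar \<nu> \<notin> (eta :: 'k::field point)"
  by (simp add: eta_def)

lemma ts_zf_mult: "x \<in> Proj4 \<Longrightarrow> f \<in> twist_stalk l x \<Longrightarrow> m = l + 1 \<Longrightarrow> zf \<nu> * f \<in> twist_stalk m x"
  using zf_mult_stalk by blast

lemma ts_zf3:
  assumes "x \<in> Proj4" "f \<in> twist_stalk 0 x"
  shows "zf i * zf j * zf k * f \<in> twist_stalk 3 x"
proof -
  have "zf i * (zf j * (zf k * f)) \<in> twist_stalk 3 x"
    by (rule ts_zf_mult[OF assms(1), of _ 2], rule ts_zf_mult[OF assms(1), of _ 1],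
        rule ts_zf_mult[OF assms]) simp_all
  then show ?thesis by (simp add: mult.assoc)
qed

section \<open>Unique representatives of the generic classes\<close>

lemma hm_cond_eta:
  assumes "f \<in> fun_field" "g \<in> fun_field" "\<And>\<nu>. w$\<nu> \<in> twist_stalk 2 eta"
  shows "hm_cond eta f g w"
proof -
  have "zf i * w$j \<in> twist_stalk 3 eta" for i j by (rule ts_zf_mult[OF eta_Proj4 assms(3)]) simp
  then show ?thesis unfolding hm_cond_def
    using assms(1,2) by (auto intro!: ts_add[OF eta_Proj4] ts_zf3[OF eta_Proj4] simp: fun_field_eq)
qed

lemma hm_vec_stalk_ker_q:
  assumes "f \<in> fun_field" "g \<in> fun_field" shows "hm_vec (f, g) \<in> stalk ker_q eta"
proof -
  have "hm_cond eta f g 0" using assms by (rule hm_cond_eta) (simp add: eta_Proj4)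
  then show ?thesis
    unfolding stalk_ker_q[OF eta_Proj4] using hm_cond_iff[OF eta_Proj4, of f g 0]
    by (simp add: monad_p_0 monad_q_hm_vec)
qed

lemma xcoord_monad_p: "xcoord (fst (monad_p w)) \<nu> * (zf (\<nu> + 2) * zf (\<nu> - 2)) = w$\<nu>"
  using coord_p0_f_up_plus(1)[of \<nu> w] by (simp add: monad_p_def ac_simps)

text \<open>The x-coordinates of the first component of p(w) recover w, and they vanish on multiples
  of \<open>alpha_minus\<close>. So w = 0, and the remaining coordinates give f and g.\<close>

lemma hm_vec_in_im_p:
  fixes f g :: "'k::field hfrac"
  assumes "hm_vec (f, g) \<in> stalk im_p eta" shows "f = 0 \<and> g = 0"
proof -
  obtain w where w: "hm_vec (f, g) = monad_p w"
    using assms unfolding stalk_im_p[OF eta_Proj4] by blast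
  have al: "xcoord (alpha_minus :: 'k hfrac^5^5) \<nu> = 0" "ycoord (alpha_minus :: 'k hfrac^5^5) \<nu> = 1"
    "xcoord (alpha_plus :: 'k hfrac^5^5) \<nu> = 1" for \<nu> by (rule alpha_nth)+
  have "w$\<nu> = 0" for \<nu>
    unfolding xcoord_monad_p[of w \<nu>, symmetric] w[symmetric]
    using al(1)[of \<nu>] by (simp add: hm_vec_def coord_simps)
  then have "w = 0" by (simp add: vec_eq_iff)
  then have *: "mscale f alpha_minus = 0" "mscale g (alpha_plus :: 'k hfrac^5^5) = 0"
    using w by (simp_all add: monad_p_0 hm_vec_def zero_prod_def)
  have "ycoord (mscale f alpha_minus) 0 = f" "xcoord (mscale g alpha_plus) 0 = g"
    using al(2,3)[of 0] by (simp_all add: coord_simps)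
  then show ?thesis unfolding * by (simp add: coord_simps)
qed

text \<open>On the six-dimensional space \<open>ext2_generic\<close> the five equations leave only
  the line of \<open>alpha_minus\<close>, and each y-coordinate of \<open>alpha_minus\<close> is 1,
  so index 0 reads off the scalar.\<close>

lemma xcoord_eq_0_imp:
  fixes A :: "'k::field hfrac^5^5"
  assumes A: "A \<in> ext2_generic" and x: "\<And>\<nu>. xcoord A \<nu> = 0"
  shows "A = mscale (ycoord A 0) alpha_minus"
proof -
  note D = ext2_genericD(2)[OF A]
  note D0 = ext2_genericD(3-5)[OF A]
  have "A$2$3 = 0" "A$2$4 = 0" "A$1$3 = 0" using x[of 0] x[of 2] x[of 3] by (simp_all add: xcoord_def tri_def D0)
  moreover from this have "A$3$4 = A$1$4" "A$1$2 = A$1$4"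
    using x[of 1] x[of 4] D[of 4 1] by (simp_all add: xcoord_def tri_def D0)
  moreover have "ycoord A 0 = A$1$4" by (simp add: ycoord_def tri_def D0)
  ultimately show ?thesis
    using D[of 2 1] D[of 3 1] D[of 4 1] D[of 3 2] D[of 4 2] D[of 4 3]
    unfolding vec_eq_iff forall_5
    by (simp add: D0 alpha_minus_def brk_def wedge_def avec_nth)
qed

lemma ycoord_eq_0_imp:
  fixes A :: "'k::field hfrac^5^5"
  assumes A: "A \<in> ext2_generic" and y: "\<And>\<nu>. ycoord A \<nu> = 0"
  shows "A = mscale (xcoord A 0) alpha_plus"
proof -
  note D = ext2_genericD(2)[OF A]
  note D0 = ext2_genericD(3-5)[OF A]
  have "A$1$4 = 0" "A$1$2 = 0" "A$3$4 = 0" using y[of 0] y[of 1] y[of 4] D[of 4 3]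
    by (simp_all add: ycoord_def tri_def D0)
  moreover from this have "A$1$3 = A$2$3" "A$2$4 = A$2$3"
    using y[of 2] y[of 3] D[of 3 1] D[of 4 2] by (simp_all add: ycoord_def tri_def D0)
  moreover have "xcoord A 0 = A$2$3" by (simp add: xcoord_def tri_def D0)
  ultimately show ?thesis
    using D[of 2 1] D[of 3 1] D[of 4 1] D[of 3 2] D[of 4 2] D[of 4 3]
    unfolding vec_eq_iff forall_5
    by (simp add: D0 alpha_plus_def brk_def wedge_def avec_nth)
qed

lemma ts_eta_zf3_cancel:
  assumes "zf i * zf j * zf k * f \<in> twist_stalk 3 eta" shows "f \<in> twist_stalk 0 eta"
proof -
  have "zf i * (zf j * (zf k * f)) \<in> twist_stalk 3 eta" using assms by (simp add: mult.assoc)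
  then have "zf j * (zf k * f) \<in> twist_stalk 2 eta"
    using ts_zf_mult_iff[OF eta_Proj4 Zvar_notin_eta, of i "zf j * (zf k * f)" 2] by simp
  then have "zf k * f \<in> twist_stalk 1 eta"
    using ts_zf_mult_iff[OF eta_Proj4 Zvar_notin_eta, of j "zf k * f" 1] by simp
  then show ?thesis using ts_zf_mult_iff[OF eta_Proj4 Zvar_notin_eta, of k f 0] by simp
qed

text \<open>The vector \<open>w\<close> is chosen so that subtracting p(w) kills the x-coordinates
  of the first component. Then q = 0 kills the y-coordinates of the second one, and both components
  lie on the lines of \<open>alpha_minus\<close> and \<open>alpha_plus\<close>.\<close>

lemma ker_q_generic_decomp:
  fixes v :: "'k::field pairs"
  assumes v: "v \<in> stalk ker_q eta"
  obtains f g w where "f \<in> fun_field" "g \<in> fun_field" "\<forall>\<nu>. w$\<nu> \<in> twist_stalk 2 eta"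
    "v = hm_vec (f, g) + monad_p w"
proof -
  have v': "fst v \<in> ext2_stalk eta" "snd v \<in> ext2_stalk eta" and q: "monad_q v = (\<lambda>_. 0)"
    using v unfolding stalk_ker_q[OF eta_Proj4] by auto
  have gen: "fst v \<in> ext2_generic" "snd v \<in> ext2_generic" using v' by (simp_all add: ext2_stalk_def)
  define w where "w = (\<chi> \<nu>. xcoord (fst v) \<nu> * (zf (\<nu> + 2) * zf (\<nu> - 2)))"
  have w: "w$\<nu> \<in> twist_stalk 2 eta" for \<nu>
  proof -
    have "zf \<nu> * zf (\<nu> + 2) * zf (\<nu> - 2) * xcoord (fst v) \<nu> \<in> twist_stalk 3 eta"
      using v'(1) ext2_stalk_iff[OF eta_Proj4 gen(1)] by blast
    then have "zf \<nu> * w$\<nu> \<in> twist_stalk (2 + 1) eta" by (simp add: w_def ac_simps)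
    then show ?thesis by (simp only: ts_zf_mult_iff[OF eta_Proj4 Zvar_notin_eta])
  qed
  have "hm_cond eta 0 0 w" by (rule hm_cond_eta) (simp_all add: w)
  then have mp: "fst (monad_p w) \<in> ext2_stalk eta" "snd (monad_p w) \<in> ext2_stalk eta"
    using hm_cond_iff[OF eta_Proj4, of 0 0 w] by (simp_all add: hm_vec_0)
  define u where "u = v + - monad_p w"
  have u': "fst u \<in> ext2_stalk eta" "snd u \<in> ext2_stalk eta"
    unfolding u_def using v' mp
    by (simp_all only: fst_add snd_add fst_uminus snd_uminus ext2_stalk_add[OF eta_Proj4] ext2_stalk_uminus[OF eta_Proj4])
  have ugen: "fst u \<in> ext2_generic" "snd u \<in> ext2_generic" using u' by (simp_all add: ext2_stalk_def)
  have "monad_q u = (\<lambda>_. 0)"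
    unfolding u_def using gen monad_p_generic[of w] q
    by (intro monad_q_add monad_q_uminus monad_q_monad_p) (simp_all add: ext2_generic_uminus)
  then have k: "xcoord (fst u) \<nu> * (zf (\<nu> + 2) * zf (\<nu> - 2)) = ycoord (snd u) \<nu> * (zf (\<nu> + 1) * zf (\<nu> - 1))" for \<nu>
    using monad_q_eq_0_iff[OF ugen] by simp
  have xu: "xcoord (fst u) \<nu> = 0" for \<nu>
  proof -
    have "xcoord (fst (monad_p w)) \<nu> * (zf (\<nu> + 2) * zf (\<nu> - 2)) = xcoord (fst v) \<nu> * (zf (\<nu> + 2) * zf (\<nu> - 2))"
      unfolding xcoord_monad_p by (simp add: w_def)
    then have "xcoord (fst (monad_p w)) \<nu> = xcoord (fst v) \<nu>" by simp
    then show ?thesis by (simp add: u_def coord_simps)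
  qed
  have yu: "ycoord (snd u) \<nu> = 0" for \<nu> using k[of \<nu>] xu[of \<nu>] by simp
  define f where "f = ycoord (fst u) 0"
  define g where "g = - xcoord (snd u) 0"
  have "fst u = mscale f alpha_minus" unfolding f_def using ugen(1) xu by (rule xcoord_eq_0_imp)
  moreover have "snd u = - mscale g alpha_plus"
  proof -
    have "snd u = mscale (- g) alpha_plus" unfolding g_def using ycoord_eq_0_imp[OF ugen(2) yu] by simp
    then show ?thesis by (simp add: vec_eq_iff)
  qed
  ultimately have "u = hm_vec (f, g)" by (simp add: hm_vec_def prod_eq_iff)
  then have "v = hm_vec (f, g) + monad_p w" by (simp add: u_def diff_eq_eq)
  moreover have "f \<in> fun_field" unfolding f_def fun_field_eq
    using u'(1) ext2_stalk_iff[OF eta_Proj4 ugen(1)] ts_eta_zf3_cancel by blast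
  moreover have "g \<in> fun_field" unfolding g_def fun_field_eq ts_uminus_iff[OF eta_Proj4]
    using u'(2) ext2_stalk_iff[OF eta_Proj4 ugen(2)] ts_eta_zf3_cancel by blast
  ultimately show ?thesis using that w by blast
qed

lemma hm_map_bij: "bij_betw hm_map (fun_field \<times> fun_field) HM_eta"
proof (rule bij_betwI')
  fix u v :: "'k::field hfrac \<times> 'k hfrac"
  show "hm_map u = hm_map v \<longleftrightarrow> u = v"
  proof
    assume "hm_map u = hm_map v"
    then have "hm_vec (u - v) \<in> stalk im_p eta" by (simp add: hm_map_eq_iff hm_vec_diff)
    then show "u = v" using hm_vec_in_im_p[of "fst (u - v)" "snd (u - v)"] by (simp add: minus_prod_def prod_eq_iff)
  qed simp
next
  fix u :: "'k::field hfrac \<times> 'k hfrac" assume "u \<in> fun_field \<times> fun_field"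
  then show "hm_map u \<in> HM_eta"
    unfolding HM_eta_def quot_stalk_def hm_map_def using hm_vec_stalk_ker_q by (cases u) auto
next
  fix A :: "'k::field pairs set" assume "A \<in> HM_eta"
  then obtain v where v: "v \<in> stalk ker_q eta" "A = coset (stalk im_p eta) v"
    unfolding HM_eta_def quot_stalk_def by blast
  obtain f g w where fg: "f \<in> fun_field" "g \<in> fun_field" "\<forall>\<nu>. w$\<nu> \<in> twist_stalk 2 eta"
    "v = hm_vec (f, g) + monad_p w" using v(1) by (rule ker_q_generic_decomp)
  have "v - hm_vec (f, g) \<in> stalk im_p eta" unfolding stalk_im_p[OF eta_Proj4] using fg by auto
  then have "A = hm_map (f, g)"
    unfolding v(2) hm_map_def by (subst coset_eq_iff[OF stalk_im_p_group[OF eta_Proj4]])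
  then show "\<exists>u\<in>fun_field \<times> fun_field. A = hm_map u" using fg by blast
qed

section \<open>Local structure of the cohomology\<close>

definition hm_at :: "'k::field point \<Rightarrow> 'k hfrac \<Rightarrow> 'k hfrac \<Rightarrow> bool" where
  "hm_at x f g \<longleftrightarrow> (\<exists>w. (\<forall>\<nu>. w$\<nu> \<in> twist_stalk 2 eta) \<and> hm_cond x f g w)"

section \<open>Injectivity of p on fibres\<close>

lemma ts_zf_cancel:
  "x \<in> Proj4 \<Longrightarrow> Zvar \<nu> \<notin> x \<Longrightarrow> zf \<nu> * f \<in> twist_stalk m x \<Longrightarrow> m = l + 1 \<Longrightarrow> f \<in> twist_stalk l x"
  using ts_zf_mult_iff[of x \<nu> f l] by simp

definition delta :: "5 \<Rightarrow> 'k::field hpoly" where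
  "delta n = Zvar n ^ 4 - Zvar (n + 1) * Zvar (n + 2) * Zvar (n + 3) * Zvar (n + 4)"

definition deltaf :: "5 \<Rightarrow> 'k::field hfrac" where
  "deltaf n = zf n ^ 4 - zf (n + 1) * zf (n + 2) * zf (n + 3) * zf (n + 4)"

lemma homog_delta: "homog 4 (delta n :: 'k::field hpoly)"
proof -
  have "homog 4 (Zvar n ^ 4 :: 'k hpoly)" by (rule homog_Zvar_power)
  moreover have "homog (1 + 1 + 1 + 1) (Zvar (n + 1) * Zvar (n + 2) * Zvar (n + 3) * Zvar (n + 4) :: 'k hpoly)"
    by (intro homog_mult homog_Zvar)
  ultimately show ?thesis
    unfolding delta_def using homog_add[OF _ homog_uminus, of 4] by (simp add: numeral_eq_Suc)
qed

lemma emb_delta: "Fract (delta n) 1 = deltaf n"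
proof -
  have "emb (a - b) = emb a - emb b" for a b :: "'a hpoly" by simp
  then show ?thesis unfolding delta_def deltaf_def zf_def by (simp only: emb_mult emb_power)
qed

text \<open>Where \<open>delta n\<close> vanishes, the fourth power of z_n equals the product of the
  other four variables. If z_n is a unit, so is that product, and hence each of its factors.\<close>

lemma delta_dichotomy:
  assumes x: "x \<in> Proj4" and n: "Zvar n \<notin> x" and d: "delta n \<in> x"
  shows "Zvar \<nu> \<notin> x"
proof
  assume \<nu>: "Zvar \<nu> \<in> x"
  let ?m = "Zvar (n + 1) * Zvar (n + 2) * Zvar (n + 3) * Zvar (n + 4)"
  have "Zvar \<nu> dvd ?m"
  proof -
    have "\<nu> - n = 0 \<or> \<nu> - n = 1 \<or> \<nu> - n = 2 \<or> \<nu> - n = 3 \<or> \<nu> - n = 4" by (rule exhaust_5)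
    moreover have "\<nu> \<noteq> n" using \<nu> n by auto
    ultimately have "\<nu> = n + 1 \<or> \<nu> = n + 2 \<or> \<nu> = n + 3 \<or> \<nu> = n + 4"
      by (simp add: diff_eq_eq add.commute)
    then show ?thesis by (elim disjE) simp_all
  qed
  then have "?m \<in> x" by (rule Proj4_dvd[OF x \<nu>])
  then have "delta n + ?m \<in> x" using d by (rule Proj4_add[OF x, rotated])
  then show False using Proj4_power[OF x n, of 4] by (simp add: delta_def)
qed

text \<open>In the chart \<open>z\<^sub>n \<noteq> 0\<close> five of the fifteen components of \<open>p\<close> already form a linear system with
  determinant a unit times \<open>z\<^sub>n\<^sup>4 - z\<^sub>n\<^sub>+\<^sub>1z\<^sub>n\<^sub>+\<^sub>2z\<^sub>n\<^sub>+\<^sub>3z\<^sub>n\<^sub>+\<^sub>4\<close>.\<close>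

lemma chart_solve:
  fixes u :: "'k::field hfrac^5"
  assumes x: "x \<in> Proj4" and n: "Zvar n \<notin> x" and d: "delta n \<notin> x"
    and e0: "zf n * u$n \<in> twist_stalk 3 x"
    and e1: "zf n * u$(n + 1) + zf (n + 3) * u$(n + 2) \<in> twist_stalk 3 x"
    and e2: "zf n * u$(n + 2) + zf (n + 1) * u$(n + 4) \<in> twist_stalk 3 x"
    and e3: "zf n * u$(n + 3) + zf (n + 4) * u$(n + 1) \<in> twist_stalk 3 x"
    and e4: "zf n * u$(n + 4) + zf (n + 2) * u$(n + 3) \<in> twist_stalk 3 x"
  shows "u$\<nu> \<in> twist_stalk 2 x"
proof -
  define z0 z1 z2 z3 z4 :: "'k hfrac" where z: "z0 = zf n" "z1 = zf (n + 1)" "z2 = zf (n + 2)" "z3 = zf (n + 3)" "z4 = zf (n + 4)"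
  define u1 u2 u3 u4 :: "'k hfrac" where u: "u1 = u$(n + 1)" "u2 = u$(n + 2)" "u3 = u$(n + 3)" "u4 = u$(n + 4)"
  let ?E1 = "z0 * u1 + z3 * u2" and ?E2 = "z0 * u2 + z1 * u4" and ?E3 = "z0 * u3 + z4 * u1" and ?E4 = "z0 * u4 + z2 * u3"
  have E: "?E1 \<in> twist_stalk 3 x" "?E2 \<in> twist_stalk 3 x" "?E3 \<in> twist_stalk 3 x" "?E4 \<in> twist_stalk 3 x"
    using e1 e2 e3 e4 by (simp_all add: z u)
  have zz: "z0 * f \<in> twist_stalk (l + 1) x" "z1 * f \<in> twist_stalk (l + 1) x" "z2 * f \<in> twist_stalk (l + 1) x"
    "z3 * f \<in> twist_stalk (l + 1) x" "z4 * f \<in> twist_stalk (l + 1) x" if "f \<in> twist_stalk l x" for f l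
    unfolding z using that by (simp_all add: zf_mult_stalk[OF x])
  have t: "z0 * (z0 * (z0 * ?E1)) \<in> twist_stalk 6 x" "z0 * (z0 * (z3 * ?E2)) \<in> twist_stalk 6 x"
    "z0 * (z1 * (z3 * ?E4)) \<in> twist_stalk 6 x" "z1 * (z2 * (z3 * ?E3)) \<in> twist_stalk 6 x"
    using zz(1)[OF zz(1)[OF zz(1)[OF E(1)]]] zz(1)[OF zz(1)[OF zz(4)[OF E(2)]]]
      zz(1)[OF zz(2)[OF zz(4)[OF E(4)]]] zz(2)[OF zz(3)[OF zz(4)[OF E(3)]]] by simp_all
  \<comment> \<open>Elimination of u2, u4 and u3, in this order, along the cycle of equations E1,
    E2, E4, E3; the last one leads back to u1 and contributes the product z1 z2 z3 z4.\<close>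
  have "deltaf n * u1 = z0 * (z0 * (z0 * ?E1)) - z0 * (z0 * (z3 * ?E2)) + z0 * (z1 * (z3 * ?E4)) - z1 * (z2 * (z3 * ?E3))"
    unfolding deltaf_def z(1-5)[symmetric] by (simp add: algebra_simps power4_eq_xxxx)
  also have "\<dots> \<in> twist_stalk 6 x" by (intro ts_diff[OF x] ts_add[OF x] t)
  finally have du: "deltaf n * u1 \<in> twist_stalk 6 x" .
  have inv: "inverse (deltaf n) \<in> twist_stalk (- 4) x"
    using ts_inverse[OF homog_delta d x] unfolding emb_delta by simp
  have "deltaf n \<noteq> (0 :: 'k hfrac)"
  proof -
    have "delta n \<noteq> (0 :: 'k hpoly)" using d Proj4_0[OF x] by auto
    then show ?thesis unfolding emb_delta[symmetric] by simp
  qed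
  then have "u1 = inverse (deltaf n) * (deltaf n * u1)" by simp
  also have "\<dots> \<in> twist_stalk 2 x" by (rule ts_mult[OF x inv du]) simp
  finally have U1: "u1 \<in> twist_stalk 2 x" .
  have cancel: "f \<in> twist_stalk 2 x" if "z0 * f + h \<in> twist_stalk 3 x" "h \<in> twist_stalk 3 x" for f h
  proof -
    have "z0 * f \<in> twist_stalk 3 x" using ts_diff[OF x that] by simp
    then show ?thesis unfolding z by (rule ts_zf_cancel[OF x n]) simp
  qed
  have U3: "u3 \<in> twist_stalk 2 x" by (rule cancel[OF E(3)]) (use zz(5)[OF U1] in simp)
  have U4: "u4 \<in> twist_stalk 2 x" by (rule cancel[OF E(4)]) (use zz(3)[OF U3] in simp)
  have U2: "u2 \<in> twist_stalk 2 x" by (rule cancel[OF E(2)]) (use zz(2)[OF U4] in simp)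
  have U0: "u$n \<in> twist_stalk 2 x" using e0 by (rule ts_zf_cancel[OF x n]) simp
  have "u$(n + a) \<in> twist_stalk 2 x" for a
    using exhaust_5[of a] U0 U1 U2 U3 U4 by (auto simp: u)
  from this[of "\<nu> - n"] show ?thesis by simp
qed

text \<open>The conditions are affine in w, so the terms with f and g drop out of the
  difference.\<close>

lemma hm_cond_diff:
  assumes x: "x \<in> Proj4" and "hm_cond x f g v" "hm_cond x f g w"
  shows "hm_cond x 0 0 (v - w)"
proof -
  have vw: "zf \<nu> * u$\<nu> \<in> twist_stalk 3 x"
    "zf \<nu> * zf (\<nu> + 1) * zf (\<nu> - 1) * f + zf (\<nu> + 1) * u$(\<nu> + 2) + zf (\<nu> - 1) * u$(\<nu> - 2) \<in> twist_stalk 3 x"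
    "zf \<nu> * zf (\<nu> + 2) * zf (\<nu> - 2) * g + zf (\<nu> - 2) * u$(\<nu> + 1) + zf (\<nu> + 2) * u$(\<nu> - 1) \<in> twist_stalk 3 x"
    if "hm_cond x f g u" for u \<nu> using that by (simp_all add: hm_cond_def)
  note V = vw[OF assms(2)] and W = vw[OF assms(3)]
  have lin: "(c + p + q) - (c + p' + q') = (p - p') + (q - q')" for c p q p' q' :: "'a hfrac" by simp
  show ?thesis unfolding hm_cond_def
  proof (intro allI conjI)
    fix \<nu>
    show "zf \<nu> * (v - w)$\<nu> \<in> twist_stalk 3 x"
      using ts_diff[OF x V(1) W(1), of \<nu> \<nu>] by (simp add: right_diff_distrib)
    show "zf \<nu> * zf (\<nu> + 1) * zf (\<nu> - 1) * 0 + zf (\<nu> + 1) * (v - w)$(\<nu> + 2) + zf (\<nu> - 1) * (v - w)$(\<nu> - 2) \<in> twist_stalk 3 x"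
      using ts_diff[OF x V(2) W(2), of \<nu> \<nu>] unfolding lin by (simp add: right_diff_distrib)
    show "zf \<nu> * zf (\<nu> + 2) * zf (\<nu> - 2) * 0 + zf (\<nu> - 2) * (v - w)$(\<nu> + 1) + zf (\<nu> + 2) * (v - w)$(\<nu> - 1) \<in> twist_stalk 3 x"
      using ts_diff[OF x V(3) W(3), of \<nu> \<nu>] unfolding lin by (simp add: right_diff_distrib)
  qed
qed

lemma hm_cond_add:
  assumes x: "x \<in> Proj4" and w: "hm_cond x f g w" and u: "\<And>\<nu>. u$\<nu> \<in> twist_stalk 2 x"
  shows "hm_cond x f g (w + u)"
proof -
  have zu: "zf i * u$j \<in> twist_stalk 3 x" for i j by (rule ts_zf_mult[OF x u]) simp
  have w': "zf \<nu> * w$\<nu> \<in> twist_stalk 3 x"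
    "zf \<nu> * zf (\<nu> + 1) * zf (\<nu> - 1) * f + zf (\<nu> + 1) * w$(\<nu> + 2) + zf (\<nu> - 1) * w$(\<nu> - 2) \<in> twist_stalk 3 x"
    "zf \<nu> * zf (\<nu> + 2) * zf (\<nu> - 2) * g + zf (\<nu> - 2) * w$(\<nu> + 1) + zf (\<nu> + 2) * w$(\<nu> - 1) \<in> twist_stalk 3 x" for \<nu>
    using w by (simp_all add: hm_cond_def)
  have eq: "c + zf i * (w + u)$a + zf j * (w + u)$b = (c + zf i * w$a + zf j * w$b) + (zf i * u$a + zf j * u$b)" for c i j a b
    by (simp add: distrib_left)
  have eq1: "zf i * (w + u)$a = zf i * w$a + zf i * u$a" for i a by (simp add: distrib_left)
  show ?thesis unfolding hm_cond_def
  proof (intro allI conjI)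
    fix \<nu>
    show "zf \<nu> * (w + u)$\<nu> \<in> twist_stalk 3 x" unfolding eq1 by (rule ts_add[OF x w'(1) zu])
    show "zf \<nu> * zf (\<nu> + 1) * zf (\<nu> - 1) * f + zf (\<nu> + 1) * (w + u)$(\<nu> + 2) + zf (\<nu> - 1) * (w + u)$(\<nu> - 2) \<in> twist_stalk 3 x"
      unfolding eq by (rule ts_add[OF x w'(2) ts_add[OF x zu zu]])
    show "zf \<nu> * zf (\<nu> + 2) * zf (\<nu> - 2) * g + zf (\<nu> - 2) * (w + u)$(\<nu> + 1) + zf (\<nu> + 2) * (w + u)$(\<nu> - 1) \<in> twist_stalk 3 x"
      unfolding eq by (rule ts_add[OF x w'(3) ts_add[OF x zu zu]])
  qed
qed

text \<open>These are exactly the conditions in which a coordinate of w has the factor z_n: one for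
  each coordinate, found at the indices n, n+4, n+3, n+2 and n+1. The terms with f and g are put in
  front, so that the brackets have the form required by \<open>chart_solve\<close>.\<close>

lemma hm_cond_chart:
  assumes "hm_cond x f g w"
  shows "zf n * w$n \<in> twist_stalk 3 x"
    "zf (n + 4) * zf n * zf (n + 3) * f + (zf n * w$(n + 1) + zf (n + 3) * w$(n + 2)) \<in> twist_stalk 3 x"
    "zf (n + 3) * zf n * zf (n + 1) * g + (zf n * w$(n + 2) + zf (n + 1) * w$(n + 4)) \<in> twist_stalk 3 x"
    "zf (n + 2) * zf (n + 4) * zf n * g + (zf n * w$(n + 3) + zf (n + 4) * w$(n + 1)) \<in> twist_stalk 3 x"
    "zf (n + 1) * zf (n + 2) * zf n * f + (zf n * w$(n + 4) + zf (n + 2) * w$(n + 3)) \<in> twist_stalk 3 x"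
proof -
  have H: "zf \<nu> * w$\<nu> \<in> twist_stalk 3 x"
    "zf \<nu> * zf (\<nu> + 1) * zf (\<nu> + 4) * f + zf (\<nu> + 1) * w$(\<nu> + 2) + zf (\<nu> + 4) * w$(\<nu> + 3) \<in> twist_stalk 3 x"
    "zf \<nu> * zf (\<nu> + 2) * zf (\<nu> + 3) * g + zf (\<nu> + 3) * w$(\<nu> + 1) + zf (\<nu> + 2) * w$(\<nu> + 4) \<in> twist_stalk 3 x" for \<nu>
    using assms unfolding hm_cond_def minus_eq_plus_5 by blast+
  show "zf n * w$n \<in> twist_stalk 3 x" by (rule H)
  show "zf (n + 4) * zf n * zf (n + 3) * f + (zf n * w$(n + 1) + zf (n + 3) * w$(n + 2)) \<in> twist_stalk 3 x"
    using H(2)[of "n + 4"] by (simp add: add.assoc)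
  show "zf (n + 3) * zf n * zf (n + 1) * g + (zf n * w$(n + 2) + zf (n + 1) * w$(n + 4)) \<in> twist_stalk 3 x"
  proof -
    have "zf (n + 3) * zf n * zf (n + 1) * g + zf (n + 1) * w$(n + 4) + zf n * w$(n + 2) \<in> twist_stalk 3 x"
      using H(3)[of "n + 3"] by (simp add: add.assoc)
    then show ?thesis by (simp only: add.assoc add.commute[of "zf n * w$(n + 2)"])
  qed
  show "zf (n + 2) * zf (n + 4) * zf n * g + (zf n * w$(n + 3) + zf (n + 4) * w$(n + 1)) \<in> twist_stalk 3 x"
    using H(3)[of "n + 2"] by (simp add: add.assoc)
  show "zf (n + 1) * zf (n + 2) * zf n * f + (zf n * w$(n + 4) + zf (n + 2) * w$(n + 3)) \<in> twist_stalk 3 x"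
  proof -
    have "zf (n + 1) * zf (n + 2) * zf n * f + zf (n + 2) * w$(n + 3) + zf n * w$(n + 4) \<in> twist_stalk 3 x"
      using H(2)[of "n + 1"] by (simp add: add.assoc)
    then show ?thesis by (simp only: add.assoc add.commute[of "zf n * w$(n + 4)"])
  qed
qed

text \<open>If p(w) is regular at x, so is w: either all variables are units and the conditions on
  z_\<nu> w_\<nu> suffice, or the chart system has an invertible determinant.\<close>

lemma hm_cond_0_imp:
  assumes x: "x \<in> Proj4" and w: "hm_cond x 0 0 w"
  shows "w$\<nu> \<in> twist_stalk 2 x"
proof -
  obtain n where n: "Zvar n \<notin> x" using x by (rule Proj4_Zvar)
  show ?thesis
  proof (cases "delta n \<in> x")
    case True
    then have "Zvar \<nu> \<notin> x" by (rule delta_dichotomy[OF x n])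
    then show ?thesis using hm_cond_chart(1)[OF w] by (rule ts_zf_cancel[OF x]) simp
  next
    case False
    show ?thesis by (rule chart_solve[OF x n False]) (use hm_cond_chart[OF w, of n] in simp_all)
  qed
qed

lemma hm_at_all_units:
  assumes x: "x \<in> Proj4" and z: "\<And>\<nu>. Zvar \<nu> \<notin> x" and fg: "f \<in> fun_field" "g \<in> fun_field"
  shows "hm_at x f g \<longleftrightarrow> f \<in> twist_stalk 0 x \<and> g \<in> twist_stalk 0 x"
proof
  assume "hm_at x f g"
  then obtain w where w: "hm_cond x f g w" unfolding hm_at_def by blast
  have c: "h \<in> twist_stalk 0 x" if "zf i * zf j * zf k * h \<in> twist_stalk 3 x" for h i j k
  proof -
    have "zf i * (zf j * (zf k * h)) \<in> twist_stalk 3 x" using that by (simp add: mult.assoc)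
    then have "zf j * (zf k * h) \<in> twist_stalk 2 x" by (rule ts_zf_cancel[OF x z]) simp
    then have "zf k * h \<in> twist_stalk 1 x" by (rule ts_zf_cancel[OF x z]) simp
    then show ?thesis by (rule ts_zf_cancel[OF x z]) simp
  qed
  have "w$\<nu> \<in> twist_stalk 2 x" for \<nu> using hm_cond_chart(1)[OF w] by (rule ts_zf_cancel[OF x z]) simp
  then have zw: "zf i * w$j \<in> twist_stalk 3 x" for i j by (rule ts_zf_mult[OF x]) simp
  have "h \<in> twist_stalk 3 x" if "h + (zf i * w$j + zf k * w$l) \<in> twist_stalk 3 x" for h i j k l
    using ts_diff[OF x that ts_add[OF x zw zw], of i j k l] by simp
  then show "f \<in> twist_stalk 0 x \<and> g \<in> twist_stalk 0 x"
    using hm_cond_chart(2,3)[OF w] c by blast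
next
  assume a: "f \<in> twist_stalk 0 x \<and> g \<in> twist_stalk 0 x"
  have "hm_cond x f g 0" unfolding hm_cond_def using a x by (simp add: ts_zf3)
  then show "hm_at x f g" unfolding hm_at_def by (intro exI[of _ 0]) (simp add: eta_Proj4)
qed

section \<open>Reduction to prime divisors\<close>

lemma hm_cond_codim1:
  assumes x: "x \<in> Proj4" and fg: "f \<in> fun_field" "g \<in> fun_field" and w: "\<And>\<nu>. w$\<nu> \<in> twist_stalk 2 eta"
    and P: "\<And>P. P \<in> prime_divisors \<Longrightarrow> P \<subseteq> x \<Longrightarrow> hm_cond P f g w"
  shows "hm_cond x f g w"
proof -
  have "hm_cond eta f g w" using fg w by (rule hm_cond_eta)
  then show ?thesis unfolding hm_cond_def
    by (intro allI conjI; intro twist_stalk_codim1[OF x]; simp add: P[unfolded hm_cond_def])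
qed

text \<open>Since the witness given at \<open>P\<close> varies with \<open>P\<close>, a common one
  is built by solving the chart system exactly. It differs from each given witness by something
  regular at \<open>P\<close>, hence satisfies the conditions at every \<open>P\<close> through
  \<open>x\<close>; then each condition is a statement about a single function, to which
  \<open>twist_stalk_codim1\<close> applies.\<close>

theorem hm_at_codim1:
  fixes x :: "'k::field point"
  assumes x: "x \<in> Proj4" and fg: "f \<in> fun_field" "g \<in> fun_field"
    and P: "\<And>P. P \<in> prime_divisors \<Longrightarrow> P \<subseteq> x \<Longrightarrow> hm_at P f g"
  shows "hm_at x f g"
proof -
  obtain n where n: "Zvar n \<notin> x" using x by (rule Proj4_Zvar)
  show ?thesis
  proof (cases "delta n \<in> x")
    case True
    have z: "Zvar \<nu> \<notin> x" for \<nu> using True by (rule delta_dichotomy[OF x n])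
    have fgP: "f \<in> twist_stalk 0 P" "g \<in> twist_stalk 0 P" if PP: "P \<in> prime_divisors" "P \<subseteq> x" for P
    proof -
      have "Zvar \<nu> \<notin> P" for \<nu> using z[of \<nu>] PP(2) by blast
      from hm_at_all_units[OF prime_divisor_Proj4[OF PP(1)] this fg] P[OF PP]
      show "f \<in> twist_stalk 0 P" "g \<in> twist_stalk 0 P" by simp_all
    qed
    have "f \<in> twist_stalk 0 x" by (rule twist_stalk_codim1[OF x fg(1)[unfolded fun_field_eq] fgP(1)])
    moreover have "g \<in> twist_stalk 0 x" by (rule twist_stalk_codim1[OF x fg(2)[unfolded fun_field_eq] fgP(2)])
    ultimately show ?thesis using hm_at_all_units[OF x z fg] by simp
  next
    case False
    define z0 z1 z2 z3 z4 :: "'k hfrac" where z: "z0 = zf n" "z1 = zf (n + 1)" "z2 = zf (n + 2)" "z3 = zf (n + 3)" "z4 = zf (n + 4)"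
    define F1 F2 F3 F4 where F: "F1 = z4 * z0 * z3 * f" "F2 = z3 * z0 * z1 * g" "F3 = z2 * z4 * z0 * g" "F4 = z1 * z2 * z0 * f"
    \<comment> \<open>The elimination formula of \<open>chart_solve\<close> with right-hand sides -
      F1, ..., - F4, the negatives of the terms with f and g. The other coordinates follow by
      back-substitution.\<close>
    define w1 where "w1 = - (z0 * (z0 * (z0 * F1)) - z0 * (z0 * (z3 * F2)) + z0 * (z1 * (z3 * F4)) - z1 * (z2 * (z3 * F3))) / deltaf n"
    define w3 where "w3 = (- F3 - z4 * w1) / z0"
    define w4 where "w4 = (- F4 - z2 * w3) / z0"
    define w2 where "w2 = (- F2 - z1 * w4) / z0"
    \<comment> \<open>The chart equation for w_n contains neither f nor g, so it is solved by w_n =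
      0.\<close>
    define w where "w = (\<chi> \<nu>. if \<nu> = n + 1 then w1 else if \<nu> = n + 2 then w2 else if \<nu> = n + 3 then w3 else if \<nu> = n + 4 then w4 else 0)"
    have wn: "w$n = 0" "w$(n + 1) = w1" "w$(n + 2) = w2" "w$(n + 3) = w3" "w$(n + 4) = w4"
      by (simp_all add: w_def)
    have z0: "z0 \<noteq> 0" by (simp add: z)
    have dn: "delta n \<noteq> (0 :: 'k hpoly)" using False Proj4_0[OF x] by auto
    then have d0: "deltaf n \<noteq> (0 :: 'k hfrac)" unfolding emb_delta[symmetric] by simp
    have eq3: "z0 * w3 + z4 * w1 = - F3" using z0 by (simp add: w3_def)
    have eq4: "z0 * w4 + z2 * w3 = - F4" using z0 by (simp add: w4_def)
    have eq2: "z0 * w2 + z1 * w4 = - F2" using z0 by (simp add: w2_def)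
    have eq1: "z0 * w1 + z3 * w2 = - F1"
    proof -
      have a: "deltaf n * w1 = - (z0 * (z0 * (z0 * F1)) - z0 * (z0 * (z3 * F2)) + z0 * (z1 * (z3 * F4)) - z1 * (z2 * (z3 * F3)))"
        using d0 by (simp add: w1_def)
      have df: "deltaf n = z0 ^ 4 - z1 * z2 * z3 * z4" by (simp add: deltaf_def z)
      have F': "F2 = - (z0 * w2 + z1 * w4)" "F3 = - (z0 * w3 + z4 * w1)" "F4 = - (z0 * w4 + z2 * w3)"
        using eq2 eq3 eq4 by simp_all
      \<comment> \<open>The elimination read backwards: three of the four equations hold by
        construction, and the formula for w1 amounts to the fourth one multiplied by the cube of
        z0.\<close>
      have "z0 * (z0 * (z0 * (z0 * w1 + z3 * w2 + F1))) = 0"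
        using a unfolding df F' by (simp add: algebra_simps power4_eq_xxxx)
      then show ?thesis using z0 by (simp add: eq_neg_iff_add_eq_0)
    qed
    have w: "w$\<nu> \<in> twist_stalk 2 eta" for \<nu>
    proof -
      have zz: "z0 * h \<in> twist_stalk (l + 1) eta" "z1 * h \<in> twist_stalk (l + 1) eta" "z2 * h \<in> twist_stalk (l + 1) eta"
        "z3 * h \<in> twist_stalk (l + 1) eta" "z4 * h \<in> twist_stalk (l + 1) eta" if "h \<in> twist_stalk l eta" for h l
        unfolding z using that by (simp_all add: zf_mult_stalk[OF eta_Proj4])
      have FF: "F1 \<in> twist_stalk 3 eta" "F2 \<in> twist_stalk 3 eta" "F3 \<in> twist_stalk 3 eta" "F4 \<in> twist_stalk 3 eta"
        unfolding F z using fg by (auto intro!: ts_zf3[OF eta_Proj4] simp: fun_field_eq)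
      have "delta n \<notin> (eta :: 'k point)" using dn by (simp add: eta_def)
      moreover have "- F1 \<in> twist_stalk 3 eta" "- F2 \<in> twist_stalk 3 eta" "- F3 \<in> twist_stalk 3 eta" "- F4 \<in> twist_stalk 3 eta"
        using FF by (simp_all add: eta_Proj4)
      ultimately show ?thesis
        by (intro chart_solve[OF eta_Proj4 Zvar_notin_eta, of n])
          (simp_all add: wn eq1[unfolded z] eq2[unfolded z] eq3[unfolded z] eq4[unfolded z] eta_Proj4)
    qed
    have "hm_cond P f g w" if PP: "P \<in> prime_divisors" "P \<subseteq> x" for P
    proof -
      have P4: "P \<in> Proj4" using PP(1) by (rule prime_divisor_Proj4)
      obtain v where v: "hm_cond P f g v" using P[OF PP] unfolding hm_at_def by blast
      note H = hm_cond_chart[OF v, of n, folded z, folded F]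
      have neg: "- a - b \<in> twist_stalk 3 P" if "a + b \<in> twist_stalk 3 P" for a b
      proof -
        have "- a - b = - (a + b)" by simp
        then show ?thesis using that by (simp only: ts_uminus_iff[OF P4])
      qed
      have lin: "a * (b - c) + d * (e - h) = a * b + d * e - (a * c + d * h)" for a b c d e h :: "'k hfrac"
        by (simp add: algebra_simps)
      \<comment> \<open>The exact solution turns each chart expression in \<open>w - v\<close> into
        the negative of a chart condition for \<open>v\<close>, which is regular at
        \<open>P\<close>.\<close>
      have "(w - v)$\<nu> \<in> twist_stalk 2 P" for \<nu>
      proof (rule chart_solve[OF P4, of n])
        show "Zvar n \<notin> P" "delta n \<notin> P" using n False PP(2) by blast+
        show "zf n * (w - v)$n \<in> twist_stalk 3 P" using H(1) by (simp add: wn P4 z)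
        have "zf n * (w - v)$(n + 1) + zf (n + 3) * (w - v)$(n + 2) = - F1 - (z0 * v$(n + 1) + z3 * v$(n + 2))"
          unfolding eq1[symmetric] by (simp only: vector_minus_component lin wn z)
        then show "zf n * (w - v)$(n + 1) + zf (n + 3) * (w - v)$(n + 2) \<in> twist_stalk 3 P"
          using neg[OF H(2)] by simp
        have "zf n * (w - v)$(n + 2) + zf (n + 1) * (w - v)$(n + 4) = - F2 - (z0 * v$(n + 2) + z1 * v$(n + 4))"
          unfolding eq2[symmetric] by (simp only: vector_minus_component lin wn z)
        then show "zf n * (w - v)$(n + 2) + zf (n + 1) * (w - v)$(n + 4) \<in> twist_stalk 3 P"
          using neg[OF H(3)] by simp
        have "zf n * (w - v)$(n + 3) + zf (n + 4) * (w - v)$(n + 1) = - F3 - (z0 * v$(n + 3) + z4 * v$(n + 1))"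
          unfolding eq3[symmetric] by (simp only: vector_minus_component lin wn z)
        then show "zf n * (w - v)$(n + 3) + zf (n + 4) * (w - v)$(n + 1) \<in> twist_stalk 3 P"
          using neg[OF H(4)] by simp
        have "zf n * (w - v)$(n + 4) + zf (n + 2) * (w - v)$(n + 3) = - F4 - (z0 * v$(n + 4) + z2 * v$(n + 3))"
          unfolding eq4[symmetric] by (simp only: vector_minus_component lin wn z)
        then show "zf n * (w - v)$(n + 4) + zf (n + 2) * (w - v)$(n + 3) \<in> twist_stalk 3 P"
          using neg[OF H(5)] by simp
      qed
      from hm_cond_add[OF P4 v this] show ?thesis by simp
    qed
    then have "hm_cond x f g w" by (rule hm_cond_codim1[OF x fg w])
    then show ?thesis unfolding hm_at_def using w by blast
  qed
qed

section \<open>The coordinate hyperplanes\<close>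

text \<open>All variables except z_n are units, so only w_n may be singular. The two conditions at
  index n contain no w_n and bound the poles of f and g. The f-condition at n+2 and the g-condition
  at n+1 both contain w_n; the difference of their cancelled forms is the third condition on the
  right.\<close>

lemma hm_at_Hyp:
  fixes f g :: "'k::field hfrac"
  assumes fg: "f \<in> fun_field" "g \<in> fun_field"
  shows "hm_at (Hyp n) f g \<longleftrightarrow> zf n * f \<in> twist_stalk 1 (Hyp n) \<and> zf n * g \<in> twist_stalk 1 (Hyp n)
    \<and> zf (n + 2) * zf (n + 3) * f - zf (n + 1) * zf (n + 4) * g \<in> twist_stalk 2 (Hyp n)" (is "?L \<longleftrightarrow> ?R")
proof -
  let ?P = "Hyp n :: 'k point"
  have P: "?P \<in> Proj4" by (rule prime_divisor_Proj4[OF Hyp_prime_divisor])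
  have z: "Zvar (n + a) \<notin> ?P" if "a \<noteq> 0" for a using that by (simp add: Zvar_in_Hyp)
  note cancel = ts_zf_cancel[OF P z]
  show ?thesis
  proof
    assume ?L
    then obtain w where w: "hm_cond ?P f g w" unfolding hm_at_def by blast
    have H: "zf \<nu> * w$\<nu> \<in> twist_stalk 3 ?P"
      "zf \<nu> * zf (\<nu> + 1) * zf (\<nu> + 4) * f + zf (\<nu> + 1) * w$(\<nu> + 2) + zf (\<nu> + 4) * w$(\<nu> + 3) \<in> twist_stalk 3 ?P"
      "zf \<nu> * zf (\<nu> + 2) * zf (\<nu> + 3) * g + zf (\<nu> + 3) * w$(\<nu> + 1) + zf (\<nu> + 2) * w$(\<nu> + 4) \<in> twist_stalk 3 ?P" for \<nu>
      using w unfolding hm_cond_def minus_eq_plus_5 by simp_all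
    have "w$(n + a) \<in> twist_stalk 2 ?P" if "a \<noteq> 0" for a
      by (rule cancel[OF that H(1)]) simp
    then have zw: "zf i * w$(n + a) \<in> twist_stalk 3 ?P" if "a \<noteq> 0" for i a
      using that by (intro ts_zf_mult[OF P, of _ 2]) simp_all
    have drop: "h \<in> twist_stalk 3 ?P" if "h + t \<in> twist_stalk 3 ?P" "t \<in> twist_stalk 3 ?P" for h t
      using ts_diff[OF P that] by simp
    have "zf n * zf (n + 1) * zf (n + 4) * f \<in> twist_stalk 3 ?P"
      using drop[OF drop[OF H(2)[of n] zw] zw] by simp
    then have "zf (n + 1) * (zf (n + 4) * (zf n * f)) \<in> twist_stalk 3 ?P" by (simp add: ac_simps)
    then have "zf (n + 4) * (zf n * f) \<in> twist_stalk 2 ?P" by (rule cancel[rotated]) simp_all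
    then have f: "zf n * f \<in> twist_stalk 1 ?P" by (rule cancel[rotated]) simp_all
    have "zf n * zf (n + 2) * zf (n + 3) * g \<in> twist_stalk 3 ?P"
      using drop[OF drop[OF H(3)[of n] zw] zw] by simp
    then have "zf (n + 2) * (zf (n + 3) * (zf n * g)) \<in> twist_stalk 3 ?P" by (simp add: ac_simps)
    then have "zf (n + 3) * (zf n * g) \<in> twist_stalk 2 ?P" by (rule cancel[rotated]) simp_all
    then have g: "zf n * g \<in> twist_stalk 1 ?P" by (rule cancel[rotated]) simp_all
    have "zf (n + 2) * zf (n + 3) * zf (n + 1) * f + zf (n + 3) * w$(n + 4) + zf (n + 1) * w$n \<in> twist_stalk 3 ?P"
      using H(2)[of "n + 2"] by (simp add: add.assoc)
    then have "(zf (n + 2) * zf (n + 3) * zf (n + 1) * f + zf (n + 1) * w$n) + zf (n + 3) * w$(n + 4) \<in> twist_stalk 3 ?P"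
      by (simp add: add.assoc add.commute[of "zf (n + 3) * _"])
    from drop[OF this zw] have "zf (n + 1) * (zf (n + 2) * zf (n + 3) * f + w$n) \<in> twist_stalk 3 ?P"
      by (simp add: distrib_left mult.commute mult.left_commute)
    then have a: "zf (n + 2) * zf (n + 3) * f + w$n \<in> twist_stalk 2 ?P" by (rule cancel[rotated]) simp_all
    have "zf (n + 1) * zf (n + 3) * zf (n + 4) * g + zf (n + 4) * w$(n + 2) + zf (n + 3) * w$n \<in> twist_stalk 3 ?P"
      using H(3)[of "n + 1"] by (simp add: add.assoc)
    then have "(zf (n + 1) * zf (n + 3) * zf (n + 4) * g + zf (n + 3) * w$n) + zf (n + 4) * w$(n + 2) \<in> twist_stalk 3 ?P"
      by (simp add: add.assoc add.commute[of "zf (n + 4) * _"])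
    from drop[OF this zw] have "zf (n + 3) * (zf (n + 1) * zf (n + 4) * g + w$n) \<in> twist_stalk 3 ?P"
      by (simp add: distrib_left mult.commute mult.left_commute)
    then have b: "zf (n + 1) * zf (n + 4) * g + w$n \<in> twist_stalk 2 ?P" by (rule cancel[rotated]) simp_all
    show ?R using f g ts_diff[OF P a b] by simp
  next
    assume R: ?R
    define k where "k = zf (n + 2) * zf (n + 3) * f - zf (n + 1) * zf (n + 4) * g"
    \<comment> \<open>Only w_n is needed. Its value makes the f-conditions at n+2 and n+3 vanish and
      turns the g-conditions at n+1 and n+4 into multiples of \<open>k\<close>.\<close>
    define w :: "'k hfrac^5" where "w = axis n (- (zf (n + 2) * zf (n + 3) * f))"
    have wn: "w$n = - (zf (n + 2) * zf (n + 3) * f)" "w$(n + 1) = 0" "w$(n + 2) = 0" "w$(n + 3) = 0" "w$(n + 4) = 0"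
      by (simp_all add: w_def axis_def)
    have "zf (n + 2) * (zf (n + 3) * f) \<in> twist_stalk 2 eta"
      using fg(1) by (intro ts_zf_mult[OF eta_Proj4, of _ 1] ts_zf_mult[OF eta_Proj4, of _ 0]) (simp_all add: fun_field_eq)
    then have w: "w$\<nu> \<in> twist_stalk 2 eta" for \<nu>
      by (simp add: w_def axis_def eta_Proj4 mult.assoc)
    have zz: "zf i * (zf j * (zf n * h)) \<in> twist_stalk 3 ?P" if "zf n * h \<in> twist_stalk 1 ?P" for i j h
      by (rule ts_zf_mult[OF P ts_zf_mult[OF P that]]) simp_all
    have ff: "zf i * zf j * zf n * f \<in> twist_stalk 3 ?P" "zf i * zf n * zf j * f \<in> twist_stalk 3 ?P"
      "zf n * zf i * zf j * f \<in> twist_stalk 3 ?P" for i j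
      using zz[of f i j] R by (simp_all add: ac_simps)
    have gg: "zf i * zf j * zf n * g \<in> twist_stalk 3 ?P" "zf i * zf n * zf j * g \<in> twist_stalk 3 ?P"
      "zf n * zf i * zf j * g \<in> twist_stalk 3 ?P" for i j
      using zz[of g i j] R by (simp_all add: ac_simps)
    have kk: "zf i * - k \<in> twist_stalk 3 ?P" for i
      using R by (intro ts_zf_mult[OF P, of _ 2]) (simp_all add: k_def P del: minus_diff_eq)
    have "hm_cond ?P f g w"
      unfolding hm_cond_def minus_eq_plus_5
    proof
      fix \<nu>
      have 1: "zf n * w$n \<in> twist_stalk 3 ?P"
        using ff(3)[of "n + 2" "n + 3"] P by (simp add: wn mult.assoc)
      have 2: "zf (n + 2) * zf (n + 3) * zf (n + 1) * f + zf (n + 1) * w$n = 0"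
        "zf (n + 3) * zf (n + 4) * zf (n + 2) * f + zf (n + 4) * w$n = 0"
        by (simp_all add: wn)
      have 3: "zf (n + 1) * zf (n + 3) * zf (n + 4) * g + zf (n + 3) * w$n = zf (n + 3) * - k"
        "zf (n + 4) * zf (n + 1) * zf (n + 2) * g + zf (n + 2) * w$n = zf (n + 2) * - k"
        by (simp_all add: wn k_def algebra_simps)
      have "\<nu> - n = 0 \<or> \<nu> - n = 1 \<or> \<nu> - n = 2 \<or> \<nu> - n = 3 \<or> \<nu> - n = 4" by (rule exhaust_5)
      then have "\<nu> = n \<or> \<nu> = n + 1 \<or> \<nu> = n + 2 \<or> \<nu> = n + 3 \<or> \<nu> = n + 4"
        by (simp add: diff_eq_eq add.commute)
      then show "zf \<nu> * w$\<nu> \<in> twist_stalk 3 ?P \<and>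
        zf \<nu> * zf (\<nu> + 1) * zf (\<nu> + 4) * f + zf (\<nu> + 1) * w$(\<nu> + 2) + zf (\<nu> + 4) * w$(\<nu> + 3) \<in> twist_stalk 3 ?P \<and>
        zf \<nu> * zf (\<nu> + 2) * zf (\<nu> + 3) * g + zf (\<nu> + 3) * w$(\<nu> + 1) + zf (\<nu> + 2) * w$(\<nu> + 4) \<in> twist_stalk 3 ?P"
      proof (elim disjE)
        assume "\<nu> = n"
        then show ?thesis using 1 ff gg by (simp add: wn(2-5))
      next
        assume "\<nu> = n + 1"
        then show ?thesis using P ff gg kk[of "n + 3"] unfolding 3(1)[symmetric] by (simp add: wn(2-5) add.assoc)
      next
        assume "\<nu> = n + 2"
        then show ?thesis using P ff gg 2 by (simp add: wn(2-5) add.assoc)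
      next
        assume "\<nu> = n + 3"
        then show ?thesis using P ff gg 2 by (simp add: wn(2-5) add.assoc)
      next
        assume "\<nu> = n + 4"
        then show ?thesis using P ff gg kk[of "n + 2"] unfolding 3(2)[symmetric] by (simp add: wn(2-5) add.assoc)
      qed
    qed
    then show ?L unfolding hm_at_def using w by blast
  qed
qed

section \<open>The residue condition at a coordinate hyperplane\<close>

definition hfun :: "5 \<Rightarrow> 'k::field hfrac" where
  "hfun n = zf (n + 1) * zf (n - 1) / (zf (n + 2) * zf (n - 2))"

lemma hfun_unit: "hfun n \<in> local_units (Hyp n :: 'k::field point)"
proof -
  let ?P = "Hyp n :: 'k point"
  have P: "?P \<in> Proj4" by (rule prime_divisor_Proj4[OF Hyp_prime_divisor])
  have z: "Zvar (n + a) \<notin> ?P" if "a \<noteq> 0" for a using that by (simp add: Zvar_in_Hyp)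
  have "(zf (n + 1) / zf (n + 2)) * (zf (n + 4) / zf (n + 3)) \<in> local_units ?P"
    by (intro local_units_mult[OF P] zf_local_unit[OF P] z) simp_all
  then show ?thesis by (simp add: hfun_def minus_eq_plus_5)
qed

text \<open>Division by the unit z_(n+1) replaces z_n by a uniformizer of degree 0, so
  multiplication by z_n raises the order by 1.\<close>

lemma zf_mult_iff_ordP:
  assumes f: "f \<in> fun_field"
  shows "zf n * f \<in> twist_stalk 1 (Hyp n) \<longleftrightarrow> Fin (- 1) \<le> ordP (Hyp n) f"
proof -
  let ?P = "Hyp n" and ?t = "zf n / zf (n + 1)"
  have P: "?P \<in> prime_divisors" by (rule Hyp_prime_divisor)
  have P4: "?P \<in> Proj4" using P by (rule prime_divisor_Proj4)
  have t: "?t \<in> fun_field"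
    unfolding fun_field_eq by (rule ts_eta_zf_divide) (simp add: eta_Proj4)
  have "zf n * f \<in> twist_stalk 1 ?P \<longleftrightarrow> ?t * f \<in> twist_stalk 0 ?P"
    using ts_zf_mult_iff[OF P4, of "n + 1" "?t * f" 0] by (simp add: Zvar_in_Hyp)
  also have "\<dots> \<longleftrightarrow> 0 \<le> ordP ?P (?t * f)"
    using local_ring_iff_ordP[OF P fun_field_mult[OF t f]] by (simp add: local_ring_def)
  also have "ordP ?P (?t * f) = Fin 1 + ordP ?P f"
    unfolding ordP_mult[OF P t f] by (simp add: ordP_Hyp_zf)
  also have "0 \<le> Fin 1 + ordP ?P f \<longleftrightarrow> Fin (- 1) \<le> ordP ?P f"
    by (cases "ordP ?P f") (auto simp: zero_extended_def)
  finally show ?thesis .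
qed

lemma hm_at_Hyp_iff:
  fixes f g :: "'k::field hfrac"
  assumes fg: "f \<in> fun_field" "g \<in> fun_field"
  shows "hm_at (Hyp n) f g \<longleftrightarrow> Fin (- 1) \<le> ordP (Hyp n) f \<and> Fin (- 1) \<le> ordP (Hyp n) g
    \<and> f - hfun n * g \<in> local_ring (Hyp n)"
proof -
  let ?P = "Hyp n :: 'k point"
  have P4: "?P \<in> Proj4" by (rule prime_divisor_Proj4[OF Hyp_prime_divisor])
  have z: "Zvar (n + a) \<notin> ?P" if "a \<noteq> 0" for a using that by (simp add: Zvar_in_Hyp)
  have "zf (n + 2) * zf (n + 3) * f - zf (n + 1) * zf (n + 4) * g = zf (n + 2) * (zf (n + 3) * (f - hfun n * g))"
    by (simp add: hfun_def minus_eq_plus_5 field_simps)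
  also have "\<dots> \<in> twist_stalk 2 ?P \<longleftrightarrow> zf (n + 3) * (f - hfun n * g) \<in> twist_stalk 1 ?P"
    using ts_zf_mult_iff[OF P4 z, of 2 "zf (n + 3) * (f - hfun n * g)" 1] by simp
  also have "\<dots> \<longleftrightarrow> f - hfun n * g \<in> local_ring ?P"
    using ts_zf_mult_iff[OF P4 z, of 3 "f - hfun n * g" 0] by (simp add: local_ring_def)
  finally show ?thesis unfolding hm_at_Hyp[OF fg] zf_mult_iff_ordP[OF fg(1)] zf_mult_iff_ordP[OF fg(2)] by simp
qed

lemma local_ring_add: "P \<in> Proj4 \<Longrightarrow> f \<in> local_ring P \<Longrightarrow> g \<in> local_ring P \<Longrightarrow> f + g \<in> local_ring P"
  unfolding local_ring_def by (rule ts_add)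

lemma local_ring_uminus: "P \<in> Proj4 \<Longrightarrow> f \<in> local_ring P \<Longrightarrow> - f \<in> local_ring P"
  unfolding local_ring_def by simp

lemma max_ideal_group:
  assumes P: "P \<in> prime_divisors"
  shows "0 \<in> max_ideal P" "a \<in> max_ideal P \<Longrightarrow> b \<in> max_ideal P \<Longrightarrow> a + b \<in> max_ideal P"
    "a \<in> max_ideal P \<Longrightarrow> - a \<in> max_ideal P"
proof -
  have P4: "P \<in> Proj4" using P by (rule prime_divisor_Proj4)
  obtain \<pi> where \<pi>: "uniformizer P \<pi>" using P by (rule prime_divisor_uniformizer) blast
  have m: "a \<in> max_ideal P \<longleftrightarrow> (\<exists>r\<in>local_ring P. a = \<pi> * r)" for a
    using \<pi> unfolding uniformizer_def by blast
  have "0 \<in> local_ring P" using P4 by (simp add: local_ring_def)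
  then show "0 \<in> max_ideal P" unfolding m by (intro bexI[of _ 0]) simp_all
  show "a + b \<in> max_ideal P" if "a \<in> max_ideal P" "b \<in> max_ideal P"
    using that unfolding m by (metis distrib_left local_ring_add[OF P4])
  show "- a \<in> max_ideal P" if "a \<in> max_ideal P"
    using that unfolding m by (metis mult_minus_right local_ring_uminus[OF P4])
qed

lemma value_at_eq_iff:
  assumes P: "P \<in> prime_divisors" and b: "b \<in> local_ring P"
  shows "value_at P a = value_at P b \<longleftrightarrow> a - b \<in> max_ideal P"
proof -
  have P4: "P \<in> Proj4" using P by (rule prime_divisor_Proj4)
  have v: "value_at P c = (if c \<in> local_ring P then Some (coset (max_ideal P) c) else None)" for c
    by (simp add: value_at_def coset_def)
  have "a \<in> local_ring P" if "a - b \<in> max_ideal P"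
    using local_ring_add[OF P4 max_ideal_local_ring[OF that] b] by simp
  then show ?thesis unfolding v using b coset_eq_iff[OF max_ideal_group[OF P], of a b] by auto
qed

text \<open>Since \<open>hfun n\<close> is regular, \<open>hval n\<close> is not
  \<open>None\<close>. This excludes both g = 0 and a pole of f/g.\<close>

lemma quot_value_at_eq_hval:
  fixes f g :: "'k::field hfrac"
  shows "quot_value_at (Hyp n) f g = hval n \<longleftrightarrow> g \<noteq> 0 \<and> f / g - hfun n \<in> max_ideal (Hyp n)"
proof -
  have "(hfun n :: 'k hfrac) \<in> local_units (Hyp n)" by (rule hfun_unit)
  then have h: "(hfun n :: 'k hfrac) \<in> local_ring (Hyp n)" by (simp add: local_units_def)
  have v: "hval n = value_at (Hyp n) (hfun n :: 'k hfrac)" by (simp add: hval_def hfun_def)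
  then have "hval n \<noteq> (None :: 'k hfrac set option)" using h by (simp add: value_at_def)
  then show ?thesis
    unfolding quot_value_at_def
    using value_at_eq_iff[OF Hyp_prime_divisor h, of "f / g"] v[symmetric] by auto
qed

section \<open>The Weil decoration\<close>

definition hm_ord :: "'k::field hfrac \<Rightarrow> 'k hfrac \<Rightarrow> 'k point \<Rightarrow> int extended" where
  "hm_ord f g P = (if \<exists>\<nu>. P = Hyp \<nu> \<and> quot_value_at P f g = hval \<nu>
     then min (ordP P f) (ordP P g) + 1 else min (ordP P f) (ordP P g))"

lemma Hyp_eq_iff: "(Hyp \<mu> :: 'k::field point) = Hyp \<nu> \<longleftrightarrow> \<mu> = \<nu>"
proof
  assume "(Hyp \<mu> :: 'k point) = Hyp \<nu>"
  then have "(Zvar \<mu> :: 'k hpoly) \<in> Hyp \<nu>" by (simp add: Zvar_in_Hyp flip: \<open>Hyp \<mu> = Hyp \<nu>\<close>)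
  then show "\<mu> = \<nu>" by (simp add: Zvar_in_Hyp)
qed simp

lemma min_ord_iff:
  "0 \<le> Fin k + min a b \<longleftrightarrow> 0 \<le> Fin k + a \<and> 0 \<le> Fin k + (b :: int extended)"
  by (cases a; cases b) (auto simp: zero_extended_def min_def)

text \<open>On a hyperplane with f/g congruent to the unit \<open>hfun n\<close>, f and g have equal
  order, and cf - h(cg) is cg times an element of the maximal ideal; so a simple pole of cf and cg
  is allowed, whence the extra 1. Without the congruence a simple pole of cg would contradict the
  regularity of cf - h(cg), so both functions must be regular.\<close>

lemma hm_at_iff_hm_ord:
  fixes f g c :: "'k::field hfrac"
  assumes P: "P \<in> prime_divisors" and fg: "f \<in> fun_field" "g \<in> fun_field" and c: "c \<in> fun_field" "c \<noteq> 0"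
  shows "hm_at P (c * f) (c * g) \<longleftrightarrow> 0 \<le> ordP P c + hm_ord f g P"
proof -
  have P4: "P \<in> Proj4" using P by (rule prime_divisor_Proj4)
  obtain k where k: "ordP P c = Fin k" using ordP_Fin[OF c(2)] by blast
  have F: "c * f \<in> fun_field" "c * g \<in> fun_field" using c fg by (simp_all add: fun_field_mult)
  have ordF: "ordP P (c * f) = Fin k + ordP P f" "ordP P (c * g) = Fin k + ordP P g"
    using ordP_mult[OF P c(1)] fg by (simp_all add: k)
  have loc: "c * f \<in> local_ring P \<and> c * g \<in> local_ring P \<longleftrightarrow> 0 \<le> ordP P c + min (ordP P f) (ordP P g)"
    using local_ring_iff_ordP[OF P F(1)] local_ring_iff_ordP[OF P F(2)] by (simp add: k ordF min_ord_iff)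
  show ?thesis
  proof (cases "\<exists>\<nu>. P = Hyp \<nu>")
    case False
    then have z: "Zvar \<nu> \<notin> P" for \<nu> using prime_divisor_eq_Hyp[OF P] by blast
    have "hm_at P (c * f) (c * g) \<longleftrightarrow> c * f \<in> local_ring P \<and> c * g \<in> local_ring P"
      unfolding local_ring_def by (rule hm_at_all_units[OF P4 z F])
    then show ?thesis using loc False by (simp add: hm_ord_def)
  next
    case True
    then obtain n where n: "P = Hyp n" by blast
    define Q where "Q \<longleftrightarrow> g \<noteq> 0 \<and> f / g - hfun n \<in> max_ideal P"
    have Q: "(\<exists>\<nu>. P = Hyp \<nu> \<and> quot_value_at P f g = hval \<nu>) \<longleftrightarrow> Q"
      unfolding n Hyp_eq_iff Q_def quot_value_at_eq_hval[symmetric] by blast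
    have h: "hfun n \<in> local_units P" unfolding n by (rule hfun_unit)
    then have hl: "hfun n \<in> local_ring P" by (simp add: local_units_def)
    have hK: "(hfun n :: 'k hfrac) \<in> fun_field" using local_ring_fun_field[OF P4 hl] .
    have at: "hm_at P (c * f) (c * g) \<longleftrightarrow> Fin (- 1) \<le> ordP P (c * f) \<and> Fin (- 1) \<le> ordP P (c * g)
        \<and> c * f - hfun n * (c * g) \<in> local_ring P"
      unfolding n by (rule hm_at_Hyp_iff[OF F])
    show ?thesis
    proof (cases Q)
      case True
      define r where "r = f / g - hfun n"
      have g0: "g \<noteq> 0" and r: "r \<in> max_ideal P" using True by (simp_all add: Q_def r_def)
      have rK: "r \<in> fun_field" using local_ring_fun_field[OF P4 max_ideal_local_ring[OF r]] .
      have q: "f / g = hfun n + r" by (simp add: r_def)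
      have ql: "f / g \<in> local_ring P" unfolding q using local_ring_add[OF P4 hl max_ideal_local_ring[OF r]] .
      have "f / g \<notin> max_ideal P"
      proof
        assume "f / g \<in> max_ideal P"
        then have "f / g + - r \<in> max_ideal P" using max_ideal_group[OF P] r by blast
        then show False using local_unit_notin_max_ideal[OF P4 h] by (simp add: q)
      qed
      moreover have qK: "f / g \<in> fun_field" using fg by (simp add: fun_field_divide)
      ultimately have "ordP P (f / g) = Fin 0"
        using local_ring_iff_ordP[OF P qK] max_ideal_iff_ordP[OF P qK] ql
        by (cases "ordP P (f / g)") (auto simp: zero_extended_def)
      then have of: "ordP P f = ordP P g"
        using ordP_mult[OF P qK fg(2)] g0 by (cases "ordP P g") simp_all
      obtain m where m: "ordP P g = Fin m" using ordP_Fin[OF g0] by blast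
      have "c * f - hfun n * (c * g) = (c * g) * r" using g0 by (simp add: r_def field_simps)
      moreover have "(c * g) * r \<in> local_ring P" if "- 1 \<le> k + m"
      proof -
        have "Fin 1 \<le> ordP P r" using r max_ideal_iff_ordP[OF P rK] by simp
        then have "0 \<le> ordP P ((c * g) * r)"
          unfolding ordP_mult[OF P F(2) rK] ordF m using that
          by (cases "ordP P r") (auto simp: zero_extended_def)
        then show ?thesis using local_ring_iff_ordP[OF P fun_field_mult[OF F(2) rK]] by simp
      qed
      ultimately have "hm_at P (c * f) (c * g) \<longleftrightarrow> - 1 \<le> k + m"
        unfolding at ordF of m by auto
      then show ?thesis
        unfolding hm_ord_def Q using True by (auto simp: of m k zero_extended_def one_extended_def)
    next
      case False
      have "hm_at P (c * f) (c * g) \<longleftrightarrow> c * f \<in> local_ring P \<and> c * g \<in> local_ring P"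
      proof
        assume "c * f \<in> local_ring P \<and> c * g \<in> local_ring P"
        then have l: "c * f \<in> local_ring P" "c * g \<in> local_ring P" by simp_all
        have "c * f + - (hfun n * (c * g)) \<in> local_ring P"
          by (intro local_ring_add[OF P4] local_ring_uminus[OF P4] local_ring_mult[OF P4 hl l(2)] l(1))
        moreover have "0 \<le> ordP P (c * f)" "0 \<le> ordP P (c * g)"
          using l local_ring_iff_ordP[OF P F(1)] local_ring_iff_ordP[OF P F(2)] by simp_all
        then have "Fin (- 1) \<le> ordP P (c * f)" "Fin (- 1) \<le> ordP P (c * g)"
          by (auto intro: order_trans[of _ 0] simp: zero_extended_def)
        ultimately show "hm_at P (c * f) (c * g)" unfolding at by simp
      next
        assume "hm_at P (c * f) (c * g)"
        then have A: "Fin (- 1) \<le> ordP P (c * g)" and d: "c * f - hfun n * (c * g) \<in> local_ring P"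
          unfolding at by simp_all
        have G: "c * g \<in> local_ring P"
        proof (rule ccontr)
          assume nG: "c * g \<notin> local_ring P"
          then have g0: "g \<noteq> 0" using P4 by (auto simp: local_ring_def)
          obtain j where j: "ordP P (c * g) = Fin j" using ordP_Fin[of "c * g"] g0 c by auto
          \<comment> \<open>The pole of \<open>c * g\<close> is exactly simple. Hence a regular
            product \<open>r * (c * g)\<close> puts \<open>r\<close> into the maximal ideal, against
            the assumption that the congruence fails.\<close>
          have "j = - 1" using A nG local_ring_iff_ordP[OF P F(2)] by (auto simp: j zero_extended_def)
          define r where "r = f / g - hfun n"
          have rK: "r \<in> fun_field"
            unfolding r_def diff_conv_add_uminus using fg hK by (intro fun_field_add fun_field_divide fun_field_uminus)
          have "c * f - hfun n * (c * g) = r * (c * g)" using g0 by (simp add: r_def field_simps)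
          then have "0 \<le> ordP P (r * (c * g))"
            using d local_ring_iff_ordP[OF P fun_field_mult[OF rK F(2)]] by simp
          then have "Fin 1 \<le> ordP P r"
            unfolding ordP_mult[OF P rK F(2)] j \<open>j = - 1\<close> by (cases "ordP P r") (auto simp: zero_extended_def)
          then have "r \<in> max_ideal P" using max_ideal_iff_ordP[OF P rK] by simp
          then show False using False g0 by (simp add: Q_def r_def)
        qed
        have "(c * f - hfun n * (c * g)) + hfun n * (c * g) \<in> local_ring P"
          by (rule local_ring_add[OF P4 d local_ring_mult[OF P4 hl G]])
        then show "c * f \<in> local_ring P \<and> c * g \<in> local_ring P" using G by simp
      qed
      then show ?thesis using loc unfolding hm_ord_def Q using False by simp
    qed
  qed
qed

section \<open>Sections of the cohomology sheaf over open sets\<close>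

lemma ker_q_nbhd:
  assumes "v \<in> stalk ker_q x" "x \<in> U" "zopen U"
  obtains W where "zopen W" "x \<in> W" "W \<subseteq> U" "v \<in> ker_q W"
proof -
  from assms(1) obtain W where W: "zopen W" "x \<in> W" "v \<in> ker_q W" unfolding stalk_def by blast
  have o: "zopen (W \<inter> U)" using W(1) assms(3) by (rule zopen_Int)
  have "v \<in> ker_q (W \<inter> U)" using W(3) unfolding ker_q_iff[OF W(1)] ker_q_iff[OF o] by blast
  then show ?thesis using that[OF o] W(2) assms(2) by blast
qed

lemma hm_vec_monad_p_stalk:
  assumes x: "x \<in> Proj4" and w: "hm_cond x f g w"
  shows "hm_vec (f, g) + monad_p w \<in> stalk ker_q x"
proof -
  have "monad_q (hm_vec (f, g) + monad_p w) = (\<lambda>_. 0)"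
    by (intro monad_q_add hm_vec_generic monad_p_generic monad_q_hm_vec monad_q_monad_p)
  then show ?thesis unfolding stalk_ker_q[OF x] using hm_cond_iff[OF x, of f g w] w by blast
qed

text \<open>A local representative of the class differs from \<open>hm_vec (f, g)\<close> by some
  p(w) with w over K, and its regularity is the condition on w. Conversely, witnesses are chosen
  point by point without any relation between them; injectivity of p on fibres makes the resulting
  classes agree near each point.\<close>

lemma hm_map_in_HM_iff:
  fixes f g :: "'k::field hfrac"
  assumes U: "zopen U" "U \<noteq> {}"
  shows "hm_map (f, g) \<in> HM U \<longleftrightarrow> (\<forall>x\<in>U. hm_at x f g)"
proof
  assume "hm_map (f, g) \<in> HM U"
  then obtain s where s: "s \<in> quot_sections ker_q im_p U" "s eta = hm_map (f, g)"
    unfolding HM_def quot_in_generic_def by (auto simp: image_iff)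
  show "\<forall>x\<in>U. hm_at x f g"
  proof
    fix x assume xU: "x \<in> U"
    obtain W t where W: "zopen W" "x \<in> W" and t: "t \<in> ker_q W" "\<forall>y\<in>W. s y = coset (stalk im_p y) t"
      using s(1) xU unfolding quot_sections_def by blast
    have x: "x \<in> Proj4" using W zopen_subset by blast
    have "s eta = coset (stalk im_p eta) t" using t(2) eta_in_zopen[OF W] by blast
    then have "t - hm_vec (f, g) \<in> stalk im_p eta"
      using s(2) coset_eq_iff[OF stalk_im_p_group[OF eta_Proj4], of t "hm_vec (f, g)"]
      unfolding hm_map_def by metis
    then obtain w where w: "t - hm_vec (f, g) = monad_p w" "\<forall>\<nu>. w$\<nu> \<in> twist_stalk 2 eta"
      unfolding stalk_im_p[OF eta_Proj4] by blast
    have tw: "t = hm_vec (f, g) + monad_p w" using w(1) by (simp add: diff_eq_eq add.commute)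
    have "fst t \<in> ext2_stalk x \<and> snd t \<in> ext2_stalk x" using t(1) W(2) unfolding ker_q_iff[OF W(1)] by blast
    then have "hm_cond x f g w" unfolding tw hm_cond_iff[OF x] .
    then show "hm_at x f g" unfolding hm_at_def using w(2) by blast
  qed
next
  assume "\<forall>x\<in>U. hm_at x f g"
  then obtain w where w: "\<And>x \<nu>. x \<in> U \<Longrightarrow> w x $ \<nu> \<in> twist_stalk 2 eta" "\<And>x. x \<in> U \<Longrightarrow> hm_cond x f g (w x)"
    unfolding hm_at_def by metis
  define v where "v = (\<lambda>x. hm_vec (f, g) + monad_p (w x))"
  define s where "s = (\<lambda>y. if y \<in> U then coset (stalk im_p y) (v y) else {})"
  have U4: "x \<in> Proj4" if "x \<in> U" for x using that U(1) zopen_subset by blast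
  have "\<exists>W. zopen W \<and> x \<in> W \<and> W \<subseteq> U \<and> (\<exists>t\<in>ker_q W. \<forall>y\<in>W. s y = coset (stalk im_p y) t)" if xU: "x \<in> U" for x
  proof -
    have "v x \<in> stalk ker_q x" unfolding v_def by (rule hm_vec_monad_p_stalk[OF U4[OF xU] w(2)[OF xU]])
    then obtain W where W: "zopen W" "x \<in> W" "W \<subseteq> U" "v x \<in> ker_q W"
      using xU U(1) by (rule ker_q_nbhd)
    have "s y = coset (stalk im_p y) (v x)" if yW: "y \<in> W" for y
    proof -
      have yU: "y \<in> U" using yW W(3) by blast
      have y: "y \<in> Proj4" using U4[OF yU] .
      have "fst (v x) \<in> ext2_stalk y \<and> snd (v x) \<in> ext2_stalk y" using W(4) yW unfolding ker_q_iff[OF W(1)] by blast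
      then have "hm_cond y f g (w x)" unfolding v_def hm_cond_iff[OF y] .
      \<comment> \<open>The witness chosen at \<open>x\<close> is also a witness at
        \<open>y\<close>, so the two choices differ by an element of V(2)_y and define the same
        class there.\<close>
      then have "hm_cond y 0 0 (w y - w x)" by (rule hm_cond_diff[OF y w(2)[OF yU]])
      then have "\<forall>\<nu>. (w y - w x)$\<nu> \<in> twist_stalk 2 y" using hm_cond_0_imp[OF y] by blast
      then have "monad_p (w y - w x) \<in> stalk im_p y" unfolding stalk_im_p[OF y] by blast
      moreover have "monad_p (w y - w x) = v y - v x"
        using monad_p_add[of "w y - w x" "w x"] by (simp add: v_def)
      ultimately have "coset (stalk im_p y) (v y) = coset (stalk im_p y) (v x)"
        using coset_eq_iff[OF stalk_im_p_group[OF y], of "v y" "v x"] by simp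
      then show ?thesis using yU by (simp add: s_def)
    qed
    then show ?thesis using W by blast
  qed
  then have "s \<in> quot_sections ker_q im_p U" unfolding quot_sections_def by (auto simp: s_def)
  moreover have "s eta = hm_map (f, g)"
  proof -
    obtain x where "x \<in> U" using U(2) by blast
    then have eU: "eta \<in> U" by (rule eta_in_zopen[OF U(1)])
    have "v eta - hm_vec (f, g) \<in> stalk im_p eta"
      unfolding v_def stalk_im_p[OF eta_Proj4] using w(1)[OF eU] by auto
    then show ?thesis
      using eU coset_eq_iff[OF stalk_im_p_group[OF eta_Proj4], of "v eta" "hm_vec (f, g)"]
      by (simp add: s_def hm_map_def)
  qed
  ultimately show "hm_map (f, g) \<in> HM U" unfolding HM_def quot_in_generic_def by (auto simp: image_iff)
qed

section \<open>Uniqueness of the Weil divisor of a divisorial sheaf\<close>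

lemma avoid_prime_divisors:
  fixes P :: "'k::field point"
  assumes P: "P \<in> prime_divisors" and S: "finite S" "S \<subseteq> prime_divisors" "P \<notin> S"
  obtains b e where "homog e b" "b \<notin> P" "\<And>Q. Q \<in> S \<Longrightarrow> b \<in> Q"
proof -
  have P4: "P \<in> Proj4" using P by (rule prime_divisor_Proj4)
  from S have "\<exists>b e. homog e b \<and> b \<notin> P \<and> (\<forall>Q\<in>S. b \<in> Q)"
  proof (induction S)
    case empty
    then show ?case using Proj4_1[OF P4] homog_1 by blast
  next
    case (insert Q S)
    then obtain b e where b: "homog e b" "b \<notin> P" "\<forall>Q\<in>S. b \<in> Q" by auto
    have Q: "Q \<in> prime_divisors" "Q \<noteq> P" using insert by auto
    obtain q m where q: "prime_elem q" "homog m q" "Q = {a. q dvd a}" using Q(1) by (rule prime_divisorE)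
    have qQ: "q \<in> Q" by (simp add: q(3))
    have "q \<notin> P"
    proof
      assume "q \<in> P"
      then have "Q \<subseteq> P" unfolding q(3) using Proj4_dvd[OF P4] by (intro subsetI) simp
      moreover have "eta \<subset> Q"
        using eta_subset[OF prime_divisor_Proj4[OF Q(1)]] Q(1) unfolding prime_divisors_def by blast
      ultimately show False using P Q prime_divisor_Proj4[OF Q(1)] unfolding prime_divisors_def by blast
    qed
    then have "b * q \<notin> P" using Proj4_mult[OF P4 b(2)] by simp
    moreover have "b * q \<in> Q" using Proj4_dvd[OF prime_divisor_Proj4[OF Q(1)] qQ] by simp
    moreover have "\<forall>Q'\<in>S. b * q \<in> Q'"
    proof
      fix Q' assume "Q' \<in> S"
      then have "Q' \<in> Proj4" "b \<in> Q'" using insert.prems b(3) prime_divisor_Proj4 by auto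
      then show "b * q \<in> Q'" by (rule Proj4_dvd) simp
    qed
    moreover have "homog (e + m) (b * q)" using b(1) q(2) by (rule homog_mult)
    ultimately show ?case by blast
  qed
  then show ?thesis using that by blast
qed

text \<open>A function of order exactly \<open>- D' P\<close> at \<open>P\<close> is allowed by
  \<open>D'\<close> but not by \<open>D\<close>. On a suitable open set containing \<open>P\<close>
  no other divisor imposes a restriction that it violates.\<close>

lemma divisor_sheaf_separates:
  fixes D D' :: "'k::field point \<Rightarrow> int"
  assumes D: "weil_divisor D" "weil_divisor D'" and P: "P \<in> prime_divisors" "D P < D' P"
  obtains U where "zopen U" "U \<noteq> {}" "divisor_sheaf D U \<noteq> divisor_sheaf D' U"
proof -
  obtain f where f: "f \<in> fun_field" "f \<noteq> 0" "ordP P f = Fin (- D' P)" using P(1) by (rule ordP_attains)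
  \<comment> \<open>The divisors other than \<open>P\<close> where \<open>f\<close> could violate
    the bound given by \<open>D'\<close>; away from them both \<open>D'\<close> and the order of
    \<open>f\<close> are 0.\<close>
  define S where "S = ({Q. D' Q \<noteq> 0} \<union> {Q \<in> prime_divisors. ordP Q f \<noteq> Fin 0}) - {P}"
  have "finite S" unfolding S_def using D(2) finite_ordP_neq_0[OF f(1,2)] by (simp add: weil_divisor_def)
  moreover have "S \<subseteq> prime_divisors" unfolding S_def using D(2) by (auto simp: weil_divisor_def)
  moreover have "P \<notin> S" by (simp add: S_def)
  ultimately obtain b e where b: "homog e b" "b \<notin> P" "\<And>Q. Q \<in> S \<Longrightarrow> b \<in> Q"
    by (rule avoid_prime_divisors[OF P(1)]) blast
  define U where "U = {x \<in> Proj4. b \<notin> x}"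
  have U: "zopen U" unfolding U_def using b(1) by (rule zopen_basic)
  have PU: "P \<in> U" using b(2) prime_divisor_Proj4[OF P(1)] by (simp add: U_def)
  have "0 \<le> Fin (D' Q) + ordP Q f" if Q: "Q \<in> prime_divisors \<inter> U" for Q
  proof (cases "Q = P")
    case True
    then show ?thesis using f(3) by (simp add: zero_extended_def)
  next
    case False
    have "Q \<notin> S" using Q b(3) by (auto simp: U_def)
    then have "D' Q = 0" "ordP Q f = Fin 0" using Q False by (auto simp: S_def)
    then show ?thesis by (simp add: zero_extended_def)
  qed
  then have "f \<in> divisor_sheaf D' U" using f by (simp add: divisor_sheaf_def)
  moreover have "f \<notin> divisor_sheaf D U"
  proof
    assume "f \<in> divisor_sheaf D U"
    then have "0 \<le> Fin (D P) + ordP P f" using f(2) P(1) PU by (simp add: divisor_sheaf_def)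
    then show False using f(3) P(2) by (simp add: zero_extended_def)
  qed
  ultimately have "divisor_sheaf D U \<noteq> divisor_sheaf D' U" by metis
  then show ?thesis using that U PU by blast
qed

lemma weil_divisor_unique:
  fixes D D' :: "'k::field point \<Rightarrow> int"
  assumes D: "weil_divisor D" "weil_divisor D'"
    and eq: "\<And>U. zopen U \<Longrightarrow> U \<noteq> {} \<Longrightarrow> divisor_sheaf D U = divisor_sheaf D' U"
  shows "D = D'"
proof (rule ext, rule ccontr)
  fix P assume ne: "D P \<noteq> D' P"
  then have P: "P \<in> prime_divisors" using D unfolding weil_divisor_def by force
  from ne have "D P < D' P \<or> D' P < D P" by linarith
  then show False
    using divisor_sheaf_separates[OF D P] divisor_sheaf_separates[OF D(2,1) P] eq by metis
qed

section \<open>Computation of the decoration\<close>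

lemma hm_ord_Fin:
  assumes "(f, g) \<noteq> (0, 0)" obtains d where "hm_ord f g P = Fin d"
proof -
  obtain m where "min (ordP P f) (ordP P g) = Fin m"
    using assms ordP_Fin[of f P] ordP_Fin[of g P] by (cases "f = 0"; cases "g = 0") auto
  then have "hm_ord f g P = Fin m \<or> hm_ord f g P = Fin (m + 1)"
    by (simp add: hm_ord_def one_extended_def)
  then show ?thesis using that by blast
qed

lemma weil_decoration_HM:
  fixes f g :: "'k::field hfrac"
  assumes fg: "f \<in> fun_field" "g \<in> fun_field" "(f, g) \<noteq> (0, 0)" and P: "P \<in> prime_divisors"
  shows "Fin (weil_decoration HM_scale HM (hm_map (f, g)) P) = hm_ord f g P"
proof -
  \<comment> \<open>\<open>weil_divisor\<close> demands the value 0 off the prime divisors. On them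
    \<open>hm_ord\<close> is finite, since f and g are not both 0, so the description picks an
    actual integer.\<close>
  define D where "D = (\<lambda>Q. if Q \<in> prime_divisors then (THE d. hm_ord f g Q = Fin d) else 0)"
  have DQ: "hm_ord f g Q = Fin (D Q)" if "Q \<in> prime_divisors" for Q
  proof -
    obtain d where "hm_ord f g Q = Fin d" using fg(3) by (rule hm_ord_Fin)
    then show ?thesis using that by (simp add: D_def)
  qed
  have D: "weil_divisor D"
    unfolding weil_divisor_def
  proof
    show sub: "{Q. D Q \<noteq> 0} \<subseteq> prime_divisors" by (auto simp: D_def)
    \<comment> \<open>The zero function has infinite order everywhere and never determines the
      minimum, so it contributes no divisor.\<close>
    let ?S = "\<lambda>h. if h = 0 then {} else {Q \<in> prime_divisors. ordP Q h \<noteq> Fin 0}"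
    have "Q \<in> ?S f \<union> ?S g \<union> range Hyp" if Q: "D Q \<noteq> 0" for Q
    proof (rule ccontr)
      assume n: "Q \<notin> ?S f \<union> ?S g \<union> range Hyp"
      have pd: "Q \<in> prime_divisors" using Q sub by blast
      have "f = 0 \<or> ordP Q f = Fin 0" "g = 0 \<or> ordP Q g = Fin 0" using n pd by (auto split: if_splits)
      then have "min (ordP Q f) (ordP Q g) = Fin 0" using fg(3) by auto
      moreover have "hm_ord f g Q = min (ordP Q f) (ordP Q g)" using n by (auto simp: hm_ord_def)
      ultimately show False using DQ[OF pd] Q by simp
    qed
    then have "{Q. D Q \<noteq> 0} \<subseteq> ?S f \<union> ?S g \<union> range Hyp" by blast
    moreover have "finite (?S f)" "finite (?S g)"
      using finite_ordP_neq_0[OF fg(1)] finite_ordP_neq_0[OF fg(2)] by auto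
    ultimately show "finite {Q. D Q \<noteq> 0}" by (elim finite_subset) simp
  qed
  have sheaf: "divisor_sheaf D U = {c \<in> fun_field. HM_scale c (hm_map (f, g)) \<in> HM U}"
    if U: "zopen U" "U \<noteq> {}" for U
  proof -
    have "c \<in> divisor_sheaf D U \<longleftrightarrow> HM_scale c (hm_map (f, g)) \<in> HM U" if c: "c \<in> fun_field" for c
    proof -
      have K: "c * f \<in> fun_field" "c * g \<in> fun_field" using c fg by (simp_all add: fun_field_mult)
      have "HM_scale c (hm_map (f, g)) \<in> HM U \<longleftrightarrow> (\<forall>x\<in>U. hm_at x (c * f) (c * g))"
        unfolding hm_map_scale[OF c, symmetric] by (rule hm_map_in_HM_iff[OF U])
      \<comment> \<open>Open sets are stable under generization, so every prime divisor through a
        point of \<open>U\<close> is itself a point of \<open>U\<close>.\<close>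
      also have "\<dots> \<longleftrightarrow> (\<forall>Q\<in>prime_divisors \<inter> U. hm_at Q (c * f) (c * g))"
      proof
        assume Q: "\<forall>Q\<in>prime_divisors \<inter> U. hm_at Q (c * f) (c * g)"
        show "\<forall>x\<in>U. hm_at x (c * f) (c * g)"
        proof
          fix x assume x: "x \<in> U"
          show "hm_at x (c * f) (c * g)"
          proof (rule hm_at_codim1[OF _ K])
            show "x \<in> Proj4" using x U(1) zopen_subset by blast
            fix Q' assume "Q' \<in> prime_divisors" "Q' \<subseteq> x"
            then show "hm_at Q' (c * f) (c * g)"
              using Q zopen_generization[OF U(1) x prime_divisor_Proj4] by blast
          qed
        qed
      qed blast
      also have "\<dots> \<longleftrightarrow> c \<in> divisor_sheaf D U"
      \<comment> \<open>The zero function belongs to \<open>divisor_sheaf\<close> by definition,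
        whereas \<open>hm_at_iff_hm_ord\<close> compares finite orders of \<open>c\<close>.\<close>
      proof (cases "c = 0")
        case True
        have "hm_at Q 0 0" if "Q \<in> prime_divisors" for Q :: "'k point"
          unfolding hm_at_def hm_cond_def using prime_divisor_Proj4[OF that]
          by (intro exI[of _ 0]) (simp add: eta_Proj4)
        then show ?thesis using True by (simp add: divisor_sheaf_def)
      next
        case False
        have "hm_at Q (c * f) (c * g) \<longleftrightarrow> 0 \<le> Fin (D Q) + ordP Q c" if "Q \<in> prime_divisors" for Q
          using hm_at_iff_hm_ord[OF that fg(1,2) c False] DQ[OF that] by (simp add: add.commute)
        then show ?thesis using False c by (simp add: divisor_sheaf_def)
      qed
      finally show ?thesis by simp
    qed
    moreover have "divisor_sheaf D U \<subseteq> fun_field" by (auto simp: divisor_sheaf_def)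
    ultimately show ?thesis by blast
  qed
  have "weil_decoration HM_scale HM (hm_map (f, g)) = D"
    unfolding weil_decoration_def
  proof (rule the_equality)
    show "weil_divisor D \<and> (\<forall>U. zopen U \<and> U \<noteq> {} \<longrightarrow>
        divisor_sheaf D U = {c \<in> fun_field. HM_scale c (hm_map (f, g)) \<in> HM U})"
      using D sheaf by blast
    fix D' assume "weil_divisor D' \<and> (\<forall>U. zopen U \<and> U \<noteq> {} \<longrightarrow>
        divisor_sheaf D' U = {c \<in> fun_field. HM_scale c (hm_map (f, g)) \<in> HM U})"
    then show "D' = D" using sheaf D by (intro weil_divisor_unique) simp_all
  qed
  then show ?thesis using DQ[OF P] by simp
qed

theorem theorem5p1:
  fixes K :: "'k::{alg_closed_field, field_char_0} hfrac set"
  assumes "K = fun_field"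
  shows "(\<forall>f\<in>K. \<forall>g\<in>K. hm_vec (f, g) \<in> stalk ker_q eta)
    \<and> bij_betw hm_map (K \<times> K) HM_eta
    \<and> (\<forall>u\<in>K \<times> K. \<forall>v\<in>K \<times> K. hm_map (u + v) = HM_add (hm_map u) (hm_map v))
    \<and> (\<forall>c\<in>K. \<forall>f\<in>K. \<forall>g\<in>K. hm_map (c * f, c * g) = HM_scale c (hm_map (f, g)))
    \<and> (\<forall>f\<in>K. \<forall>g\<in>K. \<forall>P\<in>prime_divisors. (f, g) \<noteq> (0, 0) \<longrightarrow>
        Fin (weil_decoration HM_scale HM (hm_map (f, g)) P) =
          (if \<exists>\<nu>. P = Hyp \<nu> \<and> quot_value_at P f g = hval \<nu>
           then min (ordP P f) (ordP P g) + 1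
           else min (ordP P f) (ordP P g)))"
  unfolding assms
proof (intro conjI ballI impI)
  fix f g :: "'k hfrac" and P :: "'k point"
  assume "f \<in> fun_field" "g \<in> fun_field" "P \<in> prime_divisors" "(f, g) \<noteq> (0, 0)"
  then show "Fin (weil_decoration HM_scale HM (hm_map (f, g)) P) =
      (if \<exists>\<nu>. P = Hyp \<nu> \<and> quot_value_at P f g = hval \<nu>
       then min (ordP P f) (ordP P g) + 1 else min (ordP P f) (ordP P g))"
    using weil_decoration_HM[of f g P] unfolding hm_ord_def by simp
qed (simp_all add: hm_vec_stalk_ker_q hm_map_bij hm_map_add hm_map_scale)

end
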